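(* For any integer $n\ge5$, the complete graph $K_n$ satisfies $h\ell(K_n)=\ell(K_n)=\mathrm{bt}(K_n)=\lceil \tfrac{n}{2}\rceil$.
   Context: All graphs are connected, undirected, simple and finite. A graph is Hamiltonian if it contains a cycle that visits every vertex exactly once. For $n\ge1$, an $n$-book consists of a line $L$ (the spine of the book) and $n$ distinct half-planes (pages) with boundary $L$; an $n$-book embedding of $G$ is an embedding of $G$ in an $n$-book such that each vertex lies on $L$ and each edge lies in the interior of one page. The book thickness $\mathrm{bt}(G)$ is the smallest $n$ such that $G$ has an $n$-book embedding. A graph embedding is an embedding $G\to S^3$, up to ambient isotopy; the spatial graph $\mathcal{G}$ is its image up to ambient isotopy. Everything is tame (piecewise linear). A cycle is unknotted if it can be embedded as the equator of a sphere $S^2$. The fragments of a graph $G$ with respect to a cycle $C$ are the closures of the connected components of $G-C$ (topologically; so an edge not in $C$ with both endpoints on $C$ is a fragment). A diagram of $\mathcal{G}$ is the image of a projection of $\mathcal{G}$ to $\mathbb{R}^2$ such that all intersections are transversal, no vertices and at most two points are mapped to a crossing, and at each double point over/under information is assigned. It is reduced if no Reidemeister moves of type 1 and 2 can be applied to reduce its number of crossings. $\mathcal{G}$ is semi-leveled if there is an unknotted cycle $C$ (the spine) and a diagram $D$ of $\mathcal{G}$ (a semi-leveled diagram) in which no fragment with respect to $C$ has self-crossings, crossings with $C$, or both over- and under-crossings with another fragment. A reduced semi-leveled diagram in which every fragment lies in the bounded connected component of $\mathbb{R}^2\setminus C$ is divided in levels if there is a partition $\{L_1,\dots,L_n\}$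 of all the fragments such that $L_1$ is the set of fragments that do not cross over any other fragment, and for $i>1$ the set $L_i$ consists of the fragments that cross over at least one fragment in $L_{i-1}$ and only cross over fragments in sets $L_k$ with $k<i$; then $n$ is the number of levels. A connected spatial graph is leveled (with spine $C$) if it has a semi-leveled diagram (with spine $C$) that is divided in levels; it is Hamiltonian leveled if the spine is a Hamiltonian cycle of the underlying graph. The level number $\ell(\mathcal{G})$ of a spatial graph is the minimum number of levels ranging over all possible spines, with $\ell(\mathcal{G})=\infty$ if $\mathcal{G}$ admits no leveled embedding; $\ell(G)$ of an abstract graph is the minimum of $\ell(\mathcal{G})$ over all embeddings of $G$. The Hamiltonian level number $h\ell(\mathcal{G})$ is the minimum number of levels ranging over all choices of Hamiltonian spines for a Hamiltonian leveled embedding of $\mathcal{G}$; $h\ell(G)$ of an abstract Hamiltonian graph is the minimum over all its embeddings. *)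

theory Defs
  imports "HOL-Analysis.Analysis" "HOL-Library.Extended_Nat" "HOL-Library.Disjoint_Sets"
begin

section \<open>Finite simple graphs\<close>

record 'v ugraph =
  verts :: "'v set"
  edges :: "'v set set"

definition complete_graph :: "nat \<Rightarrow> nat ugraph" where
  "complete_graph n = \<lparr> verts = {..<n}, edges = {e. e \<subseteq> {..<n} \<and> card e = 2} \<rparr>"

text \<open>A cycle is given by the cyclic list of its vertices.\<close>

definition cycle_edges :: "'v list \<Rightarrow> 'v set set" where
  "cycle_edges vs = {{vs ! i, vs ! (Suc i mod length vs)} | i. i < length vs}"

definition is_cycle :: "'v ugraph \<Rightarrow> 'v list \<Rightarrow> bool" where
  "is_cycle G vs \<longleftrightarrow> 3 \<le> length vs \<and> distinct vs \<and> set vs \<subseteq> verts G \<and> cycle_edges vs \<subseteq> edges G"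

definition is_hamiltonian_cycle :: "'v ugraph \<Rightarrow> 'v list \<Rightarrow> bool" where
  "is_hamiltonian_cycle G vs \<longleftrightarrow> is_cycle G vs \<and> set vs = verts G"


section \<open>Embeddings of graphs\<close>

text \<open>
  A drawing records the position of every vertex and the point set of every (closed) edge;
  thus an embedding of the topological realisation of a graph is determined up to
  reparametrisation of the edges.
\<close>

record ('v, 'a) drawing =
  vpos :: "'v \<Rightarrow> 'a"
  epos :: "'v set \<Rightarrow> 'a set"

definition embedding :: "'v ugraph \<Rightarrow> ('v, 'a::topological_space) drawing \<Rightarrow> bool" where
  "embedding G D \<longleftrightarrow>
     inj_on (vpos D) (verts G) \<and>
     (\<forall>e\<in>edges G. \<exists>u v g. e = {u, v} \<and> arc g \<and> pathstart g = vpos D u \<and> pathfinish g = vpos D v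
        \<and> epos D e = path_image g) \<and>
     (\<forall>e\<in>edges G. epos D e \<inter> vpos D ` verts G = vpos D ` e) \<and>
     (\<forall>e\<in>edges G. \<forall>f\<in>edges G. e \<noteq> f \<longrightarrow> epos D e \<inter> epos D f = vpos D ` (e \<inter> f))"

definition support :: "'v ugraph \<Rightarrow> ('v, 'a) drawing \<Rightarrow> 'a set" where
  "support G D = vpos D ` verts G \<union> (\<Union>e\<in>edges G. epos D e)"

definition cycle_support :: "'v list \<Rightarrow> ('v, 'a) drawing \<Rightarrow> 'a set" where
  "cycle_support vs D = (\<Union>e\<in>cycle_edges vs. epos D e)"

text \<open>
  Three-space is the product of the plane of projection, represented by the complex numbers,
  and a height axis. The projection is \<open>fst\<close>; of two points with the same projection, the one
  with the larger \<open>snd\<close> lies over the other.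
\<close>

type_synonym R3 = "complex \<times> real"

definition piecewise_linear :: "'a::euclidean_space set \<Rightarrow> bool" where
  "piecewise_linear S \<longleftrightarrow> (\<exists>P. finite P \<and> (\<forall>p\<in>P. polytope p) \<and> S = \<Union>P)"

definition pl_embedding :: "'v ugraph \<Rightarrow> ('v, R3) drawing \<Rightarrow> bool" where
  "pl_embedding G D \<longleftrightarrow> embedding G D \<and> (\<forall>e\<in>edges G. piecewise_linear (epos D e))"


section \<open>Spatial graphs in the three-sphere\<close>

definition S3 :: "(R3 \<times> real) set" where
  "S3 = sphere 0 1"

text \<open>Inverse stereographic projection, identifying three-space with \<open>S3\<close> minus its north pole.\<close>

definition inv_stereo :: "R3 \<Rightarrow> R3 \<times> real" where
  "inv_stereo x = ((2 / ((norm x)\<^sup>2 + 1)) *\<^sub>R x, ((norm x)\<^sup>2 - 1) / ((norm x)\<^sup>2 + 1))"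

definition to_S3 :: "('v, R3) drawing \<Rightarrow> ('v, R3 \<times> real) drawing" where
  "to_S3 D = \<lparr> vpos = (\<lambda>v. inv_stereo (vpos D v)), epos = (\<lambda>e. inv_stereo ` epos D e) \<rparr>"

definition ambient_isotopic ::
  "'v ugraph \<Rightarrow> ('v, R3 \<times> real) drawing \<Rightarrow> ('v, R3 \<times> real) drawing \<Rightarrow> bool" where
  "ambient_isotopic G D D' \<longleftrightarrow>
     (\<exists>H :: real \<Rightarrow> R3 \<times> real \<Rightarrow> R3 \<times> real.
        continuous_on ({0..1} \<times> S3) (\<lambda>(t, x). H t x) \<and>
        (\<forall>t\<in>{0..1}. \<exists>K. homeomorphism S3 S3 (H t) K) \<and>
        (\<forall>x\<in>S3. H 0 x = x) \<and>
        (\<forall>v\<in>verts G. H 1 (vpos D v) = vpos D' v) \<and>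
        (\<forall>e\<in>edges G. H 1 ` epos D e = epos D' e))"

text \<open>
  The piecewise linear representatives in three-space of the ambient isotopy class of an
  embedding into \<open>S3\<close>; the embedding is tame if there is one.
\<close>

definition pl_representative :: "'v ugraph \<Rightarrow> ('v, R3 \<times> real) drawing \<Rightarrow> ('v, R3) drawing \<Rightarrow> bool" where
  "pl_representative G \<G> D \<longleftrightarrow> pl_embedding G D \<and> ambient_isotopic G \<G> (to_S3 D)"

definition spatial_embedding :: "'v ugraph \<Rightarrow> ('v, R3 \<times> real) drawing \<Rightarrow> bool" where
  "spatial_embedding G \<G> \<longleftrightarrow>
     embedding G \<G> \<and> support G \<G> \<subseteq> S3 \<and> (\<exists>D. pl_representative G \<G> D)"

text \<open>A closed curve is unknotted if it is the equator of a (tamely) embedded two-sphere.\<close>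

definition unknotted :: "R3 set \<Rightarrow> bool" where
  "unknotted C \<longleftrightarrow>
     (\<exists>S h k. piecewise_linear S \<and> homeomorphism (sphere (0::R3) 1) S h k \<and>
        h ` {x \<in> sphere 0 1. snd x = 0} = C)"


section \<open>Diagrams\<close>

definition straight_at :: "R3 set \<Rightarrow> R3 \<Rightarrow> R3 \<Rightarrow> bool" where
  "straight_at X a u \<longleftrightarrow> (\<exists>r>0. X \<inter> ball a r = range (\<lambda>t. a + t *\<^sub>R u) \<inter> ball a r)"

text \<open>
  A piecewise linear embedding in three-space has a diagram if its projection is regular. As
  usual for piecewise linear diagrams, transversality at a double point means that both
  strands are straight there, with linearly independent projected directions.
\<close>

definition diagram :: "'v ugraph \<Rightarrow> ('v, R3) drawing \<Rightarrow> bool" where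
  "diagram G D \<longleftrightarrow>
     (let X = support G D in
       (\<forall>a\<in>X. \<forall>b\<in>X. \<forall>c\<in>X. fst a = fst b \<and> fst b = fst c \<longrightarrow> a = b \<or> b = c \<or> a = c) \<and>
       (\<forall>v\<in>verts G. \<forall>a\<in>X. fst a = fst (vpos D v) \<longrightarrow> a = vpos D v) \<and>
       (\<forall>a\<in>X. \<forall>b\<in>X. a \<noteq> b \<and> fst a = fst b \<longrightarrow>
          (\<exists>u w. straight_at X a u \<and> straight_at X b w \<and>
             fst u \<noteq> fst w \<and> independent {fst u, fst w})))"

text \<open>
  A crossing-reducing Reidemeister move of type 1 or 2 is applicable exactly at an empty
  monogon, respectively at an empty bigon one of whose sides lies over the other one at both
  corners. The sides run in edges and contain no vertices.
\<close>

definition reducing_R1 :: "'v ugraph \<Rightarrow> ('v, R3) drawing \<Rightarrow> bool" where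
  "reducing_R1 G D \<longleftrightarrow>
     (\<exists>e\<in>edges G. \<exists>g. arc g \<and> path_image g \<subseteq> epos D e - vpos D ` verts G \<and>
        simple_path (fst \<circ> g) \<and> fst (pathstart g) = fst (pathfinish g) \<and>
        inside (path_image (fst \<circ> g)) \<inter> fst ` support G D = {})"

definition reducing_R2 :: "'v ugraph \<Rightarrow> ('v, R3) drawing \<Rightarrow> bool" where
  "reducing_R2 G D \<longleftrightarrow>
     (\<exists>e\<in>edges G. \<exists>f\<in>edges G. \<exists>g h. arc g \<and> arc h \<and>
        path_image g \<subseteq> epos D e - vpos D ` verts G \<and>
        path_image h \<subseteq> epos D f - vpos D ` verts G \<and>
        fst (pathstart g) = fst (pathstart h) \<and> snd (pathstart h) < snd (pathstart g) \<and>
        fst (pathfinish g) = fst (pathfinish h) \<and> snd (pathfinish h) < snd (pathfinish g) \<and>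
        simple_path ((fst \<circ> g) +++ reversepath (fst \<circ> h)) \<and>
        inside (path_image ((fst \<circ> g) +++ reversepath (fst \<circ> h))) \<inter> fst ` support G D = {})"

definition reduced :: "'v ugraph \<Rightarrow> ('v, R3) drawing \<Rightarrow> bool" where
  "reduced G D \<longleftrightarrow> \<not> reducing_R1 G D \<and> \<not> reducing_R2 G D"


section \<open>Leveled spatial graphs\<close>

definition fragments :: "'v ugraph \<Rightarrow> ('v, R3) drawing \<Rightarrow> 'v list \<Rightarrow> R3 set set" where
  "fragments G D vs = closure ` components (support G D - cycle_support vs D)"

definition crosses_over :: "R3 set \<Rightarrow> R3 set \<Rightarrow> bool" where
  "crosses_over f g \<longleftrightarrow> (\<exists>a\<in>f. \<exists>b\<in>g. fst a = fst b \<and> snd b < snd a)"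

text \<open>
  The condition that the spine has no self-crossings is what gives a meaning to ``the bounded
  component'' of its complement in the plane.
\<close>

definition semi_leveled_diagram :: "'v ugraph \<Rightarrow> ('v, R3) drawing \<Rightarrow> 'v list \<Rightarrow> bool" where
  "semi_leveled_diagram G D vs \<longleftrightarrow>
     is_cycle G vs \<and> unknotted (cycle_support vs D) \<and> diagram G D \<and>
     inj_on fst (cycle_support vs D) \<and>
     (\<forall>f\<in>fragments G D vs. inj_on fst f) \<and>
     (\<forall>f\<in>fragments G D vs. \<forall>a\<in>f. \<forall>b\<in>cycle_support vs D. fst a = fst b \<longrightarrow> a = b) \<and>
     (\<forall>f\<in>fragments G D vs. \<forall>g\<in>fragments G D vs. f \<noteq> g \<longrightarrow>
        \<not> (crosses_over f g \<and> crosses_over g f))"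

text \<open>Fragments are closed, so they meet the spine; the rest of a fragment lies inside of it.\<close>

definition divided_in_levels ::
  "'v ugraph \<Rightarrow> ('v, R3) drawing \<Rightarrow> 'v list \<Rightarrow> nat \<Rightarrow> bool" where
  "divided_in_levels G D vs n \<longleftrightarrow>
     semi_leveled_diagram G D vs \<and> reduced G D \<and>
     (\<forall>f\<in>fragments G D vs.
        fst ` (f - cycle_support vs D) \<subseteq> inside (fst ` cycle_support vs D)) \<and>
     (\<exists>L :: nat \<Rightarrow> R3 set set.
        inj_on L {1..n} \<and> partition_on (fragments G D vs) (L ` {1..n}) \<and>
        (1 \<le> n \<longrightarrow>
           L 1 = {f \<in> fragments G D vs. \<forall>g\<in>fragments G D vs. g \<noteq> f \<longrightarrow> \<not> crosses_over f g}) \<and>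
        (\<forall>i\<in>{2..n}.
           L i = {f \<in> fragments G D vs. (\<exists>g\<in>L (i - 1). crosses_over f g) \<and>
             (\<forall>g\<in>fragments G D vs. crosses_over f g \<longrightarrow> (\<exists>k\<in>{1..<i}. g \<in> L k))}))"

text \<open>
  The infimum of a non-empty set of extended naturals is its minimum, and that of the empty
  set is \<open>\<infinity>\<close>.
\<close>

definition spatial_level_number :: "'v ugraph \<Rightarrow> ('v, R3 \<times> real) drawing \<Rightarrow> enat" where
  "spatial_level_number G \<G> =
     Inf {enat n | n D vs. pl_representative G \<G> D \<and> divided_in_levels G D vs n}"

definition level_number :: "'v ugraph \<Rightarrow> enat" where
  "level_number G = (INF \<G>\<in>{\<G>. spatial_embedding G \<G>}. spatial_level_number G \<G>)"

definition spatial_hamiltonian_level_number :: "'v ugraph \<Rightarrow> ('v, R3 \<times> real) drawing \<Rightarrow> enat" where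
  "spatial_hamiltonian_level_number G \<G> =
     Inf {enat n | n D vs. pl_representative G \<G> D \<and> is_hamiltonian_cycle G vs \<and>
       divided_in_levels G D vs n}"

definition hamiltonian_level_number :: "'v ugraph \<Rightarrow> enat" where
  "hamiltonian_level_number G =
     (INF \<G>\<in>{\<G>. spatial_embedding G \<G>}. spatial_hamiltonian_level_number G \<G>)"


section \<open>Book thickness\<close>

definition is_book :: "nat \<Rightarrow> R3 set \<Rightarrow> R3 set set \<Rightarrow> bool" where
  "is_book n L P \<longleftrightarrow> finite P \<and> card P = n \<and>
     (\<exists>a u. u \<noteq> 0 \<and> L = range (\<lambda>t. a + t *\<^sub>R u) \<and>
        (\<forall>H\<in>P. \<exists>w. w \<noteq> u \<and> independent {u, w} \<and>
           H = {a + t *\<^sub>R u + s *\<^sub>R w | t s. 0 \<le> s}))"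

text \<open>Here \<open>H - L\<close> is the interior of the page \<open>H\<close>, and an edge is taken without its endpoints.\<close>

definition book_embedding :: "'v ugraph \<Rightarrow> nat \<Rightarrow> ('v, R3) drawing \<Rightarrow> bool" where
  "book_embedding G n D \<longleftrightarrow> pl_embedding G D \<and>
     (\<exists>L P. is_book n L P \<and> vpos D ` verts G \<subseteq> L \<and>
        (\<forall>e\<in>edges G. \<exists>H\<in>P. epos D e - vpos D ` e \<subseteq> H - L))"

definition book_thickness :: "'v ugraph \<Rightarrow> enat" where
  "book_thickness G = Inf {enat n | n. 1 \<le> n \<and> (\<exists>D. book_embedding G n D)}"

end

theory Submission
  imports Defs
begin


text \<open>
  Let \<open>b = \<lceil>n/2\<rceil>\<close>. All three invariants come from one count. Call two edges \<open>ij\<close> and \<open>kl\<close> of an \<open>n\<close>-gon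
  interleaved if \<open>i < k < j < l\<close>. Pairwise non-interleaved diagonals number at most \<open>n - 3\<close>, and there
  are \<open>n(n-3)/2\<close> diagonals, so a colouring of them in which interleaved diagonals get different
  colours needs at least \<open>n/2\<close> colours (\<open>noncrossing_colouring_bound\<close>). In the other direction
  the colour \<open>((i + j) mod n) div 2\<close> separates all interleaved pairs and takes only \<open>b\<close> values
  (\<open>page_noncrossing\<close>): in a regular \<open>n\<close>-gon the chords with a fixed \<open>i + j mod n\<close> are parallel,
  and two neighbouring parallel classes together form a zigzag.
  
  For books, two edges with interleaved ends cannot lie in one half-plane
  (\<open>half_plane_chords_meet\<close>), so the pages colour the diagonals; conversely, nested arches drawn in
  the pages given by the colour above form a book embedding.
  
  For the lower bound on levels, give every edge outside the spine \<open>C\<close> the level of its fragment.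
  The spine and the edges of one level project to a plane graph, drawn inside the Jordan curve \<open>C\<close>
  (\<open>edge_levels\<close>, \<open>level_planar_embedding\<close>), and a theta-curve argument shows that a level contains
  no interleaved chords. If \<open>C\<close> is Hamiltonian, the count above applies. If exactly one vertex \<open>v\<close>
  is not on \<open>C\<close>, all edges at \<open>v\<close> have the same level, this level contains no chord of \<open>C\<close>, and
  the remaining \<open>N - 1\<close> levels colour the diagonals of an \<open>(n-1)\<close>-gon, so that
  \<open>n - 1 \<le> 2 (N - 1)\<close>. Two vertices off \<open>C\<close> would lie in one fragment and both be joined to three
  vertices of \<open>C\<close> inside the disc, which is impossible (\<open>no_two_hubs\<close>).
  
  For the upper bound on Hamiltonian levels, place the vertices on a parabola so that no three
  chords with distinct ends are concurrent, draw the edges as straight chords in the projection,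
  leave the sides of the convex polygon at height \<open>0\<close>, and lift every diagonal to a height that
  grows quickly with its colour. Of two crossing diagonals the one of the larger colour lies over
  the other, hence the relation of crossing over is ranked by the colour and there are at most \<open>b\<close>
  levels (\<open>levels_of_ranked_relation\<close>). A Hamiltonian level number is at least the level
  number, which closes the chain of inequalities.
\<close>

section \<open>Colouring the diagonals of a polygon\<close>

definition diagonals :: "nat \<Rightarrow> (nat \<times> nat) set" where
  "diagonals n = {(i, j). i + 2 \<le> j \<and> j < n \<and> (i, j) \<noteq> (0, n - 1)}"

definition interleaved :: "nat \<times> nat \<Rightarrow> nat \<times> nat \<Rightarrow> bool" where
  "interleaved p q \<longleftrightarrow> fst p < fst q \<and> fst q < snd p \<and> snd p < snd q"

lemma finite_diagonals: "finite (diagonals n)"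
  by (rule finite_subset[of _ "{..<n} \<times> {..<n}"]) (auto simp: diagonals_def)

text \<open>
  A non-crossing set of diagonals of the polygon with vertices \<open>a, \<dots>, b\<close> that may include the
  base edge \<open>(a, b)\<close> is part of a triangulation, in which the diagonals and the base are in
  bijection with the \<open>b - a - 1\<close> triangles. The induction cuts the polygon at the far end \<open>m\<close> of the
  longest remaining diagonal at \<open>a\<close>; nothing straddles \<open>m\<close>.
\<close>

lemma noncrossing_card_le:
  assumes "S \<subseteq> {(i, j). a \<le> i \<and> i + 2 \<le> j \<and> j \<le> b}" "a < b"
    and "\<And>p q. p \<in> S \<Longrightarrow> q \<in> S \<Longrightarrow> \<not> interleaved p q"
  shows "card S \<le> b - a - 1"
  using assms
proof (induction "b - a" arbitrary: a b S rule: less_induct)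
  case less
  have fin: "finite S"
    by (rule finite_subset[of _ "{..b} \<times> {..b}"]) (use less.prems(1) in auto)
  show ?case
  proof (cases "b = a + 1")
    case True
    then have "S = {}" using less.prems(1) by force
    then show ?thesis by simp
  next
    case False
    \<comment> \<open>The neighbour \<open>a + 1\<close> stands in when \<open>a\<close> has no diagonal other than the base.\<close>
    define J where "J = insert (a + 1) {j. j < b \<and> (a, j) \<in> S}"
    define m where "m = Max J"
    have finJ: "finite J" unfolding J_def by simp
    have mJ: "m \<in> J" unfolding m_def by (rule Max_in) (auto simp: J_def)
    have mmax: "j \<le> m" if "j \<in> J" for j unfolding m_def using finJ that by simp
    have ab: "a < m" "m < b"
      using mJ less.prems(1,2) False unfolding J_def by auto
    have split: "j \<le> m \<or> m \<le> i" if ij: "(i, j) \<in> S - {(a, b)}" for i j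
    proof (rule ccontr)
      assume "\<not> (j \<le> m \<or> m \<le> i)"
      then have *: "i < m" "m < j" by auto
      have bounds: "a \<le> i" "j \<le> b" using ij less.prems(1) by auto
      show False
      proof (cases "i = a")
        case True
        then have "j \<in> J" using ij bounds unfolding J_def by auto
        then show False using mmax * by force
      next
        case False
        then have "(a, m) \<in> S" using mJ * bounds unfolding J_def by auto
        then show False
          using less.prems(3)[of "(a, m)" "(i, j)"] ij * bounds False by (auto simp: interleaved_def)
      qed
    qed
    define S1 where "S1 = S \<inter> {(i, j). j \<le> m}"
    define S2 where "S2 = S \<inter> {(i, j). m \<le> i}"
    have "S \<subseteq> insert (a, b) (S1 \<union> S2)" using split unfolding S1_def S2_def by fastforce
    then have "card S \<le> card (insert (a, b) (S1 \<union> S2))"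
      by (rule card_mono[rotated]) (use fin in \<open>auto simp: S1_def S2_def\<close>)
    also have "\<dots> \<le> 1 + (card S1 + card S2)"
      using card_Un_le[of S1 S2] card_insert_le_m1[of "1 + (card S1 + card S2)" "S1 \<union> S2" "(a,b)"]
      by simp
    also have "card S1 \<le> m - a - 1"
      using less.prems by (intro less.hyps) (use ab in \<open>auto simp: S1_def\<close>)
    also have "card S2 \<le> b - m - 1"
      using less.prems by (intro less.hyps) (use ab in \<open>auto simp: S2_def\<close>)
    finally have "card S \<le> 1 + ((m - a - 1) + (b - m - 1))" by simp
    then show ?thesis using ab by linarith
  qed
qed

lemma card_diagonals:
  assumes "3 \<le> n"
  shows "2 * card (diagonals n) = n * (n - 3)"
  using assms
proof (induction n rule: dec_induct)
  case base
  have "diagonals 3 = {}" unfolding diagonals_def by auto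
  then show ?case by simp
next
  case (step n)
  let ?N = "(\<lambda>i. (i, n)) ` {1..n - 2}"
  have eq: "diagonals (Suc n) = insert (0, n - 1) (diagonals n \<union> ?N)"
    using step.hyps unfolding diagonals_def by (auto simp: image_iff)
  have "card (diagonals n \<union> ?N) = card (diagonals n) + (n - 2)"
    by (subst card_Un_disjoint)
       (use finite_diagonals in \<open>auto simp: diagonals_def card_image inj_on_def\<close>)
  moreover have "(0, n - 1) \<notin> diagonals n \<union> ?N" by (auto simp: diagonals_def)
  ultimately have "card (diagonals (Suc n)) = Suc (card (diagonals n) + (n - 2))"
    unfolding eq by (simp add: finite_diagonals)
  then have "2 * card (diagonals (Suc n)) = n * (n - 3) + 2 * (n - 1)"
    using step by simp
  also have "\<dots> = Suc n * (Suc n - 3)"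
  proof -
    obtain k where "n = k + 3" using step.hyps by (metis add.commute le_Suc_ex)
    then show ?thesis by (simp add: algebra_simps)
  qed
  finally show ?case .
qed

text \<open>
  Each colour class has at most \<open>n - 3\<close> diagonals: together with the base edge \<open>(0, n - 1)\<close>, which
  is interleaved with nothing, it has at most \<open>n - 2\<close> elements.
\<close>

lemma noncrossing_colouring_bound:
  assumes n: "4 \<le> n" and C: "finite C" "c ` diagonals n \<subseteq> C"
    and nc: "\<And>p q. p \<in> diagonals n \<Longrightarrow> q \<in> diagonals n \<Longrightarrow> interleaved p q \<Longrightarrow> c p \<noteq> c q"
  shows "n \<le> 2 * card C"
proof -
  have small: "card {p \<in> diagonals n. c p = x} \<le> n - 3" for x
  proof -
    let ?S = "{p \<in> diagonals n. c p = x}"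
    have "card (insert (0, n - 1) ?S) \<le> (n - 1) - 0 - 1"
    proof (rule noncrossing_card_le)
      show "insert (0, n - 1) ?S \<subseteq> {(i, j). 0 \<le> i \<and> i + 2 \<le> j \<and> j \<le> n - 1}"
        using n by (auto simp: diagonals_def)
      show "\<not> interleaved p q" if "p \<in> insert (0, n - 1) ?S" "q \<in> insert (0, n - 1) ?S" for p q
      proof (cases "p = (0, n - 1) \<or> q = (0, n - 1)")
        case True
        then show ?thesis using that n by (auto simp: interleaved_def diagonals_def)
      next
        case False
        then show ?thesis using that nc[of p q] by auto
      qed
    qed (use n in auto)
    moreover have "(0, n - 1) \<notin> ?S" by (auto simp: diagonals_def)
    ultimately show ?thesis using finite_diagonals[of n] by simp
  qed
  have "diagonals n = (\<Union>x\<in>C. {p \<in> diagonals n. c p = x})" using C(2) by auto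
  then have "card (diagonals n) \<le> (\<Sum>x\<in>C. card {p \<in> diagonals n. c p = x})"
    using card_UN_le[OF C(1), of "\<lambda>x. {p \<in> diagonals n. c p = x}"] by presburger
  also have "\<dots> \<le> card C * (n - 3)" using sum_bounded_above[of C, OF small] by simp
  finally have "2 * card (diagonals n) \<le> 2 * card C * (n - 3)" by simp
  moreover have "2 * card (diagonals n) = n * (n - 3)" using n by (intro card_diagonals) simp
  ultimately have "n * (n - 3) \<le> 2 * card C * (n - 3)" by (simp only:)
  moreover have "0 < n - 3" using n by simp
  ultimately show ?thesis using mult_le_cancel2 by blast
qed

definition page :: "nat \<Rightarrow> nat \<times> nat \<Rightarrow> nat" where
  "page n p = ((fst p + snd p) mod n) div 2"

lemma page_less: "0 < n \<Longrightarrow> page n p < (n + 1) div 2"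
  unfolding page_def using mod_less_divisor[of n "fst p + snd p"] by linarith

text \<open>
  If \<open>i < k < j < l < n\<close>, then \<open>k + l\<close> exceeds \<open>i + j\<close> by at least \<open>2\<close> and at most \<open>n - 2\<close>, so the
  residues of the two sums modulo \<open>n\<close> are at cyclic distance at least \<open>2\<close> and cannot both lie
  in a pair \<open>{2c, 2c + 1}\<close>.
\<close>

lemma page_noncrossing:
  assumes "interleaved p q" "snd q < n"
  shows "page n p \<noteq> page n q"
proof
  assume eq: "page n p = page n q"
  obtain i j k l where pq: "p = (i, j)" "q = (k, l)" by (cases p, cases q)
  have o: "i < k" "k < j" "j < l" "l < n" using assms by (auto simp: interleaved_def pq)
  define d where "d = k + l - (i + j)"
  have d: "2 \<le> d" "d + 2 \<le> n" "k + l = (i + j) + d" using o by (auto simp: d_def)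
  define r where "r = (i + j) mod n"
  have r: "r < n" using o unfolding r_def by simp
  have "(k + l) mod n = (r + d) mod n" unfolding d(3) r_def by (simp add: mod_simps)
  also have "\<dots> = (if r + d < n then r + d else r + d - n)"
    using r d by (simp add: mod_if)
  finally have "(k + l) mod n = (if r + d < n then r + d else r + d - n)" .
  moreover have "r div 2 = ((k + l) mod n) div 2"
    using eq unfolding page_def pq r_def by simp
  ultimately show False using d r by (auto split: if_splits)
qed

section \<open>Levels of a ranked relation\<close>

text \<open>
  The levels are the ranks of the well-founded relation \<open>R\<close>: with \<open>D k\<close> the set of elements from
  which all descending chains have length at most \<open>k\<close>, level \<open>i\<close> is \<open>D i - D (i - 1)\<close>. The rank is at
  most \<open>r f + 1\<close> for any function \<open>r\<close> that decreases along \<open>R\<close>, and the levels up to the maximal rank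
  are non-empty because \<open>D\<close> stays constant once two successive values agree.
\<close>

lemma levels_of_ranked_relation:
  fixes R :: "'a \<Rightarrow> 'a \<Rightarrow> bool" and r :: "'a \<Rightarrow> nat"
  assumes "\<And>f. f \<in> F \<Longrightarrow> r f < N"
    and r: "\<And>f g. f \<in> F \<Longrightarrow> g \<in> F \<Longrightarrow> R f g \<Longrightarrow> r g < r f"
  shows "\<exists>n\<le>N. \<exists>L :: nat \<Rightarrow> 'a set. inj_on L {1..n} \<and> partition_on F (L ` {1..n}) \<and>
     (1 \<le> n \<longrightarrow> L 1 = {f \<in> F. \<forall>g\<in>F. g \<noteq> f \<longrightarrow> \<not> R f g}) \<and>
     (\<forall>i\<in>{2..n}. L i = {f \<in> F. (\<exists>g\<in>L (i - 1). R f g) \<and>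
        (\<forall>g\<in>F. R f g \<longrightarrow> (\<exists>k\<in>{1..<i}. g \<in> L k))})"
proof -
  define D :: "nat \<Rightarrow> 'a set"
    where "D = rec_nat {} (\<lambda>_ X. {f \<in> F. \<forall>g\<in>F. R f g \<longrightarrow> g \<in> X})"
  have D0: "D 0 = {}" and DS: "D (Suc k) = {f \<in> F. \<forall>g\<in>F. R f g \<longrightarrow> g \<in> D k}" for k
    by (auto simp: D_def)
  have DF: "D k \<subseteq> F" for k by (cases k) (auto simp: D0 DS)
  have step: "D k \<subseteq> D (Suc k)" for k
  proof (induction k)
    case (Suc k) then show ?case unfolding DS by blast
  qed (simp add: D0)
  then have mono: "D i \<subseteq> D j" if "i \<le> j" for i j using lift_Suc_mono_le that by blast
  have rank: "f \<in> D k" if "f \<in> F" "r f < k" for f k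
    using that
  proof (induction k arbitrary: f)
    case (Suc k)
    have "g \<in> D k" if "g \<in> F" "R f g" for g
      using Suc.IH[of g] Suc.prems r[of f g] that by simp
    then show ?case unfolding DS using Suc.prems(1) by simp
  qed simp
  have ex: "D N = F" using rank assms(1) DF by blast
  define n where "n = (LEAST k. D k = F)"
  have n: "D n = F" unfolding n_def by (rule LeastI[of "\<lambda>k. D k = F", OF ex])
  have nN: "n \<le> N" unfolding n_def using ex by (rule Least_le)
  have least: "D k \<noteq> F" if "k < n" for k
    using that not_less_Least unfolding n_def by blast
  define L where "L = (\<lambda>i. D i - D (i - 1))"
  have below: "g \<in> D i \<longleftrightarrow> (\<exists>k\<in>{1..i}. g \<in> L k)" for g i
  proof
    assume gi: "g \<in> D i"
    define k where "k = (LEAST k. g \<in> D k)"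
    have k: "g \<in> D k" "k \<le> i" unfolding k_def by (rule LeastI[of "\<lambda>k. g \<in> D k", OF gi], rule Least_le[of "\<lambda>k. g \<in> D k", OF gi])
    have "0 < k" using k(1) D0 by (cases k) auto
    then have "g \<notin> D (k - 1)" using not_less_Least[of "k - 1" "\<lambda>k. g \<in> D k"] unfolding k_def by auto
    then show "\<exists>k\<in>{1..i}. g \<in> L k" using k \<open>0 < k\<close> by (auto simp: L_def intro!: bexI[of _ k])
  next
    assume "\<exists>k\<in>{1..i}. g \<in> L k"
    then obtain k where "k \<le> i" "g \<in> D k" by (auto simp: L_def)
    then show "g \<in> D i" using mono[of k i] by blast
  qed
  have disj: "L i \<inter> L j = {}" if "i < j" for i j
  proof -
    have "D i \<subseteq> D (j - 1)" using that by (intro mono) simp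
    then show ?thesis by (auto simp: L_def)
  qed
  have stationary: "D (k + m) = D k" if "D (Suc k) = D k" for k m
  proof (induction m)
    case (Suc m)
    have "D (k + Suc m) = D (Suc k)" using Suc by (simp add: DS)
    then show ?case using that by simp
  qed simp
  have ne: "L i \<noteq> {}" if i: "i \<in> {1..n}" for i
  proof
    assume "L i = {}"
    then have "D (Suc (i - 1)) = D (i - 1)" using i step[of "i - 1"] by (auto simp: L_def)
    then have "D n = D (i - 1)" using stationary[of "i - 1" "n - (i - 1)"] i by auto
    moreover have "i - 1 < n" using i by auto
    ultimately show False using least[of "i - 1"] n by simp
  qed
  have inj: "inj_on L {1..n}"
  proof (rule inj_onI)
    fix i j assume "i \<in> {1..n}" "j \<in> {1..n}" "L i = L j"
    then show "i = j" using disj[of i j] disj[of j i] ne[of i] by (cases i j rule: linorder_cases) auto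
  qed
  have part: "partition_on F (L ` {1..n})"
    unfolding partition_on_def disjoint_def
  proof (intro conjI)
    show "\<Union> (L ` {1..n}) = F" using below[of _ n] n DF by auto
    show "\<forall>a\<in>L ` {1..n}. \<forall>b\<in>L ` {1..n}. a \<noteq> b \<longrightarrow> a \<inter> b = {}"
    proof (intro ballI impI)
      fix a b assume "a \<in> L ` {1..n}" "b \<in> L ` {1..n}" "a \<noteq> b"
      then obtain i j where "a = L i" "b = L j" "i \<noteq> j" by auto
      then show "a \<inter> b = {}" using disj[of i j] disj[of j i] by (cases i j rule: linorder_cases) auto
    qed
    show "{} \<notin> L ` {1..n}" using ne by (metis (no_types, lifting) image_iff)
  qed
  have first: "L 1 = {f \<in> F. \<forall>g\<in>F. g \<noteq> f \<longrightarrow> \<not> R f g}"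
  proof -
    have "L 1 = {f \<in> F. \<forall>g\<in>F. \<not> R f g}" using DS[of 0] by (simp add: L_def D0)
    also have "\<dots> = {f \<in> F. \<forall>g\<in>F. g \<noteq> f \<longrightarrow> \<not> R f g}"
      using r[of f f for f] by (intro Collect_cong conj_cong refl) (metis less_irrefl)
    finally show ?thesis .
  qed
  have later: "L i = {f \<in> F. (\<exists>g\<in>L (i - 1). R f g) \<and>
        (\<forall>g\<in>F. R f g \<longrightarrow> (\<exists>k\<in>{1..<i}. g \<in> L k))}" if i: "i \<in> {2..n}" for i
  proof -
    define k where "k = i - 2"
    have k: "i = Suc (Suc k)" using i by (auto simp: k_def)
    have "{1..<i} = {1..Suc k}" using k by auto
    then have "(\<exists>l\<in>{1..<i}. g \<in> L l) \<longleftrightarrow> g \<in> D (Suc k)" for g using below by simp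
    moreover have "L i = D (Suc (Suc k)) - D (Suc k)" "L (i - 1) = D (Suc k) - D k"
      by (simp_all add: L_def k)
    moreover have "D (Suc (Suc k)) - D (Suc k) = {f \<in> F. (\<exists>g\<in>D (Suc k) - D k. R f g) \<and>
        (\<forall>g\<in>F. R f g \<longrightarrow> g \<in> D (Suc k))}"
      unfolding DS[of "Suc k"] using DS[of k] DF[of "Suc k"] by blast
    ultimately show ?thesis by simp
  qed
  show ?thesis
  proof (rule exI[of _ n], rule conjI[OF nN], rule exI[of _ L], rule conjI[OF inj],
      rule conjI[OF part], rule conjI, rule impI, rule first, rule ballI, rule later)
  qed
qed


section \<open>Chords of a Jordan curve\<close>

text \<open>
  The chord \<open>c\<close> splits the inside of the Jordan curve \<open>c1 \<union> c2\<close> into the insides of \<open>c1 \<union> c\<close> and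
  \<open>c2 \<union> c\<close>. A connected set in the complement of \<open>c\<close> lies in one of them, and a point of \<open>c2\<close> other
  than the common ends is not in the closure of the part bounded by \<open>c1 \<union> c\<close>.
\<close>

lemma theta_curve_side:
  fixes c1 c2 c :: "real \<Rightarrow> complex"
  assumes c1: "arc c1" "pathstart c1 = a" "pathfinish c1 = b"
    and c2: "arc c2" "pathstart c2 = a" "pathfinish c2 = b"
    and c: "arc c" "pathstart c = a" "pathfinish c = b"
    and c1c2: "path_image c1 \<inter> path_image c2 = {a, b}"
    and chord: "path_image c - {a, b} \<subseteq> inside (path_image c1 \<union> path_image c2)"
    and T: "connected T" "T \<subseteq> inside (path_image c1 \<union> path_image c2) - path_image c"
    and q: "q \<in> closure T" "q \<in> path_image c2 - {a, b}"
  shows "T \<subseteq> inside (path_image c2 \<union> path_image c)"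
    and "inside (path_image c1 \<union> path_image c) \<inter> inside (path_image c2 \<union> path_image c) = {}"
proof -
  let ?C1 = "path_image c1" and ?C2 = "path_image c2" and ?C = "path_image c"
  have closed: "closed (?C1 \<union> ?C)" "closed (?C2 \<union> ?C)"
    using c1(1) c2(1) c(1) by (simp_all add: closed_Un closed_arc_image)
  have "{a, b} \<subseteq> ?C1" "{a, b} \<subseteq> ?C2" "{a, b} \<subseteq> ?C"
    using pathstart_in_path_image[of c1] pathfinish_in_path_image[of c1]
      pathstart_in_path_image[of c2] pathfinish_in_path_image[of c2]
      pathstart_in_path_image[of c] pathfinish_in_path_image[of c] c1 c2 c by simp_all
  moreover have "?C \<inter> (?C1 \<union> ?C2) \<subseteq> {a, b}"
    using chord inside_no_overlap[of "?C1 \<union> ?C2"] by blast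
  ultimately have meet: "?C1 \<inter> ?C = {a, b}" "?C2 \<inter> ?C = {a, b}" by blast+
  have "a \<noteq> b" using arc_distinct_ends[OF c(1)] c by simp
  have "?C - {a, b} \<noteq> {}"
    using nonempty_simple_path_endless[OF arc_imp_simple_path[OF c(1)]] c by simp
  then have "?C \<inter> inside (?C1 \<union> ?C2) \<noteq> {}" using chord by blast
  then obtain disj: "inside (?C1 \<union> ?C) \<inter> inside (?C2 \<union> ?C) = {}"
    and un: "inside (?C1 \<union> ?C) \<union> inside (?C2 \<union> ?C) \<union> (?C - {a, b}) = inside (?C1 \<union> ?C2)"
    using split_inside_simple_closed_curve[of c1 a b c2 c] c1 c2 c c1c2 meet \<open>a \<noteq> b\<close>
      arc_imp_simple_path by blast
  show "inside (?C1 \<union> ?C) \<inter> inside (?C2 \<union> ?C) = {}" by (rule disj)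
  have sub: "T \<subseteq> inside (?C1 \<union> ?C) \<union> inside (?C2 \<union> ?C)" using T(2) un by blast
  have "inside (?C1 \<union> ?C) \<inter> T = {} \<or> inside (?C2 \<union> ?C) \<inter> T = {}"
    using connectedD[OF T(1) open_inside[OF closed(1)] open_inside[OF closed(2)]] disj sub by blast
  then show "T \<subseteq> inside (?C2 \<union> ?C)"
  proof
    assume "inside (?C2 \<union> ?C) \<inter> T = {}"
    then have "T \<subseteq> inside (?C1 \<union> ?C)" using sub by blast
    then have "closure T \<subseteq> closure (inside (?C1 \<union> ?C))" by (rule closure_mono)
    also have "\<dots> \<subseteq> (?C1 \<union> ?C) \<union> inside (?C1 \<union> ?C)"
      by (rule closure_inside_subset[OF closed(1)])
    also have "\<dots> \<subseteq> (?C1 \<union> ?C) \<union> inside (?C1 \<union> ?C2)" using un by blast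
    finally have "q \<in> (?C1 \<union> ?C) \<union> inside (?C1 \<union> ?C2)" using q(1) by blast
    moreover have "q \<notin> ?C1 \<union> ?C" using q(2) c1c2 meet by blast
    moreover have "q \<notin> inside (?C1 \<union> ?C2)" using q(2) inside_no_overlap[of "?C1 \<union> ?C2"] by blast
    ultimately show ?thesis by blast
  qed (use sub in blast)
qed

section \<open>Walks and cycles in embedded graphs\<close>

fun walk_edges :: "'v list \<Rightarrow> 'v set set" where
  "walk_edges (x # y # ws) = insert {x, y} (walk_edges (y # ws))"
| "walk_edges _ = {}"

definition drawn :: "('v, 'a) drawing \<Rightarrow> 'v set set \<Rightarrow> 'a set" where
  "drawn D E = (\<Union>e\<in>E. epos D e)"

lemma drawn_simps [simp]:
  "drawn D {} = {}" "drawn D (insert e E) = epos D e \<union> drawn D E"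
  "drawn D (E \<union> F) = drawn D E \<union> drawn D F"
  by (auto simp: drawn_def)

lemma cycle_support_eq_drawn: "cycle_support vs D = drawn D (cycle_edges vs)"
  by (simp add: cycle_support_def drawn_def)

lemma walk_edges_eq: "walk_edges ws = (\<lambda>i. {ws ! i, ws ! Suc i}) ` {..<length ws - 1}"
  by (induction ws rule: walk_edges.induct) (simp_all add: lessThan_Suc_eq_insert_0 image_image)

lemma walk_edges_append: "walk_edges (xs @ y # ys) = walk_edges (xs @ [y]) \<union> walk_edges (y # ys)"
  by (induction xs rule: walk_edges.induct) (auto simp: neq_Nil_conv)

lemma Union_walk_edges: "2 \<le> length ws \<Longrightarrow> \<Union> (walk_edges ws) = set ws"
proof (induction ws rule: walk_edges.induct)
  case (1 x y ws) then show ?case by (cases ws) auto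
qed auto

lemma Union_walk_edges_subset: "\<Union> (walk_edges ws) \<subseteq> set ws"
  by (induction ws rule: walk_edges.induct) auto

lemma cycle_edges_eq_walk: "cycle_edges (x # xs) = walk_edges (x # xs @ [x])"
proof -
  have "{(x # xs) ! i, (x # xs) ! (Suc i mod length (x # xs))} =
        {(x # xs @ [x]) ! i, (x # xs @ [x]) ! Suc i}" if "i < length (x # xs)" for i
  proof (cases "i = length xs")
    case True
    then show ?thesis by (simp add: nth_append nth_Cons')
  next
    case False
    then show ?thesis using that by (auto simp: nth_append nth_Cons')
  qed
  then have "(\<lambda>i. {(x # xs) ! i, (x # xs) ! (Suc i mod length (x # xs))}) ` {..<length (x # xs)} =
      (\<lambda>i. {(x # xs @ [x]) ! i, (x # xs @ [x]) ! Suc i}) ` {..<length (x # xs)}"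
    by (intro image_cong) auto
  then show ?thesis unfolding cycle_edges_def walk_edges_eq by (simp add: image_def Bex_def conj_commute)
qed

lemma cycle_edges_split:
  "cycle_edges (a # xs @ b # ys) = walk_edges (a # xs @ [b]) \<union> walk_edges (b # ys @ [a])"
  using walk_edges_append[of "a # xs" b "ys @ [a]"] by (simp add: cycle_edges_eq_walk)

text \<open>
  A cyclic list may be cut open anywhere; this brings any two of its vertices into the form
  \<open>a # xs @ b # ys\<close>, in which the two arcs of the cycle between \<open>a\<close> and \<open>b\<close> are visible.
\<close>

lemma cycle_edges_commute: "cycle_edges (xs @ ys) = cycle_edges (ys @ xs)"
proof (cases xs; cases ys)
  fix a as b bs assume "xs = a # as" "ys = b # bs"
  then show ?thesis using cycle_edges_split[of a as b bs] cycle_edges_split[of b bs a as] by auto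
qed auto

lemma is_cycle_commute: "is_cycle G (xs @ ys) \<longleftrightarrow> is_cycle G (ys @ xs)"
  using cycle_edges_commute[of xs ys] by (auto simp: is_cycle_def)

lemma Union_cycle_edges: "2 \<le> length vs \<Longrightarrow> \<Union> (cycle_edges vs) = set vs"
proof (cases vs)
  case (Cons x xs)
  then show ?thesis using Union_walk_edges[of "x # xs @ [x]"] by (auto simp: cycle_edges_eq_walk)
qed simp

lemma embedding_edge_Int:
  "embedding G D \<Longrightarrow> e \<in> edges G \<Longrightarrow> f \<in> edges G \<Longrightarrow> e \<noteq> f \<Longrightarrow> epos D e \<inter> epos D f = vpos D ` (e \<inter> f)"
  by (simp add: embedding_def)

lemma embedding_edge_verts:
  "embedding G D \<Longrightarrow> e \<in> edges G \<Longrightarrow> epos D e \<inter> vpos D ` verts G = vpos D ` e"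
  by (simp add: embedding_def)

lemma embedding_inj: "embedding G D \<Longrightarrow> inj_on (vpos D) (verts G)"
  by (simp add: embedding_def)

lemma embedding_drawn_Int:
  assumes "embedding G D" "E \<subseteq> edges G" "F \<subseteq> edges G" "E \<inter> F = {}"
  shows "drawn D E \<inter> drawn D F = vpos D ` (\<Union>E \<inter> \<Union>F)"
proof -
  have ep: "epos D e \<inter> epos D f = vpos D ` (e \<inter> f)" if "e \<in> E" "f \<in> F" for e f
    using assms that by (intro embedding_edge_Int) auto
  have "drawn D E \<inter> drawn D F = (\<Union>e\<in>E. \<Union>f\<in>F. epos D e \<inter> epos D f)"
    by (auto simp: drawn_def)
  also have "\<dots> = (\<Union>e\<in>E. \<Union>f\<in>F. vpos D ` (e \<inter> f))" using ep by auto
  also have "\<dots> = vpos D ` (\<Union>E \<inter> \<Union>F)" by auto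
  finally show ?thesis .
qed

lemma embedding_edge_arc:
  assumes "embedding G D" "{x, y} \<in> edges G"
  obtains g where "arc g" "pathstart g = vpos D x" "pathfinish g = vpos D y"
    "path_image g = epos D {x, y}"
proof -
  obtain u v g where g: "{x, y} = {u, v}" "arc g" "pathstart g = vpos D u" "pathfinish g = vpos D v"
    "epos D {x, y} = path_image g"
    using assms unfolding embedding_def by meson
  from g(1) consider "x = u" "y = v" | "x = v" "y = u" by (auto simp: doubleton_eq_iff)
  then show thesis
  proof cases
    case 1 then show thesis using that[of g] g by simp
  next
    case 2 then show thesis using that[of "reversepath g"] g by (simp add: arc_reversepath)
  qed
qed

lemma embedding_ends: "embedding G D \<Longrightarrow> {x, y} \<in> edges G \<Longrightarrow> vpos D x \<in> epos D {x, y}"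
  by (metis embedding_edge_arc pathstart_in_path_image)

lemma embedding_edge_closed:
  fixes D :: "('v, 'a::t2_space) drawing"
  shows "embedding G D \<Longrightarrow> e \<in> edges G \<Longrightarrow> compact (epos D e)"
  unfolding embedding_def by (metis compact_arc_image)

lemma embedding_edge_delete:
  fixes D :: "('v, 'a::real_normed_vector) drawing"
  assumes D: "embedding G D" and e: "{x, y} \<in> edges G" and F: "F \<subseteq> {x, y}"
  shows "connected (epos D {x, y} - vpos D ` F)"
    and "epos D {x, y} \<subseteq> closure (epos D {x, y} - vpos D ` F)"
    and "epos D {x, y} - vpos D ` F \<noteq> {}"
proof -
  obtain g where g: "arc g" "pathstart g = vpos D x" "pathfinish g = vpos D y"
    "path_image g = epos D {x, y}" using embedding_edge_arc[OF D e] .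
  let ?I = "epos D {x, y} - {vpos D x, vpos D y}"
  have conn: "connected ?I" and ne: "?I \<noteq> {}"
    using connected_simple_path_endless[OF arc_imp_simple_path[OF g(1)]]
      nonempty_simple_path_endless[OF arc_imp_simple_path[OF g(1)]] g by simp_all
  have sub: "?I \<subseteq> epos D {x, y} - vpos D ` F" using F by auto
  have "epos D {x, y} \<subseteq> closure ?I"
  proof -
    have "path_image g = g ` closure {0<..<1}" by (simp add: path_image_def)
    also have "\<dots> \<subseteq> closure (g ` {0<..<1})"
      by (rule image_closure_subset[of _ g])
        (use arc_imp_path[OF g(1)] in \<open>auto simp: path_def closure_subset\<close>)
    also have "g ` {0<..<1} = ?I"
      using simple_path_endless[OF arc_imp_simple_path[OF g(1)]] g by simp
    finally show ?thesis using g by simp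
  qed
  then show "epos D {x, y} \<subseteq> closure (epos D {x, y} - vpos D ` F)"
    using closure_mono[OF sub] by blast
  show "connected (epos D {x, y} - vpos D ` F)"
    by (rule connected_intermediate_closure[OF conn sub]) (use \<open>epos D {x, y} \<subseteq> closure ?I\<close> in auto)
  show "epos D {x, y} - vpos D ` F \<noteq> {}" using ne sub by blast
qed

lemma embedding_walk_arc:
  assumes D: "embedding G D"
    and "distinct ws" "2 \<le> length ws" "set ws \<subseteq> verts G" "walk_edges ws \<subseteq> edges G"
  shows "\<exists>g. arc g \<and> pathstart g = vpos D (hd ws) \<and> pathfinish g = vpos D (last ws)
    \<and> path_image g = drawn D (walk_edges ws)"
  using assms(2-)
proof (induction ws rule: walk_edges.induct)
  case (1 x y ws)
  obtain g where g: "arc g" "pathstart g = vpos D x" "pathfinish g = vpos D y"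
    "path_image g = epos D {x, y}" using embedding_edge_arc[OF D] 1(5) by auto
  show ?case
  proof (cases "ws = []")
    case True
    then show ?thesis using g by auto
  next
    case False
    obtain h where h: "arc h" "pathstart h = vpos D y" "pathfinish h = vpos D (last (y # ws))"
      "path_image h = drawn D (walk_edges (y # ws))"
      using 1 False by (auto simp: Suc_le_eq)
    have new: "{x, y} \<notin> walk_edges (y # ws)"
      using Union_walk_edges_subset[of "y # ws"] 1(2) by auto
    have "path_image g \<inter> path_image h = drawn D {{x, y}} \<inter> drawn D (walk_edges (y # ws))"
      using g h by simp
    also have "\<dots> = vpos D ` ({x, y} \<inter> \<Union>(walk_edges (y # ws)))"
      by (subst embedding_drawn_Int[OF D]) (use 1 new in auto)
    also have "\<Union>(walk_edges (y # ws)) = set (y # ws)"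
      using False by (intro Union_walk_edges) (simp add: Suc_le_eq)
    also have "{x, y} \<inter> set (y # ws) = {y}" using 1(2) by auto
    finally have "arc (g +++ h)" using arc_join[OF g(1) h(1)] g h by simp
    moreover have "path_image (g +++ h) = drawn D (walk_edges (x # y # ws))"
      using g h by (simp add: path_image_join)
    ultimately show ?thesis using g h False by (intro exI[of _ "g +++ h"]) simp
  qed
qed auto


lemma vpos_in_drawn:
  assumes "embedding G D" "E \<subseteq> edges G" "x \<in> \<Union>E"
  shows "vpos D x \<in> drawn D E"
proof -
  obtain e where e: "e \<in> E" "x \<in> e" using assms(3) by blast
  then have "vpos D ` e \<subseteq> epos D e" using embedding_edge_verts[OF assms(1), of e] assms(2) by blast
  then show ?thesis using e by (auto simp: drawn_def)
qed

lemma drawn_Int_verts: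
  assumes "embedding G D" "E \<subseteq> edges G"
  shows "drawn D E \<inter> vpos D ` verts G = vpos D ` \<Union>E"
proof -
  have "drawn D E \<inter> vpos D ` verts G = (\<Union>e\<in>E. epos D e \<inter> vpos D ` verts G)"
    by (auto simp: drawn_def)
  also have "\<dots> = (\<Union>e\<in>E. vpos D ` e)"
    by (intro SUP_cong refl embedding_edge_verts[OF assms(1)]) (use assms(2) in blast)
  finally show ?thesis by (simp add: image_Union)
qed

lemma walk_edges_card: "distinct ws \<Longrightarrow> e \<in> walk_edges ws \<Longrightarrow> card e = 2"
  by (induction ws rule: walk_edges.induct) auto

lemma ends_not_walk_edge:
  assumes "distinct (a # xs @ [b])" "xs \<noteq> []"
  shows "{a, b} \<notin> walk_edges (a # xs @ [b])"
proof -
  obtain x zs where xs: "xs = x # zs" using assms(2) by (auto simp: neq_Nil_conv)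
  have "{a, b} \<notin> walk_edges (x # zs @ [b])"
    using Union_walk_edges_subset[of "x # zs @ [b]"] assms(1) xs by auto
  moreover have "{a, b} \<noteq> {a, x}" using assms(1) xs by (auto simp: doubleton_eq_iff)
  ultimately show ?thesis by (simp add: xs)
qed

section \<open>Chords and hubs inside a cycle\<close>

text \<open>
  The theta-curve argument for embedded graphs: a walk from \<open>a\<close> to \<open>b\<close> through the inside of the
  cycle \<open>a # xs @ b # ys\<close> separates the arc \<open>xs\<close> from the arc \<open>ys\<close>, so a connected set \<open>T\<close> of the
  inside that avoids the walk and reaches the second arc stays on its side and does not reach the
  first one.
\<close>

lemma chord_walk_separates:
  fixes D :: "('v, complex) drawing"
  assumes D: "embedding G D" and cyc: "is_cycle G (a # xs @ b # ys)"
    and us: "distinct (a # us @ [b])" "set us \<subseteq> verts G - set (a # xs @ b # ys)"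
    and P: "walk_edges (a # us @ [b]) \<subseteq> edges G"
    and inP: "drawn D (walk_edges (a # us @ [b])) - vpos D ` {a, b}
      \<subseteq> inside (cycle_support (a # xs @ b # ys) D)"
    and T: "connected T" "T \<subseteq> inside (cycle_support (a # xs @ b # ys) D)"
      "T \<inter> drawn D (walk_edges (a # us @ [b])) = {}"
    and q: "q \<in> set ys" "vpos D q \<in> closure T"
  shows "T \<subseteq> inside (drawn D (walk_edges (b # ys @ [a])) \<union> drawn D (walk_edges (a # us @ [b])))"
    and "p \<in> set xs \<Longrightarrow> vpos D p \<notin> closure T"
proof -
  let ?E1 = "walk_edges (a # xs @ [b])" and ?E2 = "walk_edges (b # ys @ [a])"
    and ?P = "walk_edges (a # us @ [b])"
  have dist: "distinct (a # xs @ b # ys)" and V: "set (a # xs @ b # ys) \<subseteq> verts G"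
    and len: "3 \<le> length (a # xs @ b # ys)"
    and E: "?E1 \<subseteq> edges G" "?E2 \<subseteq> edges G"
    using cyc unfolding is_cycle_def cycle_edges_split by auto
  have C: "cycle_support (a # xs @ b # ys) D = drawn D ?E1 \<union> drawn D ?E2"
    by (simp add: cycle_support_eq_drawn cycle_edges_split)
  obtain c1 where c1: "arc c1" "pathstart c1 = vpos D a" "pathfinish c1 = vpos D b"
    "path_image c1 = drawn D ?E1"
    using embedding_walk_arc[OF D, of "a # xs @ [b]"] dist V E by auto
  obtain d2 where d2: "arc d2" "pathstart d2 = vpos D b" "pathfinish d2 = vpos D a"
    "path_image d2 = drawn D ?E2"
    using embedding_walk_arc[OF D, of "b # ys @ [a]"] dist V E by auto
  define c2 where "c2 = reversepath d2"
  have c2: "arc c2" "pathstart c2 = vpos D a" "pathfinish c2 = vpos D b"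
    "path_image c2 = drawn D ?E2" using d2 by (simp_all add: c2_def arc_reversepath)
  obtain c where c: "arc c" "pathstart c = vpos D a" "pathfinish c = vpos D b"
    "path_image c = drawn D ?P"
    using embedding_walk_arc[OF D, of "a # us @ [b]"] us V P by auto
  have U: "\<Union>?E1 = set (a # xs @ [b])" "\<Union>?E2 = set (b # ys @ [a])"
    by (rule Union_walk_edges; simp)+
  have "?E1 \<inter> ?E2 = {}"
  proof (rule ccontr)
    assume "?E1 \<inter> ?E2 \<noteq> {}"
    then obtain e where e: "e \<in> ?E1" "e \<in> ?E2" by blast
    have "e \<subseteq> set (a # xs @ [b]) \<inter> set (b # ys @ [a])" using e U by blast
    then have "e \<subseteq> {a, b}" using dist by auto
    moreover have "card e = 2" using walk_edges_card[OF _ e(1)] dist by simp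
    moreover have "card {a, b} = 2" using dist by simp
    ultimately have "e = {a, b}" by (metis card_subset_eq finite.emptyI finite_insert)
    then have "xs = []" "ys = []"
      using ends_not_walk_edge[of a xs b] ends_not_walk_edge[of b ys a] e dist
      by (auto simp: insert_commute)
    then show False using len by simp
  qed
  then have "drawn D ?E1 \<inter> drawn D ?E2 = vpos D ` (\<Union>?E1 \<inter> \<Union>?E2)"
    by (rule embedding_drawn_Int[OF D E])
  also have "\<Union>?E1 \<inter> \<Union>?E2 = {a, b}" unfolding U using dist by auto
  finally have meet: "path_image c1 \<inter> path_image c2 = {vpos D a, vpos D b}" using c1 c2 by simp
  have C': "path_image c1 \<union> path_image c2 = cycle_support (a # xs @ b # ys) D"
    using C c1 c2 by simp
  have inP': "path_image c - {vpos D a, vpos D b} \<subseteq> inside (path_image c1 \<union> path_image c2)"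
    using inP unfolding C' c(4) by simp
  have T': "T \<subseteq> inside (path_image c1 \<union> path_image c2) - path_image c"
    using T unfolding C' c(4) by blast
  have on: "vpos D x \<in> drawn D F - {vpos D a, vpos D b}"
    if "F \<subseteq> edges G" "x \<in> \<Union>F" "x \<in> set xs \<union> set ys" for x F
  proof -
    have "vpos D x \<notin> vpos D ` {a, b}"
      using that dist V by (subst inj_on_image_mem_iff[OF embedding_inj[OF D]]) auto
    then show ?thesis using vpos_in_drawn[OF D that(1,2)] by simp
  qed
  have q': "vpos D q \<in> path_image c2 - {vpos D a, vpos D b}"
    using on[OF E(2), of q] q U by (simp add: c2)
  note side = theta_curve_side[OF c1(1-3) c2(1-3) c(1-3) meet inP' T(1) T' q(2) q']
  show "T \<subseteq> inside (drawn D ?E2 \<union> drawn D ?P)" using side(1) c2 c by simp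
  show "vpos D p \<notin> closure T" if p: "p \<in> set xs"
  proof
    assume cl: "vpos D p \<in> closure T"
    have p': "vpos D p \<in> path_image c1 - {vpos D a, vpos D b}"
      using on[OF E(1), of p] p U by (simp add: c1)
    have "T \<subseteq> inside (path_image c1 \<union> path_image c)"
      using meet inP' T' by (intro theta_curve_side(1)[OF c2(1-3) c1(1-3) c(1-3) _ _ T(1) _ cl p'])
        (simp_all add: Int_commute Un_commute)
    then have "T = {}" using side by blast
    then show False using cl by simp
  qed
qed

text \<open>
  The outer ends are removed, so that the star lies inside the cycle when the vertices in \<open>X\<close>
  are on it.
\<close>

definition star :: "('v, 'a) drawing \<Rightarrow> 'v \<Rightarrow> 'v set \<Rightarrow> 'a set" where
  "star D v X = (\<Union>x\<in>X. epos D {v, x} - {vpos D x})"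

lemma star_around_hub:
  fixes D :: "('v, 'a::real_normed_vector) drawing"
  assumes D: "embedding G D" and v: "v \<in> verts G" and X: "X \<subseteq> verts G - {v}"
    and E: "\<And>x. x \<in> X \<Longrightarrow> {v, x} \<in> edges G"
  shows "connected (star D v X)"
    and "x \<in> X \<Longrightarrow> vpos D x \<in> closure (star D v X)"
    and "F \<subseteq> edges G \<Longrightarrow> v \<notin> \<Union>F \<Longrightarrow> star D v X \<inter> drawn D F = {}"
proof -
  have centre: "vpos D v \<in> epos D {v, x} - {vpos D x}" if "x \<in> X" for x
    using embedding_ends[OF D E[OF that]] inj_onD[OF embedding_inj[OF D], of v x] v X that by blast
  have "connected (epos D {v, x} - {vpos D x})" if "x \<in> X" for x
    using embedding_edge_delete(1)[OF D E[OF that], of "{x}"] by simp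
  then show "connected (star D v X)"
    unfolding star_def
  proof (intro connected_Union)
    have "vpos D v \<in> (\<Inter>x\<in>X. epos D {v, x} - {vpos D x})" using centre by blast
    then show "(\<Inter>x\<in>X. epos D {v, x} - {vpos D x}) \<noteq> {}" by blast
  qed auto
  show "vpos D x \<in> closure (star D v X)" if x: "x \<in> X"
  proof -
    have "vpos D x \<in> epos D {x, v}"
      using embedding_ends[OF D, of x v] E[OF x] by (simp add: insert_commute)
    also have "epos D {x, v} \<subseteq> closure (epos D {v, x} - {vpos D x})"
      using embedding_edge_delete(2)[OF D E[OF x], of "{x}"] by (simp add: insert_commute)
    also have "\<dots> \<subseteq> closure (star D v X)" using x by (intro closure_mono) (auto simp: star_def)
    finally show ?thesis .
  qed
  show "star D v X \<inter> drawn D F = {}" if F: "F \<subseteq> edges G" "v \<notin> \<Union>F"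
  proof -
    have "epos D {v, x} \<inter> epos D f \<subseteq> {vpos D x}" if "x \<in> X" "f \<in> F" for x f
    proof -
      have "epos D {v, x} \<inter> epos D f = vpos D ` ({v, x} \<inter> f)"
        using that F E by (intro embedding_edge_Int[OF D]) auto
      then show ?thesis using that F by auto
    qed
    then show ?thesis unfolding star_def drawn_def by blast
  qed
qed

definition chords_inside :: "'v ugraph \<Rightarrow> ('v, complex) drawing \<Rightarrow> 'v list \<Rightarrow> bool" where
  "chords_inside G D vs \<longleftrightarrow> (\<forall>e\<in>edges G - cycle_edges vs.
     epos D e - cycle_support vs D \<subseteq> inside (cycle_support vs D))"

lemma chord_Int_cycle_support:
  assumes "embedding G D" "is_cycle G vs" "F \<subseteq> edges G - cycle_edges vs"
  shows "drawn D F \<inter> cycle_support vs D = vpos D ` (\<Union>F \<inter> set vs)"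
proof -
  have "drawn D F \<inter> drawn D (cycle_edges vs) = vpos D ` (\<Union>F \<inter> \<Union>(cycle_edges vs))"
    using assms by (intro embedding_drawn_Int[OF assms(1)]) (auto simp: is_cycle_def)
  then show ?thesis using assms(2) Union_cycle_edges[of vs] 
    by (simp add: cycle_support_eq_drawn is_cycle_def)
qed

lemma chord_inside:
  assumes "embedding G D" "is_cycle G vs" "chords_inside G D vs" "F \<subseteq> edges G - cycle_edges vs"
  shows "drawn D F - vpos D ` (\<Union>F \<inter> set vs) \<subseteq> inside (cycle_support vs D)"
proof -
  have "drawn D F - vpos D ` (\<Union>F \<inter> set vs) = drawn D F - cycle_support vs D"
    unfolding chord_Int_cycle_support[OF assms(1,2,4), symmetric] by auto
  also have "\<dots> \<subseteq> inside (cycle_support vs D)"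
  proof
    fix z assume "z \<in> drawn D F - cycle_support vs D"
    then obtain e where "e \<in> F" "z \<in> epos D e - cycle_support vs D" by (auto simp: drawn_def)
    moreover have "e \<in> edges G - cycle_edges vs" using \<open>e \<in> F\<close> assms(4) by auto
    ultimately show "z \<in> inside (cycle_support vs D)"
      using assms(3) unfolding chords_inside_def by auto
  qed
  finally show ?thesis .
qed

lemma no_crossing_chords:
  fixes D :: "('v, complex) drawing"
  assumes D: "embedding G D" and cyc: "is_cycle G (a # xs @ b # ys)"
    and ins: "chords_inside G D (a # xs @ b # ys)"
    and ab: "{a, b} \<in> edges G - cycle_edges (a # xs @ b # ys)"
    and pq: "p \<in> set xs" "q \<in> set ys" "{p, q} \<in> edges G - cycle_edges (a # xs @ b # ys)"
  shows False
proof -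
  have dist: "distinct (a # xs @ b # ys)" using cyc by (auto simp: is_cycle_def)
  let ?T = "epos D {p, q} - vpos D ` {p, q}"
  have "{p, q} \<inter> {a, b} = {}" using dist pq by auto
  then have disj: "epos D {p, q} \<inter> epos D {a, b} = {}"
    using embedding_edge_Int[OF D, of "{p, q}" "{a, b}"] ab pq by auto
  have "vpos D p \<notin> closure ?T"
  proof (rule chord_walk_separates(2)[OF D cyc, of "[]" ?T q])
    show "connected ?T" using embedding_edge_delete(1)[OF D, of p q "{p, q}"] pq by simp
    show "vpos D q \<in> closure ?T"
      using embedding_edge_delete(2)[OF D, of p q "{p, q}"] embedding_ends[OF D, of q p] pq
      by (auto simp: insert_commute)
    show "drawn D (walk_edges (a # [] @ [b])) - vpos D ` {a, b}
      \<subseteq> inside (cycle_support (a # xs @ b # ys) D)"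
      using chord_inside[OF D cyc ins, of "{{a, b}}"] ab by simp
    show "?T \<subseteq> inside (cycle_support (a # xs @ b # ys) D)"
      using chord_inside[OF D cyc ins, of "{{p, q}}"] pq by auto
    show "?T \<inter> drawn D (walk_edges (a # [] @ [b])) = {}" using disj by auto
  qed (use dist pq ab in auto)
  moreover have "vpos D p \<in> closure ?T"
    using embedding_edge_delete(2)[OF D, of p q "{p, q}"] embedding_ends[OF D, of p q] pq by blast
  ultimately show False by blast
qed

lemma no_chord_beside_hub:
  fixes D :: "('v, complex) drawing"
  assumes D: "embedding G D" and cyc: "is_cycle G (a # xs @ b # ys)"
    and ins: "chords_inside G D (a # xs @ b # ys)"
    and ab: "{a, b} \<in> edges G - cycle_edges (a # xs @ b # ys)"
    and v: "v \<in> verts G - set (a # xs @ b # ys)"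
    and pq: "p \<in> set xs" "q \<in> set ys" "{v, p} \<in> edges G" "{v, q} \<in> edges G"
  shows False
proof -
  let ?vs = "a # xs @ b # ys"
  have dist: "distinct ?vs" and V: "set ?vs \<subseteq> verts G" using cyc by (auto simp: is_cycle_def)
  let ?T = "star D v {p, q}"
  have v': "v \<in> verts G" and X: "{p, q} \<subseteq> verts G - {v}" using v V pq by auto
  have vE: "{v, x} \<in> edges G" if "x \<in> {p, q}" for x using that pq by auto
  note star = star_around_hub[OF D v' X vE]
  have nc: "{v, p} \<notin> cycle_edges ?vs" "{v, q} \<notin> cycle_edges ?vs"
    using Union_cycle_edges[of ?vs] v by auto
  have "vpos D p \<notin> closure ?T"
  proof (rule chord_walk_separates(2)[OF D cyc, of "[]" ?T q])
    show "drawn D (walk_edges (a # [] @ [b])) - vpos D ` {a, b}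
      \<subseteq> inside (cycle_support ?vs D)"
      using chord_inside[OF D cyc ins, of "{{a, b}}"] ab by simp
    show "?T \<subseteq> inside (cycle_support ?vs D)"
      using chord_inside[OF D cyc ins, of "{{v, p}}"] chord_inside[OF D cyc ins, of "{{v, q}}"]
        pq nc v unfolding star_def by auto
    show "?T \<inter> drawn D (walk_edges (a # [] @ [b])) = {}"
      using ab v by (intro star(3)) auto
  qed (use dist pq ab star(1,2) in auto)
  then show False using star(2)[of p] by blast
qed

text \<open>
  With a third hub outside the cycle this would be a plane \<open>K\<^bsub>3,3\<^esub>\<close>. The walk \<open>a u b\<close> divides the
  disc, and both the edge \<open>uc\<close> and the star of \<open>v\<close> lie on the side of \<open>c\<close>, that is, inside the
  cycle \<open>u b c \<dots> a\<close>. There the chord \<open>uc\<close> separates \<open>a\<close> from \<open>b\<close>, yet the star of \<open>v\<close> joins them.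
\<close>

lemma no_two_hubs:
  fixes D :: "('v, complex) drawing"
  assumes D: "embedding G D" and cyc: "is_cycle G (a # b # c # ys)"
    and ins: "chords_inside G D (a # b # c # ys)"
    and hubs: "u \<in> verts G - set (a # b # c # ys)" "v \<in> verts G - set (a # b # c # ys)" "u \<noteq> v"
    and E: "\<And>x. x \<in> {a, b, c} \<Longrightarrow> {u, x} \<in> edges G" "\<And>x. x \<in> {a, b, c} \<Longrightarrow> {v, x} \<in> edges G"
  shows False
proof -
  let ?vs = "a # b # c # ys"
  have dist: "distinct ?vs" and V: "set ?vs \<subseteq> verts G" and CE: "cycle_edges ?vs \<subseteq> edges G"
    using cyc by (auto simp: is_cycle_def)
  have nc: "{u, x} \<notin> cycle_edges ?vs" "{v, x} \<notin> cycle_edges ?vs" for x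
    using Union_cycle_edges[of ?vs] hubs by auto
  have star: "connected (star D v X)" "x \<in> X \<Longrightarrow> vpos D x \<in> closure (star D v X)"
    "F \<subseteq> edges G \<Longrightarrow> v \<notin> \<Union>F \<Longrightarrow> star D v X \<inter> drawn D F = {}" if X: "X \<subseteq> {a, b, c}" for X x F
  proof -
    have v': "v \<in> verts G" and X': "X \<subseteq> verts G - {v}" using hubs V X by auto
    have vE: "{v, x} \<in> edges G" if "x \<in> X" for x using E(2) X that by blast
    note props = star_around_hub[OF D v' X' vE]
    show "connected (star D v X)" by (rule props(1))
    show "x \<in> X \<Longrightarrow> vpos D x \<in> closure (star D v X)" by (rule props(2))
    show "F \<subseteq> edges G \<Longrightarrow> v \<notin> \<Union>F \<Longrightarrow> star D v X \<inter> drawn D F = {}" by (rule props(3))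
  qed
  have P: "drawn D (walk_edges (a # [u] @ [b])) - vpos D ` {a, b} \<subseteq> inside (cycle_support ?vs D)"
    using chord_inside[OF D cyc ins, of "{{a, u}, {u, b}}"] E(1)[of a] E(1)[of b] nc[of a] nc[of b] hubs
    by (auto simp: insert_commute)
  have we: "walk_edges (a # [u] @ [b]) \<subseteq> edges G"
    using E(1)[of a] E(1)[of b] by (simp add: insert_commute)
  let ?ws = "u # b # c # ys @ [a]"
  have CS: "drawn D (walk_edges (b # (c # ys) @ [a])) \<union> drawn D (walk_edges (a # [u] @ [b]))
      = cycle_support ?ws D"
    using cycle_edges_split[of u "[]" b "c # ys @ [a]"] cycle_edges_eq_walk[of u "b # c # ys @ [a]"]
      walk_edges_append[of "c # ys" a "[u]"]
    by (simp add: cycle_support_eq_drawn insert_commute Un_ac)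
  have side: "T \<subseteq> inside (cycle_support ?ws D)"
    if T: "connected T" "T \<subseteq> inside (cycle_support ?vs D)" "vpos D c \<in> closure T"
      "T \<inter> drawn D (walk_edges (a # [u] @ [b])) = {}" for T
    unfolding CS[symmetric]
    by (rule chord_walk_separates(1)[OF D, of _ "[]", where q = c])
      (use T cyc dist hubs P we in auto)
  let ?T = "star D v {a, b, c}" and ?U = "epos D {u, c} - vpos D ` {u, c}"
  have T_in: "?T \<subseteq> inside (cycle_support ?ws D)"
  proof (rule side)
    have "epos D {v, x} - {vpos D x} \<subseteq> inside (cycle_support ?vs D)" if "x \<in> {a, b, c}" for x
    proof -
      have "\<Union>{{v, x}} \<inter> set ?vs = {x}" using that hubs by auto
      then show ?thesis using chord_inside[OF D cyc ins, of "{{v, x}}"] E(2)[OF that] nc by simp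
    qed
    then show "?T \<subseteq> inside (cycle_support ?vs D)" unfolding star_def by blast
    show "?T \<inter> drawn D (walk_edges (a # [u] @ [b])) = {}"
      using hubs we by (intro star(3)) auto
  qed (use star in auto)
  have U_in: "?U \<subseteq> inside (cycle_support ?ws D)"
  proof (rule side)
    show "connected ?U" using embedding_edge_delete(1)[OF D, of u c "{u, c}"] E(1) by simp
    show "?U \<subseteq> inside (cycle_support ?vs D)"
      using chord_inside[OF D cyc ins, of "{{u, c}}"] E(1) nc[of c] by auto
    show "vpos D c \<in> closure ?U"
      using embedding_edge_delete(2)[OF D, of u c "{u, c}"] embedding_ends[OF D, of c u] E(1)[of c]
      by (auto simp: insert_commute)
    have "drawn D {{u, c}} \<inter> drawn D (walk_edges (a # [u] @ [b])) = vpos D ` ({u, c} \<inter> {a, u, b})"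
      by (subst embedding_drawn_Int[OF D])
         (use E(1) we dist hubs in \<open>auto simp: doubleton_eq_iff\<close>)
    then show "?U \<inter> drawn D (walk_edges (a # [u] @ [b])) = {}" by auto
  qed
  have cyc': "is_cycle G (u # [b] @ c # (ys @ [a]))"
  proof -
    have "{u, b} \<in> edges G" "{a, u} \<in> edges G" using E(1)[of a] E(1)[of b] by (simp_all add: insert_commute)
    moreover have "walk_edges (b # c # ys @ [a]) \<subseteq> edges G"
      using CE cycle_edges_split[of a "[]" b "c # ys"] by auto
    ultimately have "cycle_edges ?ws \<subseteq> edges G"
      using walk_edges_append[of "c # ys" a "[u]"] by (simp add: cycle_edges_eq_walk)
    then show ?thesis using dist V hubs by (auto simp: is_cycle_def)
  qed
  have "vpos D b \<notin> closure (star D v {a, b})"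
  proof (rule chord_walk_separates(2)[OF D cyc', of "[]" _ a])
    show "star D v {a, b} \<subseteq> inside (cycle_support (u # [b] @ c # ys @ [a]) D)"
      using T_in by (auto simp: star_def)
    show "drawn D (walk_edges (u # [] @ [c])) - vpos D ` {u, c}
      \<subseteq> inside (cycle_support (u # [b] @ c # ys @ [a]) D)" using U_in by simp
    show "star D v {a, b} \<inter> drawn D (walk_edges (u # [] @ [c])) = {}"
      using E(1)[of c] hubs by (intro star(3)) auto
  qed (use star[of "{a, b}"] E(1)[of c] hubs in auto)
  then show False using star(2)[of "{a, b}" b] by auto
qed


section \<open>Levels as plane graphs\<close>

lemma embedding_image:
  assumes D: "embedding G D" and V': "V' \<subseteq> verts G" and VE: "\<Union>E' \<subseteq> V'" and E': "E' \<subseteq> edges G"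
    and cont: "continuous_on (drawn D E') f" and inj: "inj_on f (vpos D ` V' \<union> drawn D E')"
  shows "embedding \<lparr>verts = V', edges = E'\<rparr>
    \<lparr>vpos = (\<lambda>v. f (vpos D v)), epos = (\<lambda>e. f ` epos D e)\<rparr>"
proof -
  have sub: "epos D e \<subseteq> drawn D E'" if "e \<in> E'" for e using that by (auto simp: drawn_def)
  have img: "f ` A \<inter> f ` B = f ` (A \<inter> B)"
    if "A \<subseteq> vpos D ` V' \<union> drawn D E'" "B \<subseteq> vpos D ` V' \<union> drawn D E'" for A B
    using inj_on_image_Int[OF inj that] by simp
  have 1: "inj_on (\<lambda>v. f (vpos D v)) V'"
    using comp_inj_on[OF inj_on_subset[OF embedding_inj[OF D] V'], of f] inj_on_subset[OF inj]
    by (simp add: o_def)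
  have 2: "\<exists>u v g. e = {u, v} \<and> arc g \<and> pathstart g = f (vpos D u) \<and>
      pathfinish g = f (vpos D v) \<and> f ` epos D e = path_image g" if e: "e \<in> E'" for e
  proof -
    have "e \<in> edges G" using e E' by blast
    then obtain u v g where g: "e = {u, v}" "arc g" "pathstart g = vpos D u"
      "pathfinish g = vpos D v" "epos D e = path_image g"
      using D unfolding embedding_def by meson
    have sub': "path_image g \<subseteq> drawn D E'" using sub[OF e] g by simp
    have "arc (f \<circ> g)" unfolding arc_def
    proof
      show "path (f \<circ> g)"
        using arc_imp_path[OF g(2)] continuous_on_subset[OF cont sub'] by (rule path_continuous_image)
      show "inj_on (f \<circ> g) {0..1}"
        using g(2) sub' by (intro comp_inj_on) (auto simp: arc_def path_image_def intro: inj_on_subset[OF inj])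
    qed
    then show ?thesis using g
      by (intro exI[of _ u] exI[of _ v] exI[of _ "f \<circ> g"])
        (simp add: pathstart_compose pathfinish_compose path_image_compose)
  qed
  have 3: "f ` epos D e \<inter> (\<lambda>v. f (vpos D v)) ` V' = (\<lambda>v. f (vpos D v)) ` e" if e: "e \<in> E'" for e
  proof -
    have ee: "epos D e \<inter> vpos D ` verts G = vpos D ` e"
      using e E' by (intro embedding_edge_verts[OF D]) auto
    have "e \<subseteq> V'" using e VE by blast
    have "epos D e \<inter> vpos D ` V' = vpos D ` e"
      using ee V' image_mono[OF \<open>e \<subseteq> V'\<close>, of "vpos D"] by blast
    moreover have "f ` epos D e \<inter> f ` vpos D ` V' = f ` (epos D e \<inter> vpos D ` V')"
      using sub[OF e] by (intro img) auto
    ultimately show ?thesis by (simp add: image_image)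
  qed
  have 4: "f ` epos D e \<inter> f ` epos D e' = (\<lambda>v. f (vpos D v)) ` (e \<inter> e')"
    if "e \<in> E'" "e' \<in> E'" "e \<noteq> e'" for e e'
  proof -
    have "f ` epos D e \<inter> f ` epos D e' = f ` (epos D e \<inter> epos D e')"
      using sub that by (intro img) auto
    also have "epos D e \<inter> epos D e' = vpos D ` (e \<inter> e')"
      using that E' by (intro embedding_edge_Int[OF D]) auto
    finally show ?thesis by (simp add: image_image)
  qed
  show ?thesis unfolding embedding_def using 1 2 3 4 by simp
qed

lemma embedding_edge_pair: "embedding G D \<Longrightarrow> e \<in> edges G \<Longrightarrow> \<exists>x y. e = {x, y}"
  unfolding embedding_def by meson

text \<open>
  An edge outside the spine is connected off the spine, so it lies in a single fragment, whose
  level it inherits. Edges that share a vertex off the spine lie in the same fragment. Fragments of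
  one level do not cross each other, fragments have no self-crossings and do not cross the
  spine; hence the projection is injective on the spine together with the edges of one level.
\<close>

lemma edge_levels:
  assumes D: "embedding G D" and lv: "divided_in_levels G D vs N"
    and V: "\<Union>(edges G) \<subseteq> verts G"
  obtains lev :: "'v set \<Rightarrow> nat" where
    "\<And>e. e \<in> edges G - cycle_edges vs \<Longrightarrow> lev e \<in> {1..N}"
    "\<And>e f v. e \<in> edges G - cycle_edges vs \<Longrightarrow> f \<in> edges G - cycle_edges vs \<Longrightarrow>
       v \<in> e \<inter> f - set vs \<Longrightarrow> lev e = lev f"
    "\<And>M i. M \<subseteq> {e \<in> edges G - cycle_edges vs. lev e = i} \<Longrightarrow>
       inj_on fst (cycle_support vs D \<union> drawn D M)"
    "\<And>e. e \<in> edges G - cycle_edges vs \<Longrightarrow>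
       fst ` (epos D e - cycle_support vs D) \<subseteq> inside (fst ` cycle_support vs D)"
proof -
  let ?C = "cycle_support vs D" and ?S = "support G D - cycle_support vs D"
  let ?F = "fragments G D vs" and ?E = "edges G - cycle_edges vs"
  have sl: "semi_leveled_diagram G D vs" and ins: "\<And>f. f \<in> ?F \<Longrightarrow> fst ` (f - ?C) \<subseteq> inside (fst ` ?C)"
    using lv by (auto simp: divided_in_levels_def)
  have cyc: "is_cycle G vs" and injC: "inj_on fst ?C" and injF: "\<And>f. f \<in> ?F \<Longrightarrow> inj_on fst f"
    and FC: "\<And>f a b. f \<in> ?F \<Longrightarrow> a \<in> f \<Longrightarrow> b \<in> ?C \<Longrightarrow> fst a = fst b \<Longrightarrow> a = b"
    using sl by (auto simp: semi_leveled_diagram_def)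
  have "\<exists>L :: nat \<Rightarrow> R3 set set. inj_on L {1..N} \<and> partition_on ?F (L ` {1..N}) \<and>
        (1 \<le> N \<longrightarrow> L 1 = {f \<in> ?F. \<forall>g\<in>?F. g \<noteq> f \<longrightarrow> \<not> crosses_over f g}) \<and>
        (\<forall>i\<in>{2..N}. L i = {f \<in> ?F. (\<exists>g\<in>L (i - 1). crosses_over f g) \<and>
             (\<forall>g\<in>?F. crosses_over f g \<longrightarrow> (\<exists>k\<in>{1..<i}. g \<in> L k))})"
    using lv unfolding divided_in_levels_def by (elim conjE)
  then obtain L :: "nat \<Rightarrow> R3 set set" where injL: "inj_on L {1..N}"
    and part: "partition_on ?F (L ` {1..N})"
    and L1: "1 \<le> N \<longrightarrow> L 1 = {f \<in> ?F. \<forall>g\<in>?F. g \<noteq> f \<longrightarrow> \<not> crosses_over f g}"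
    and Li: "\<forall>i\<in>{2..N}. L i = {f \<in> ?F. (\<exists>g\<in>L (i - 1). crosses_over f g) \<and>
             (\<forall>g\<in>?F. crosses_over f g \<longrightarrow> (\<exists>k\<in>{1..<i}. g \<in> L k))}"
    by (elim exE conjE) (rule that)
  have L_unique: "i = j" if "i \<in> {1..N}" "j \<in> {1..N}" "f \<in> L i" "f \<in> L j" for i j f
    using part injL that unfolding partition_on_def disjoint_def by (metis IntI emptyE image_eqI inj_onD)
  have L_cover: "\<exists>i\<in>{1..N}. f \<in> L i" if "f \<in> ?F" for f
    using part that unfolding partition_on_def by auto
  have same_level: "\<not> crosses_over f g"
    if i: "i \<in> {1..N}" and fg: "f \<in> L i" "g \<in> L i" "f \<noteq> g" for i f g
  proof (cases "i = 1")
    case True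
    then show ?thesis using L1 i fg by auto
  next
    case False
    then have i2: "i \<in> {2..N}" using i by auto
    show ?thesis
    proof
      assume "crosses_over f g"
      moreover have "f \<in> L i \<longleftrightarrow> f \<in> ?F \<and> (\<exists>g\<in>L (i - 1). crosses_over f g) \<and>
             (\<forall>g\<in>?F. crosses_over f g \<longrightarrow> (\<exists>k\<in>{1..<i}. g \<in> L k))" for f
        by (subst bspec[OF Li i2]) simp
      ultimately obtain k where "k \<in> {1..<i}" "g \<in> L k" using fg by meson
      then show False using L_unique[of k i g] i fg by auto
    qed
  qed
  have Cverts: "?C \<inter> vpos D ` verts G = vpos D ` set vs"
    using drawn_Int_verts[OF D, of "cycle_edges vs"] cyc Union_cycle_edges[of vs]
    by (simp add: cycle_support_eq_drawn is_cycle_def)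
  have edge: "connected (epos D e - ?C) \<and> epos D e - ?C \<noteq> {} \<and> epos D e \<subseteq> closure (epos D e - ?C)"
    if e: "e \<in> ?E" for e
  proof -
    obtain x y where xy: "e = {x, y}" using embedding_edge_pair[OF D, of e] e by blast
    have "drawn D {e} \<inter> drawn D (cycle_edges vs) = vpos D ` (\<Union>{e} \<inter> \<Union>(cycle_edges vs))"
      using e cyc by (intro embedding_drawn_Int[OF D]) (auto simp: is_cycle_def)
    then have "epos D e \<inter> ?C = vpos D ` (e \<inter> set vs)"
      using Union_cycle_edges[of vs] cyc by (simp add: cycle_support_eq_drawn is_cycle_def)
    then have "epos D e - ?C = epos D {x, y} - vpos D ` ({x, y} \<inter> set vs)" unfolding xy by blast
    then show ?thesis
      using embedding_edge_delete[OF D, of x y "{x, y} \<inter> set vs"] e by (simp add: xy)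
  qed
  have "\<exists>c\<in>components ?S. epos D e - ?C \<subseteq> c" if e: "e \<in> ?E" for e
  proof -
    have "epos D e - ?C \<subseteq> ?S" using e by (auto simp: support_def)
    moreover have "?S \<noteq> {}" using calculation edge[OF e] by blast
    ultimately show ?thesis using exists_component_superset edge[OF e] by metis
  qed
  then obtain comp where comp: "\<And>e. e \<in> ?E \<Longrightarrow> comp e \<in> components ?S"
    "\<And>e. e \<in> ?E \<Longrightarrow> epos D e - ?C \<subseteq> comp e" by metis
  have frag: "closure (comp e) \<in> ?F" "epos D e \<subseteq> closure (comp e)" if e: "e \<in> ?E" for e
    using comp(1)[OF e] edge[OF e] closure_mono[OF comp(2)[OF e]] by (auto simp: fragments_def)
  \<comment> \<open>Choosing the level through the fragment makes it depend on the fragment only.\<close>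
  define lev where "lev = (\<lambda>e. SOME i. i \<in> {1..N} \<and> closure (comp e) \<in> L i)"
  have lev: "lev e \<in> {1..N} \<and> closure (comp e) \<in> L (lev e)" if e: "e \<in> ?E" for e
    unfolding lev_def by (rule someI_ex) (use L_cover[OF frag(1)[OF e]] in blast)
  show thesis
  proof
    show "lev e \<in> {1..N}" if "e \<in> ?E" for e using lev[OF that] by blast
    show "lev e = lev f" if ef: "e \<in> ?E" "f \<in> ?E" and v: "v \<in> e \<inter> f - set vs" for e f v
    proof -
      have vV: "v \<in> verts G" using V v ef by blast
      have "vpos D v \<notin> vpos D ` set vs"
        using v vV cyc by (subst inj_on_image_mem_iff[OF embedding_inj[OF D]]) (auto simp: is_cycle_def)
      then have "vpos D v \<notin> ?C" using Cverts vV by blast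
      moreover have "vpos D v \<in> epos D e" "vpos D v \<in> epos D f"
        using vpos_in_drawn[OF D, of "{e}" v] vpos_in_drawn[OF D, of "{f}" v] ef v by simp_all
      ultimately have "vpos D v \<in> comp e \<inter> comp f" using comp(2) ef by blast
      then have "comp e = comp f" using comp(1)[OF ef(1)] comp(1)[OF ef(2)] components_eq by blast
      then show ?thesis by (simp add: lev_def)
    qed
    show "fst ` (epos D e - ?C) \<subseteq> inside (fst ` ?C)" if "e \<in> ?E" for e
      using ins[OF frag(1)[OF that]] frag(2)[OF that] by blast
    show "inj_on fst (?C \<union> drawn D M)" if M: "M \<subseteq> {e \<in> ?E. lev e = i}" for M i
    proof (rule inj_onI)
      have inM: "\<exists>f\<in>L i. x \<in> f \<and> f \<in> ?F \<and> i \<in> {1..N}" if x: "x \<in> drawn D M" for x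
      proof -
        obtain e where e: "e \<in> M" "x \<in> epos D e" using x by (auto simp: drawn_def)
        then have "e \<in> ?E" "lev e = i" using M by auto
        then show ?thesis using lev[of e] frag[of e] e by blast
      qed
      fix x y assume xy: "x \<in> ?C \<union> drawn D M" "y \<in> ?C \<union> drawn D M" "fst x = fst y"
      consider "x \<in> ?C" "y \<in> ?C" | "x \<in> drawn D M" "y \<in> ?C" | "x \<in> ?C" "y \<in> drawn D M"
        | "x \<in> drawn D M" "y \<in> drawn D M" using xy by blast
      then show "x = y"
      proof cases
        case 1 then show ?thesis using injC xy(3) by (meson inj_onD)
      next
        case 2 then show ?thesis using inM[of x] FC[of _ x y] xy(3) by blast
      next
        case 3 then show ?thesis using inM[of y] FC[of _ y x] xy(3) by metis
      next
        case 4
        obtain f g where f: "f \<in> L i" "x \<in> f" "f \<in> ?F" and g: "g \<in> L i" "y \<in> g" "g \<in> ?F"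
          and i: "i \<in> {1..N}" using inM[OF 4(1)] inM[OF 4(2)] by blast
        show ?thesis
        proof (cases "f = g")
          case True
          then show ?thesis using injF[OF f(3)] f g xy(3) by (meson inj_onD)
        next
          case False
          have "\<not> crosses_over f g" "\<not> crosses_over g f"
            using same_level[OF i] f g False by auto
          then have "\<not> snd y < snd x" "\<not> snd x < snd y"
            using f g xy(3) unfolding crosses_over_def by metis+
          then show ?thesis using xy(3) by (simp add: prod_eq_iff)
        qed
      qed
    qed
  qed
qed

lemma level_planar_embedding:
  assumes D: "embedding G D" and cyc: "is_cycle G vs" and V: "\<Union>(edges G) \<subseteq> verts G"
    and M: "M \<subseteq> edges G - cycle_edges vs"
    and inj: "inj_on fst (cycle_support vs D \<union> drawn D M)"
    and ins: "\<And>e. e \<in> M \<Longrightarrow>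
       fst ` (epos D e - cycle_support vs D) \<subseteq> inside (fst ` cycle_support vs D)"
  defines "H \<equiv> \<lparr>verts = set vs \<union> \<Union>M, edges = cycle_edges vs \<union> M\<rparr>"
    and "B \<equiv> \<lparr>vpos = (\<lambda>v. fst (vpos D v)), epos = (\<lambda>e. fst ` epos D e)\<rparr>"
  shows "embedding H B" "is_cycle H vs" "chords_inside H B vs"
proof -
  have CE: "cycle_edges vs \<subseteq> edges G" "\<Union>(cycle_edges vs) = set vs" "set vs \<subseteq> verts G"
    using cyc Union_cycle_edges[of vs] by (auto simp: is_cycle_def)
  have sub: "cycle_edges vs \<union> M \<subseteq> edges G" using CE M by auto
  have "vpos D ` (set vs \<union> \<Union>M) \<subseteq> drawn D (cycle_edges vs \<union> M)"
    using vpos_in_drawn[OF D sub] CE(2) by (metis Union_Un_distrib image_subsetI)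
  moreover have dr: "drawn D (cycle_edges vs \<union> M) = cycle_support vs D \<union> drawn D M"
    by (simp add: cycle_support_eq_drawn)
  ultimately have inj': "inj_on fst (vpos D ` (set vs \<union> \<Union>M) \<union> drawn D (cycle_edges vs \<union> M))"
    using inj by (simp only: Un_absorb1)
  show "embedding H B" unfolding H_def B_def
  proof (rule embedding_image[OF D _ _ sub _ inj'])
    have "\<Union>M \<subseteq> verts G" using M V by blast
    then show "set vs \<union> \<Union>M \<subseteq> verts G" using CE by blast
    show "\<Union>(cycle_edges vs \<union> M) \<subseteq> set vs \<union> \<Union>M" using CE by blast
  qed (intro continuous_intros)
  show "is_cycle H vs" using cyc by (auto simp: H_def is_cycle_def)
  have CS: "cycle_support vs B = fst ` cycle_support vs D"
    by (auto simp: B_def cycle_support_def)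
  show "chords_inside H B vs"
    unfolding chords_inside_def
  proof
    fix e assume "e \<in> edges H - cycle_edges vs"
    then have e: "e \<in> M" by (auto simp: H_def)
    then have "epos D e \<union> cycle_support vs D \<subseteq> cycle_support vs D \<union> drawn D M" by (auto simp: drawn_def)
    then have "fst ` epos D e - fst ` cycle_support vs D = fst ` (epos D e - cycle_support vs D)"
      using inj_on_image_set_diff[OF inj, of "epos D e" "cycle_support vs D"] by blast
    then show "epos B e - cycle_support vs B \<subseteq> inside (cycle_support vs B)"
      using ins[OF e] CS by (simp add: B_def)
  qed
qed

lemma diagonal_not_cycle_edge:
  assumes "distinct vs" "(i, j) \<in> diagonals (length vs)"
  shows "{vs ! i, vs ! j} \<notin> cycle_edges vs"
proof
  assume "{vs ! i, vs ! j} \<in> cycle_edges vs"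
  then obtain m where m: "m < length vs" "{vs ! i, vs ! j} = {vs ! m, vs ! (Suc m mod length vs)}"
    by (auto simp: cycle_edges_def)
  have ij: "i + 2 \<le> j" "j < length vs" "(i, j) \<noteq> (0, length vs - 1)" using assms(2) by (auto simp: diagonals_def)
  have "Suc m mod length vs < length vs" using m(1) by (intro mod_less_divisor) auto
  then have "(i = m \<and> j = Suc m mod length vs) \<or> (i = Suc m mod length vs \<and> j = m)"
    using m ij assms(1) by (auto simp: doubleton_eq_iff nth_eq_iff_index_eq)
  then show False using m(1) ij by (cases "Suc m = length vs") auto
qed

lemma split_list_at_two:
  assumes "i < j" "j < length vs"
  obtains xs ys zs where "vs = zs @ (vs ! i # xs @ vs ! j # ys)"
    "\<And>k. i < k \<Longrightarrow> k < j \<Longrightarrow> vs ! k \<in> set xs"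
    "\<And>k. j < k \<Longrightarrow> k < length vs \<Longrightarrow> vs ! k \<in> set ys"
    "\<And>k. k < i \<Longrightarrow> vs ! k \<in> set zs"
proof
  let ?m = "map ((!) vs)"
  have "[0..<length vs] = [0..<i] @ (i # [Suc i..<j]) @ (j # [Suc j..<length vs])"
    using assms upt_add_eq_append[of 0 i "length vs - i"] upt_add_eq_append[of i j "length vs - j"]
    by (simp add: upt_conv_Cons)
  then have "?m [0..<length vs] = ?m [0..<i] @ (vs ! i # ?m [Suc i..<j] @ vs ! j # ?m [Suc j..<length vs])"
    by simp
  then show "vs = ?m [0..<i] @ (vs ! i # ?m [Suc i..<j] @ vs ! j # ?m [Suc j..<length vs])"
    by (simp only: map_nth)
qed auto


section \<open>The lower bound for levels\<close>

text \<open>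
  A single vertex off the spine occupies a level of its own, which makes up for the smaller number
  of diagonals of the shorter spine.
\<close>

lemma level_count_lower_bound:
  assumes n: "5 \<le> n" and D: "embedding (complete_graph n) D"
    and lv: "divided_in_levels (complete_graph n) D vs N"
  shows "n \<le> 2 * N"
proof -
  let ?G = "complete_graph n" and ?k = "length vs"
  have vertsG: "verts ?G = {..<n}" by (simp add: complete_graph_def)
  have edgesG: "{x, y} \<in> edges ?G" if "x < n" "y < n" "x \<noteq> y" for x y
    using that by (auto simp: complete_graph_def)
  have V: "\<Union>(edges ?G) \<subseteq> verts ?G" by (auto simp: complete_graph_def)
  have cyc: "is_cycle ?G vs" using lv by (simp add: divided_in_levels_def semi_leveled_diagram_def)
  have dist: "distinct vs" and k3: "3 \<le> ?k" and vsV: "set vs \<subseteq> {..<n}"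
    using cyc by (auto simp: is_cycle_def vertsG)
  have card: "card (set vs) = ?k" using dist by (rule distinct_card)
  let ?E = "edges ?G - cycle_edges vs"
  obtain lev where lev: "\<And>e. e \<in> ?E \<Longrightarrow> lev e \<in> {1..N}"
    and hub: "\<And>e f v. e \<in> ?E \<Longrightarrow> f \<in> ?E \<Longrightarrow> v \<in> e \<inter> f - set vs \<Longrightarrow> lev e = lev f"
    and inj: "\<And>M i. M \<subseteq> {e \<in> ?E. lev e = i} \<Longrightarrow> inj_on fst (cycle_support vs D \<union> drawn D M)"
    and ins: "\<And>e. e \<in> ?E \<Longrightarrow> fst ` (epos D e - cycle_support vs D) \<subseteq> inside (fst ` cycle_support vs D)"
    by (rule edge_levels[OF D lv V]) (rule that)
  define H where "H = (\<lambda>M. \<lparr>verts = set vs \<union> \<Union>M, edges = cycle_edges vs \<union> M\<rparr>)"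
  define B where "B = \<lparr>vpos = (\<lambda>v. fst (vpos D v)), epos = (\<lambda>e. fst ` epos D e)\<rparr>"
  have planar: "embedding (H M) B" "is_cycle (H M) vs" "chords_inside (H M) B vs"
    if M: "M \<subseteq> {e \<in> ?E. lev e = i}" for M i
  proof -
    have M': "M \<subseteq> ?E" using M by auto
    note * = level_planar_embedding[OF D cyc V M' inj[OF M] ins, folded B_def H_def]
    show "embedding (H M) B" "is_cycle (H M) vs" "chords_inside (H M) B vs"
      using * M' by (auto simp: H_def)
  qed
  have rot: "is_cycle (H M) (ws @ zs)" "chords_inside (H M) B (ws @ zs)"
      "cycle_edges (ws @ zs) = cycle_edges vs"
    if "vs = zs @ ws" "M \<subseteq> {e \<in> ?E. lev e = i}" for M i ws zs
    using planar[OF that(2)] that(1) is_cycle_commute[of "H M" zs ws] cycle_edges_commute[of zs ws]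
    by (simp_all add: chords_inside_def cycle_support_def)
  have diag: "{vs ! i, vs ! j} \<in> ?E" if "(i, j) \<in> diagonals ?k" for i j
  proof -
    have ij: "i < j" "j < ?k" using that by (auto simp: diagonals_def)
    then have "vs ! i \<in> set vs" "vs ! j \<in> set vs" "vs ! i \<noteq> vs ! j"
      using dist by (auto simp: nth_eq_iff_index_eq)
    then show ?thesis using edgesG vsV diagonal_not_cycle_edge[OF dist that] by auto
  qed
  define c where "c = (\<lambda>(i, j). lev {vs ! i, vs ! j})"
  have nc: "c p \<noteq> c q" if pq: "p \<in> diagonals ?k" "q \<in> diagonals ?k" "interleaved p q" for p q
  proof
    assume eq: "c p = c q"
    obtain i j k l where p: "p = (i, j)" and q: "q = (k, l)" by (cases p, cases q)
    have o: "i < k" "k < j" "j < l" "l < ?k"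
      using pq by (auto simp: p q interleaved_def diagonals_def)
    obtain xs ys zs where vs: "vs = zs @ (vs ! i # xs @ vs ! j # ys)"
      and xs: "vs ! k \<in> set xs" and ys: "vs ! l \<in> set ys"
      using split_list_at_two[of i j vs] o by (metis less_trans)
    let ?M = "{{vs ! i, vs ! j}, {vs ! k, vs ! l}}"
    have M: "?M \<subseteq> {e \<in> ?E. lev e = c p}" using diag pq eq by (auto simp: c_def p q)
    note R = rot[OF vs M]
    have ME: "?M \<subseteq> edges (H ?M) - cycle_edges vs" using M by (auto simp: H_def)
    show False
      using no_crossing_chords[OF planar(1)[OF M], of "vs ! i" xs "vs ! j" "ys @ zs" "vs ! k" "vs ! l"]
        R xs ys ME by simp
  qed
  consider "set vs = {..<n}" | v where "{..<n} - set vs = {v}"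
    | u v where "u \<in> {..<n} - set vs" "v \<in> {..<n} - set vs" "u \<noteq> v"
    using vsV by blast
  then show ?thesis
  proof cases
    case 1
    then have "?k = n" using card by simp
    then have "n \<le> 2 * card {1..N}"
      using noncrossing_colouring_bound[of ?k "{1..N}" c] n nc lev diag by (force simp: c_def)
    then show ?thesis by simp
  next
    case (2 v)
    have v: "v < n" "v \<notin> set vs" and ins_v: "{..<n} = insert v (set vs)" using 2 vsV by auto
    have kn: "n = Suc ?k"
    proof -
      have "n = card (insert v (set vs))" using ins_v by (metis card_lessThan)
      then show ?thesis using v card by simp
    qed
    have spoke: "{v, x} \<in> ?E" if "x \<in> set vs" for x
      using that v vsV edgesG[of v x] Union_cycle_edges[of vs] k3 by auto
    define l where "l = lev {v, vs ! 0}"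
    have vs0: "vs ! 0 \<in> set vs" using k3 by (intro nth_mem) linarith
    have lspoke: "lev {v, x} = l" if "x \<in> set vs" for x
      unfolding l_def using hub[OF spoke[OF that] spoke[OF vs0], of v] v by simp
    have "c p \<noteq> l" if p: "p \<in> diagonals ?k" for p
    proof
      assume eq: "c p = l"
      obtain i j where ij: "p = (i, j)" by (cases p)
      have o: "i + 2 \<le> j" "j < ?k" "0 < i \<or> Suc j < ?k" using p by (auto simp: ij diagonals_def)
      obtain xs ys zs where vs: "vs = zs @ (vs ! i # xs @ vs ! j # ys)"
        and xs: "\<And>k. i < k \<Longrightarrow> k < j \<Longrightarrow> vs ! k \<in> set xs"
        and ys: "\<And>k. j < k \<Longrightarrow> k < length vs \<Longrightarrow> vs ! k \<in> set ys"
        and zs: "\<And>k. k < i \<Longrightarrow> vs ! k \<in> set zs"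
        using split_list_at_two[of i j vs] o by (metis less_add_same_cancel1 less_le_trans zero_less_numeral)
      \<comment> \<open>\<open>v\<close> is joined to vertices on both sides of the diagonal \<open>(i, j)\<close>: to \<open>i + 1\<close> and to \<open>q\<close>.\<close>
      define q where "q = (if 0 < i then vs ! 0 else vs ! Suc j)"
      have q: "q \<in> set (ys @ zs)" using o ys[of "Suc j"] zs[of 0] by (auto simp: q_def)
      have P: "vs ! Suc i \<in> set xs" using xs[of "Suc i"] o by simp
      have setvs: "set vs = set (zs @ (vs ! i # xs @ vs ! j # ys))" using vs by simp
      let ?M = "{{vs ! i, vs ! j}, {v, vs ! Suc i}, {v, q}}"
      have mem: "vs ! Suc i \<in> set vs" "q \<in> set vs" using P q unfolding setvs by auto
      have M: "?M \<subseteq> {e \<in> ?E. lev e = l}"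
        using diag[of i j] p eq spoke[OF mem(1)] spoke[OF mem(2)] lspoke[OF mem(1)] lspoke[OF mem(2)]
        by (simp add: c_def ij)
      note R = rot[OF vs M]
      have ME: "?M \<subseteq> edges (H ?M) - cycle_edges vs" using M by (auto simp: H_def)
      have vH: "v \<in> verts (H ?M)" by (simp add: H_def)
      have vnot: "v \<notin> set (vs ! i # xs @ vs ! j # ys @ zs)" using v(2) unfolding setvs by simp
      show False
        using no_chord_beside_hub[OF planar(1)[OF M], of "vs ! i" xs "vs ! j" "ys @ zs" v "vs ! Suc i" q]
          R P q ME vH vnot by simp
    qed
    then have "?k \<le> 2 * card ({1..N} - {l})"
      using n kn nc lev diag by (intro noncrossing_colouring_bound[of ?k _ c]) (auto simp: c_def)
    moreover have "card ({1..N} - {l}) = N - 1" "1 \<le> N"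
      using lev[OF spoke[OF vs0]] by (auto simp: l_def)
    ultimately show ?thesis using kn by linarith
  next
    case (3 u v)
    obtain x0 x1 x2 ys where vs: "vs = x0 # x1 # x2 # ys"
      using k3 by (metis (no_types) Suc_le_length_iff numeral_3_eq_3)
    have spoke: "{w, x} \<in> ?E" if "x \<in> set vs" "w \<in> {u, v}" for x w
      using that 3 vsV edgesG[of w x] Union_cycle_edges[of vs] k3 by auto
    have uv: "{u, v} \<in> ?E" using 3 edgesG[of u v] Union_cycle_edges[of vs] k3 by auto
    have ls: "lev {w, x} = lev {u, v}" if "x \<in> set vs" "w \<in> {u, v}" for x w
      using hub[OF spoke[OF that] uv, of w] that 3 by auto
    define M where "M = (\<lambda>(w, x). {w, x}) ` ({u, v} \<times> {x0, x1, x2})"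
    have M: "M \<subseteq> {e \<in> ?E. lev e = lev {u, v}}"
      using spoke ls by (auto simp: M_def vs)
    have ME: "{w, x} \<in> edges (H M)" if "w \<in> {u, v}" "x \<in> {x0, x1, x2}" for w x
      using that by (auto simp: H_def M_def)
    have UM: "u \<in> verts (H M)" "v \<in> verts (H M)" by (auto simp: H_def M_def)
    have False
      using no_two_hubs[OF planar(1)[OF M], of x0 x1 x2 ys u v] planar[OF M] UM 3 ME
      unfolding vs by auto
    then show ?thesis ..
  qed
qed

lemma complete_graph_level_number_ge:
  assumes n: "5 \<le> n"
  shows "enat (nat \<lceil>real n / 2\<rceil>) \<le> level_number (complete_graph n)"
  unfolding level_number_def spatial_level_number_def
proof (intro INF_greatest Inf_greatest)
  fix \<G> x
  assume "x \<in> {enat N | N D vs. pl_representative (complete_graph n) \<G> D \<and>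
    divided_in_levels (complete_graph n) D vs N}"
  then obtain N D vs where x: "x = enat N" and D: "pl_representative (complete_graph n) \<G> D"
    and lv: "divided_in_levels (complete_graph n) D vs N" by blast
  have "embedding (complete_graph n) D"
    using D by (simp add: pl_representative_def pl_embedding_def)
  then have "n \<le> 2 * N" using level_count_lower_bound[OF n _ lv] by blast
  then show "enat (nat \<lceil>real n / 2\<rceil>) \<le> x" unfolding x by (simp add: ceiling_le_iff nat_le_iff)
qed

lemma level_number_le_hamiltonian: "level_number G \<le> hamiltonian_level_number G"
  unfolding level_number_def hamiltonian_level_number_def
    spatial_level_number_def spatial_hamiltonian_level_number_def
  by (intro INF_mono' Inf_superset_mono) blast


section \<open>Complete graphs drawn by parametrised curves\<close>

lemma complete_graph_edge:
  assumes "e \<in> edges (complete_graph n)"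
  obtains i j where "i < j" "j < n" "e = {i, j}"
proof -
  have "e \<subseteq> {..<n}" "card e = 2" using assms by (auto simp: complete_graph_def)
  then obtain i j where ij: "e = {i, j}" "i \<noteq> j" by (meson card_2_iff)
  then have "i < n" "j < n" using \<open>e \<subseteq> {..<n}\<close> by auto
  then show thesis using ij that[of i j] that[of j i] by (cases "i < j") (auto simp: insert_commute)
qed

text \<open>
  The edge between \<open>i < j\<close> is parametrised by the interval from \<open>x i\<close> to \<open>x j\<close>. In the book \<open>x\<close> is
  the position on the spine, in the leveled diagram it is the real part of the projection.
\<close>

definition curve_drawing ::
  "(nat \<Rightarrow> real) \<Rightarrow> (nat \<Rightarrow> 'a) \<Rightarrow> (nat \<Rightarrow> nat \<Rightarrow> real \<Rightarrow> 'a) \<Rightarrow> (nat, 'a) drawing" where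
  "curve_drawing x V F = \<lparr>vpos = V, epos = (\<lambda>e. F (Min e) (Max e) ` {x (Min e)..x (Max e)})\<rparr>"

lemma vpos_curve_drawing [simp]: "vpos (curve_drawing x V F) = V"
  by (simp add: curve_drawing_def)

lemma epos_curve_drawing [simp]:
  "i < j \<Longrightarrow> epos (curve_drawing x V F) {i, j} = F i j ` {x i..x j}"
  by (simp add: curve_drawing_def)

lemma arc_of_injective_curve:
  fixes F :: "real \<Rightarrow> 'a::topological_space"
  assumes "continuous_on {p..q} F" "inj_on F {p..q}" "p < q"
  obtains g where "arc g" "pathstart g = F p" "pathfinish g = F q" "path_image g = F ` {p..q}"
proof
  have img: "path_image (linepath p q) = {p..q}"
    using assms(3) by (simp add: closed_segment_eq_real_ivl)
  show "path_image (F \<circ> linepath p q) = F ` {p..q}" by (simp only: path_image_compose img)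
  have "path (F \<circ> linepath p q)"
    using assms(1) by (intro path_continuous_image) (simp_all only: img path_linepath)
  moreover have "inj_on (F \<circ> linepath p q) {0..1}"
    using arc_linepath[of p q] assms img
    by (intro comp_inj_on) (auto simp: arc_def path_image_def)
  ultimately show "arc (F \<circ> linepath p q)" by (simp add: arc_def)
qed (simp_all add: pathstart_compose pathfinish_compose)

lemma embedding_curve_drawing:
  fixes F :: "nat \<Rightarrow> nat \<Rightarrow> real \<Rightarrow> 'a::topological_space"
  assumes x: "strict_mono x" and V: "inj_on V {..<n}"
    and ends: "\<And>i j. i < j \<Longrightarrow> j < n \<Longrightarrow> F i j (x i) = V i \<and> F i j (x j) = V j"
    and cont: "\<And>i j. i < j \<Longrightarrow> j < n \<Longrightarrow> continuous_on {x i..x j} (F i j)"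
    and inj: "\<And>i j. i < j \<Longrightarrow> j < n \<Longrightarrow> inj_on (F i j) {x i..x j}"
    and avoid: "\<And>i j k s. i < j \<Longrightarrow> j < n \<Longrightarrow> k < n \<Longrightarrow> s \<in> {x i..x j} \<Longrightarrow> F i j s = V k \<Longrightarrow> k \<in> {i, j}"
    and meet: "\<And>i j k l s t. i < j \<Longrightarrow> j < n \<Longrightarrow> k < l \<Longrightarrow> l < n \<Longrightarrow> (i, j) \<noteq> (k, l) \<Longrightarrow>
      s \<in> {x i..x j} \<Longrightarrow> t \<in> {x k..x l} \<Longrightarrow> F i j s = F k l t \<Longrightarrow> F i j s \<in> V ` ({i, j} \<inter> {k, l})"
  shows "embedding (complete_graph n) (curve_drawing x V F)"
  unfolding embedding_def
proof (intro conjI ballI impI)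
  let ?D = "curve_drawing x V F"
  show "inj_on (vpos ?D) (verts (complete_graph n))" using V by (simp add: complete_graph_def)
  have onF: "V ` {i, j} \<subseteq> F i j ` {x i..x j}" if "i < j" "j < n" for i j
  proof -
    have "x i < x j" by (rule strict_monoD[OF x that(1)])
    then have "F i j (x i) \<in> F i j ` {x i..x j}" "F i j (x j) \<in> F i j ` {x i..x j}" by auto
    then show ?thesis using ends[OF that] by simp
  qed
  fix e assume "e \<in> edges (complete_graph n)"
  then obtain i j where e: "i < j" "j < n" "e = {i, j}" by (rule complete_graph_edge)
  have xij: "x i < x j" using strict_monoD[OF x e(1)] .
  show "\<exists>u v g. e = {u, v} \<and> arc g \<and> pathstart g = vpos ?D u \<and> pathfinish g = vpos ?D v
        \<and> epos ?D e = path_image g"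
    using arc_of_injective_curve[OF cont[OF e(1,2)] inj[OF e(1,2)] xij] ends[OF e(1,2)] e
    by (metis epos_curve_drawing vpos_curve_drawing)
  show "epos ?D e \<inter> vpos ?D ` verts (complete_graph n) = vpos ?D ` e"
  proof
    show "epos ?D e \<inter> vpos ?D ` verts (complete_graph n) \<subseteq> vpos ?D ` e"
    proof
      fix z assume "z \<in> epos ?D e \<inter> vpos ?D ` verts (complete_graph n)"
      then obtain s k where k: "s \<in> {x i..x j}" "k < n" "z = V k" "F i j s = V k"
        using e by (auto simp: complete_graph_def)
      then have "k \<in> {i, j}" using avoid[OF e(1,2)] by blast
      then show "z \<in> vpos ?D ` e" using k e by auto
    qed
    show "vpos ?D ` e \<subseteq> epos ?D e \<inter> vpos ?D ` verts (complete_graph n)"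
      using onF[OF e(1,2)] e by (auto simp: complete_graph_def)
  qed
  fix f assume "f \<in> edges (complete_graph n)"
  then obtain k l where f: "k < l" "l < n" "f = {k, l}" by (rule complete_graph_edge)
  assume "e \<noteq> f"
  then have ne: "(i, j) \<noteq> (k, l)" using e f by auto
  show "epos ?D e \<inter> epos ?D f = vpos ?D ` (e \<inter> f)"
  proof
    show "epos ?D e \<inter> epos ?D f \<subseteq> vpos ?D ` (e \<inter> f)"
    proof
      fix z assume "z \<in> epos ?D e \<inter> epos ?D f"
      then obtain s t where "s \<in> {x i..x j}" "t \<in> {x k..x l}" "z = F i j s" "F i j s = F k l t"
        using e f by auto
      then show "z \<in> vpos ?D ` (e \<inter> f)" using meet[OF e(1,2) f(1,2) ne] e f by simp
    qed
    show "vpos ?D ` (e \<inter> f) \<subseteq> epos ?D e \<inter> epos ?D f"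
      using onF[OF e(1,2)] onF[OF f(1,2)] e f by auto
  qed
qed

lemma affine_image_segment:
  fixes c d :: "'a::real_vector"
  assumes "p \<le> q"
  shows "(\<lambda>s. c + s *\<^sub>R d) ` {p..q} = closed_segment (c + p *\<^sub>R d) (c + q *\<^sub>R d)"
proof -
  have "(\<lambda>s. c + s *\<^sub>R d) ` {p..q} = (+) c ` (\<lambda>s. s *\<^sub>R d) ` closed_segment p q"
    using assms by (simp add: image_image closed_segment_eq_real_ivl)
  also have "(\<lambda>s. s *\<^sub>R d) ` closed_segment p q = closed_segment (p *\<^sub>R d) (q *\<^sub>R d)"
    by (intro closed_segment_linear_image[symmetric] linear_scaleR_left)
  also have "(+) c ` closed_segment (p *\<^sub>R d) (q *\<^sub>R d) = closed_segment (c + p *\<^sub>R d) (c + q *\<^sub>R d)"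
    by (rule closed_segment_translation[symmetric])
  finally show ?thesis .
qed

lemma piecewise_linear_curve:
  fixes F :: "real \<Rightarrow> 'a::euclidean_space"
  assumes "p \<le> m" "m \<le> q"
    and "\<And>s. s \<in> {p..m} \<Longrightarrow> F s = c + s *\<^sub>R d" "\<And>s. s \<in> {m..q} \<Longrightarrow> F s = c' + s *\<^sub>R d'"
  shows "piecewise_linear (F ` {p..q})"
proof -
  have "F ` {p..q} = F ` {p..m} \<union> F ` {m..q}"
    using assms(1,2) by (metis image_Un ivl_disj_un_two_touch(4))
  also have "F ` {p..m} = (\<lambda>s. c + s *\<^sub>R d) ` {p..m}" using assms(3) by (intro image_cong) auto
  also have "F ` {m..q} = (\<lambda>s. c' + s *\<^sub>R d') ` {m..q}" using assms(4) by (intro image_cong) auto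
  finally have eq: "F ` {p..q} = closed_segment (F p) (F m) \<union> closed_segment (F m) (F q)"
    using assms affine_image_segment[of p m c d] affine_image_segment[of m q c' d']
    by (simp add: assms(3,4)) (metis assms(3,4) atLeastAtMost_iff order_refl)
  have "finite {closed_segment (F p) (F m), closed_segment (F m) (F q)}" by simp
  then show ?thesis unfolding piecewise_linear_def
    by (intro exI[of _ "{closed_segment (F p) (F m), closed_segment (F m) (F q)}"])
      (auto simp: eq segment_convex_hull intro: polytope_convex_hull)
qed

lemma independent_pair:
  fixes u w :: "'a::real_vector"
  assumes "u \<noteq> 0" "\<And>k. w \<noteq> k *\<^sub>R u"
  shows "w \<noteq> u \<and> independent {u, w}"
proof -
  have "w \<noteq> u" using assms(2)[of 1] by simp
  moreover have "w \<notin> span {u}" using assms(2) by (auto simp: span_singleton)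
  ultimately show ?thesis using assms(1) by (simp add: independent_insert insert_commute[of u w])
qed

section \<open>The book thickness of complete graphs\<close>

text \<open>
  A tent over \<open>[i, j]\<close> whose slope is its width. A common slope would make arches with a common end
  overlap; with these slopes a wider arch lies strictly over a narrower one nested in it.
\<close>

definition arch :: "nat \<Rightarrow> nat \<Rightarrow> real \<Rightarrow> real" where
  "arch i j s = (real j - real i) * min (s - real i) (real j - s)"

lemma arch_zero: "i < j \<Longrightarrow> s \<in> {real i..real j} \<Longrightarrow> arch i j s = 0 \<longleftrightarrow> s = real i \<or> s = real j"
  unfolding arch_def by (auto simp: min_def)

lemma arch_nonneg: "i < j \<Longrightarrow> s \<in> {real i..real j} \<Longrightarrow> 0 \<le> arch i j s"
  unfolding arch_def by (auto simp: min_def)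

lemma arch_nested:
  assumes "k \<le> i" "i < j" "j \<le> l" "(i, j) \<noteq> (k, l)" "real i < s" "s < real j"
  shows "arch i j s < arch k l s"
  unfolding arch_def
proof (rule mult_less_le_imp_less)
  show "real j - real i < real l - real k" using assms by auto
qed (use assms in \<open>auto simp: min_def\<close>)

text \<open>
  The page of number \<open>p\<close> is the half-plane spanned by the real axis and \<open>(\<i>, p)\<close>.
\<close>

definition book_curve :: "nat \<Rightarrow> nat \<Rightarrow> nat \<Rightarrow> real \<Rightarrow> R3" where
  "book_curve n i j s = (Complex s (arch i j s), real (page n (i, j)) * arch i j s)"

abbreviation book_drawing :: "nat \<Rightarrow> (nat, R3) drawing" where
  "book_drawing n \<equiv> curve_drawing real (\<lambda>v. (of_real (real v), 0)) (book_curve n)"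

lemma pl_embedding_book_drawing: "pl_embedding (complete_graph n) (book_drawing n)"
  unfolding pl_embedding_def
proof
  show "embedding (complete_graph n) (book_drawing n)"
  proof (rule embedding_curve_drawing)
    fix i j :: nat assume ij: "i < j" "j < n"
    show "book_curve n i j (real i) = (of_real (real i), 0) \<and> book_curve n i j (real j) = (of_real (real j), 0)"
      using ij by (simp add: book_curve_def arch_def complex_eq_iff)
    show "continuous_on {real i..real j} (book_curve n i j)"
      unfolding book_curve_def arch_def Complex_eq by (intro continuous_intros)
    show "inj_on (book_curve n i j) {real i..real j}"
      by (rule inj_onI) (simp add: book_curve_def)
    show "k \<in> {i, j}" if "k < n" "s \<in> {real i..real j}" "book_curve n i j s = (of_real (real k), 0)" for k s
    proof -
      have "s = real k" "arch i j s = 0" using that(3) by (auto simp: book_curve_def complex_eq_iff)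
      then show ?thesis using arch_zero[OF ij(1) that(2)] by auto
    qed
    fix k l s t
    assume kl: "k < l" "l < n" and ne: "(i, j) \<noteq> (k, l)"
      and s: "s \<in> {real i..real j}" and t: "t \<in> {real k..real l}"
      and eq: "book_curve n i j s = book_curve n k l t"
    have st: "t = s" "arch i j s = arch k l s"
      "real (page n (i, j)) * arch i j s = real (page n (k, l)) * arch k l s"
      using eq by (auto simp: book_curve_def)
    note t = t[unfolded st(1)]
    have "arch i j s = 0"
    proof (rule ccontr)
      assume "arch i j s \<noteq> 0"
      then have pg: "page n (i, j) = page n (k, l)" using st by simp
      then have nc: "\<not> interleaved (i, j) (k, l)" "\<not> interleaved (k, l) (i, j)"
        using page_noncrossing[of "(i, j)" "(k, l)" n] page_noncrossing[of "(k, l)" "(i, j)" n] ij kl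
        by auto
      have inner: "real i < s" "s < real j" "real k < s" "s < real l"
        using \<open>arch i j s \<noteq> 0\<close> st(2) arch_zero[OF ij(1) s] arch_zero[OF kl(1) t] s t by auto
      then have "i < l" "k < j" by linarith+
      then have "k \<le> i \<and> j \<le> l \<or> i \<le> k \<and> l \<le> j"
        using nc unfolding interleaved_def by force
      then show False
        using arch_nested[of k i j l s] arch_nested[of i k l j s] inner ij kl ne st(2) by auto
    qed
    then have "s \<in> {real i, real j}" "s \<in> {real k, real l}"
      using arch_zero[OF ij(1) s] arch_zero[OF kl(1) t] st(2) by auto
    moreover have "book_curve n i j s = (of_real s, 0)"
      using \<open>arch i j s = 0\<close> by (simp add: book_curve_def complex_eq_iff)
    ultimately show "book_curve n i j s \<in> (\<lambda>v. (of_real (real v), 0)) ` ({i, j} \<inter> {k, l})"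
      by auto
  qed (auto intro!: strict_monoI inj_onI)
  show "\<forall>e\<in>edges (complete_graph n). piecewise_linear (epos (book_drawing n) e)"
  proof
    fix e assume "e \<in> edges (complete_graph n)"
    then obtain i j where e: "i < j" "j < n" "e = {i, j}" by (rule complete_graph_edge)
    let ?w = "(\<i>, real (page n (i, j))) :: R3" and ?h = "real j - real i"
    have up: "book_curve n i j s = (- ?h * real i) *\<^sub>R ?w + s *\<^sub>R ((1, 0) + ?h *\<^sub>R ?w)"
      if "s \<in> {real i..(real i + real j) / 2}" for s
    proof -
      have "s - real i \<le> real j - s" using that by simp
      then show ?thesis
        by (simp add: book_curve_def arch_def min_absorb1 complex_eq_iff algebra_simps)
    qed
    have down: "book_curve n i j s = (?h * real j) *\<^sub>R ?w + s *\<^sub>R ((1, 0) - ?h *\<^sub>R ?w)"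
      if "s \<in> {(real i + real j) / 2..real j}" for s
    proof -
      have "real j - s \<le> s - real i" using that by simp
      then show ?thesis
        by (simp add: book_curve_def arch_def min_absorb2 complex_eq_iff algebra_simps)
    qed
    show "piecewise_linear (epos (book_drawing n) e)"
      unfolding e(3) epos_curve_drawing[OF e(1)]
      by (rule piecewise_linear_curve[of "real i" "(real i + real j) / 2" "real j", OF _ _ up down]) (use e in auto)
  qed
qed

lemma book_thickness_complete_graph_le:
  assumes "0 < n"
  shows "book_thickness (complete_graph n) \<le> enat ((n + 1) div 2)"
proof -
  let ?N = "(n + 1) div 2" and ?u = "(1, 0) :: R3"
  define w where "w = (\<lambda>p. (\<i>, real p) :: R3)"
  define H where "H = (\<lambda>p. {0 + t *\<^sub>R ?u + s *\<^sub>R w p | t s. 0 \<le> s})"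
  define L where "L = range (\<lambda>t. 0 + t *\<^sub>R ?u)"
  have memH: "(z, r) \<in> H p \<longleftrightarrow> 0 \<le> Im z \<and> r = real p * Im z" for z r p
  proof
    assume "0 \<le> Im z \<and> r = real p * Im z"
    then show "(z, r) \<in> H p" unfolding H_def w_def
      by (intro CollectI exI[of _ "Re z"] exI[of _ "Im z"]) (auto simp: complex_eq_iff)
  qed (auto simp: H_def w_def)
  have memL: "(z, r) \<in> L \<longleftrightarrow> Im z = 0 \<and> r = 0" for z r
    unfolding L_def by (auto simp: complex_eq_iff image_iff intro: exI[of _ "Re z"])
  have inj: "inj_on H {..<?N}"
  proof (rule inj_onI)
    fix p q assume "H p = H q"
    moreover have "(\<i>, real p) \<in> H p" by (simp add: memH)
    ultimately show "p = q" by (simp add: memH)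
  qed
  have half_planes: "\<forall>X\<in>H ` {..<?N}. \<exists>w. w \<noteq> ?u \<and> independent {?u, w} \<and>
      X = {0 + t *\<^sub>R ?u + s *\<^sub>R w | t s. 0 \<le> s}"
  proof
    fix X assume "X \<in> H ` {..<?N}"
    then obtain p where p: "X = H p" by blast
    have "w p \<noteq> ?u \<and> independent {?u, w p}"
      by (rule independent_pair) (auto simp: w_def complex_eq_iff zero_prod_def)
    then show "\<exists>w. w \<noteq> ?u \<and> independent {?u, w} \<and> X = {0 + t *\<^sub>R ?u + s *\<^sub>R w |t s. 0 \<le> s}"
      unfolding p H_def by blast
  qed
  have "?u \<noteq> 0" by (simp add: zero_prod_def)
  then have book: "is_book ?N L (H ` {..<?N})"
    unfolding is_book_def using half_planes card_image[OF inj] L_def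
    by (intro conjI[OF _ conjI[OF _ exI[of _ 0, OF exI[of _ ?u]]]]) (simp, simp, blast)
  have "book_embedding (complete_graph n) ?N (book_drawing n)"
    unfolding book_embedding_def
  proof (intro conjI exI[of _ L] exI[of _ "H ` {..<?N}"] ballI)
    show "vpos (book_drawing n) ` verts (complete_graph n) \<subseteq> L" by (auto simp: memL)
    fix e assume "e \<in> edges (complete_graph n)"
    then obtain i j where e: "i < j" "j < n" "e = {i, j}" by (rule complete_graph_edge)
    have "epos (book_drawing n) e - vpos (book_drawing n) ` e \<subseteq> H (page n (i, j)) - L"
    proof
      fix z assume "z \<in> epos (book_drawing n) e - vpos (book_drawing n) ` e"
      then obtain s where s: "s \<in> {real i..real j}" "z = book_curve n i j s"
        and "z \<notin> (\<lambda>v. (of_real (real v), 0)) ` {i, j}" using e by auto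
      then have "arch i j s \<noteq> 0"
        using arch_zero[OF e(1) s(1)] by (auto simp: book_curve_def complex_eq_iff)
      then show "z \<in> H (page n (i, j)) - L"
        using arch_nonneg[OF e(1) s(1)] by (simp add: s(2) book_curve_def memH memL)
    qed
    moreover have "page n (i, j) < ?N" using assms by (rule page_less)
    ultimately show "\<exists>X\<in>H ` {..<?N}. epos (book_drawing n) e - vpos (book_drawing n) ` e \<subseteq> X - L"
      by blast
  qed (rule pl_embedding_book_drawing, rule book)
  moreover have "1 \<le> ?N" using assms by simp
  ultimately show ?thesis unfolding book_thickness_def by (intro Inf_lower) blast
qed

text \<open>
  In coordinates along \<open>u\<close> and \<open>w\<close> the two arcs are paths in a rectangle that start and end on its
  lower side in interleaved order, so they meet by the Fashoda theorem.
\<close>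

lemma half_plane_chords_meet:
  fixes a u w :: R3
  assumes ind: "u \<noteq> w" "independent {u, w}" and H: "H = {a + t *\<^sub>R u + s *\<^sub>R w | t s. 0 \<le> s}"
    and g: "arc g" "pathstart g = a + t1 *\<^sub>R u" "pathfinish g = a + t3 *\<^sub>R u" "path_image g \<subseteq> H"
    and h: "arc h" "pathstart h = a + t2 *\<^sub>R u" "pathfinish h = a + t4 *\<^sub>R u" "path_image h \<subseteq> H"
    and t: "t1 < t2" "t2 < t3" "t3 < t4"
  shows "path_image g \<inter> path_image h \<noteq> {}"
proof -
  obtain \<pi> :: "R3 \<Rightarrow> real^2" where \<pi>: "linear \<pi>" "\<pi> u = axis 1 1" "\<pi> w = axis 2 1"
    using linear_independent_extend[OF ind(2), of "\<lambda>x. if x = u then axis 1 1 else axis 2 1"] ind(1)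
    by auto
  define \<Phi> where "\<Phi> = (\<lambda>x. \<pi> (x - a))"
  have \<Phi>: "\<Phi> (a + t *\<^sub>R u + s *\<^sub>R w) = t *\<^sub>R axis 1 1 + s *\<^sub>R axis 2 1" for t s
    unfolding \<Phi>_def using \<pi> by (simp add: linear_add linear_scale algebra_simps)
  have comp: "\<Phi> (a + t *\<^sub>R u + s *\<^sub>R w) $ 1 = t" "\<Phi> (a + t *\<^sub>R u + s *\<^sub>R w) $ 2 = s" for t s
    unfolding \<Phi> by (simp_all add: axis_def)
  have comp0: "\<Phi> (a + t *\<^sub>R u) $ 1 = t" "\<Phi> (a + t *\<^sub>R u) $ 2 = 0" for t
    using comp[of t 0] by simp_all
  have inj: "inj_on \<Phi> H"
  proof (rule inj_onI)
    fix x y assume "x \<in> H" "y \<in> H" and eq: "\<Phi> x = \<Phi> y"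
    then obtain t s t' s' where xy: "x = a + t *\<^sub>R u + s *\<^sub>R w" "y = a + t' *\<^sub>R u + s' *\<^sub>R w"
      unfolding H by blast
    have "t = t'" "s = s'"
      using arg_cong[OF eq, of "\<lambda>v. v $ 1"] arg_cong[OF eq, of "\<lambda>v. v $ 2"] by (simp_all only: xy comp)
    then show "x = y" by (simp add: xy)
  qed
  have above: "0 \<le> \<Phi> z $ 2" if "z \<in> H" for z using that comp unfolding H by auto
  have cont: "continuous_on S \<Phi>" for S
    unfolding \<Phi>_def
    by (rule bounded_linear.continuous_on[OF \<pi>(1)[unfolded linear_conv_bounded_linear]])
      (intro continuous_intros)
  have "compact (\<Phi> ` (path_image g \<union> path_image h))"
    using g(1) h(1) by (intro compact_continuous_image cont compact_Un compact_arc_image)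
  then obtain M where M: "\<And>z. z \<in> path_image g \<union> path_image h \<Longrightarrow> norm (\<Phi> z) \<le> M"
    using compact_imp_bounded bounded_iff by (metis (mono_tags, lifting) imageI)
  let ?a = "vector [- M, 0] :: real^2" and ?b = "vector [M, M] :: real^2"
  have box: "\<Phi> z \<in> cbox ?a ?b" if "z \<in> path_image g \<union> path_image h" for z
  proof -
    have "\<bar>\<Phi> z $ i\<bar> \<le> M" for i using component_le_norm_cart[of "\<Phi> z" i] M[OF that] by linarith
    then show ?thesis using above[of z] that g(4) h(4)
      by (auto simp: mem_box_cart forall_2 abs_le_iff minus_le_iff)
  qed
  obtain z where "z \<in> path_image (\<Phi> \<circ> g)" "z \<in> path_image (\<Phi> \<circ> h)"
  proof (rule fashoda_interlace[of "\<Phi> \<circ> g" "\<Phi> \<circ> h" ?a ?b])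
    show "path (\<Phi> \<circ> g)" "path (\<Phi> \<circ> h)"
      using g(1) h(1) by (intro path_continuous_image cont arc_imp_path; simp)+
    show "path_image (\<Phi> \<circ> g) \<subseteq> cbox ?a ?b" "path_image (\<Phi> \<circ> h) \<subseteq> cbox ?a ?b"
      using box by (auto simp: path_image_compose)
  qed (use g h t in \<open>auto simp: pathstart_compose pathfinish_compose comp0\<close>)
  then obtain x y where "x \<in> path_image g" "y \<in> path_image h" "\<Phi> x = \<Phi> y"
    by (auto simp: path_image_compose)
  moreover have "x = y" using inj calculation g(4) h(4) by (meson inj_onD subsetD)
  ultimately show ?thesis by blast
qed

lemma book_page_count_lower_bound:
  assumes n: "4 \<le> n" and bk: "book_embedding (complete_graph n) N D"
  shows "n \<le> 2 * N"
proof -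
  let ?G = "complete_graph n"
  obtain L P where D: "embedding ?G D" and book: "is_book N L P"
    and V: "vpos D ` verts ?G \<subseteq> L" and E: "\<forall>e\<in>edges ?G. \<exists>H\<in>P. epos D e - vpos D ` e \<subseteq> H - L"
    using bk unfolding book_embedding_def pl_embedding_def by blast
  have P: "finite P" "card P = N" using book by (simp_all add: is_book_def)
  obtain a u where u: "u \<noteq> 0" and L: "L = range (\<lambda>t. a + t *\<^sub>R u)"
    and H: "\<forall>H\<in>P. \<exists>w. w \<noteq> u \<and> independent {u, w} \<and> H = {a + t *\<^sub>R u + s *\<^sub>R w | t s. 0 \<le> s}"
    using book unfolding is_book_def by (elim conjE exE) (rule that)
  have "\<forall>v\<in>{..<n}. \<exists>t. vpos D v = a + t *\<^sub>R u" using V by (auto simp: L complete_graph_def)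
  then obtain t where t: "\<And>v. v < n \<Longrightarrow> vpos D v = a + t v *\<^sub>R u" by (metis lessThan_iff)
  have inj: "inj_on t {..<n}"
    using embedding_inj[OF D] t by (fastforce simp: inj_on_def complete_graph_def)
  obtain page where page: "\<And>e. e \<in> edges ?G \<Longrightarrow> page e \<in> P"
    "\<And>e. e \<in> edges ?G \<Longrightarrow> epos D e - vpos D ` e \<subseteq> page e - L" using E by metis
  define vs where "vs = sort_key t [0..<n]"
  have vs: "set vs = {..<n}" "distinct vs" "length vs = n" "sorted (map t vs)"
    by (auto simp: vs_def)
  have mem: "vs ! i < n" if "i < n" for i using that vs nth_mem[of i vs] by auto
  have less: "t (vs ! i) < t (vs ! j)" if "i < j" "j < n" for i j
  proof -
    have "t (vs ! i) \<le> t (vs ! j)" using sorted_nth_mono[OF vs(4), of i j] that vs(3) by simp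
    moreover have "vs ! i \<noteq> vs ! j" using that vs by (simp add: nth_eq_iff_index_eq)
    ultimately show ?thesis using inj mem[of i] mem[of j] that by (auto simp: inj_on_def less_le)
  qed
  have edge: "{vs ! i, vs ! j} \<in> edges ?G" if "i < j" "j < n" for i j
    using mem[of i] mem[of j] less[OF that] that by (auto simp: complete_graph_def card_insert_if)
  define c where "c = (\<lambda>(i, j). page {vs ! i, vs ! j})"
  have "n \<le> 2 * card P"
  proof (rule noncrossing_colouring_bound[OF n P(1), of c])
    show "c ` diagonals n \<subseteq> P" using page(1) edge by (auto simp: c_def diagonals_def)
    fix p q assume pq: "p \<in> diagonals n" "q \<in> diagonals n" "interleaved p q"
    obtain i j k l where p: "p = (i, j)" and q: "q = (k, l)" by (cases p, cases q)
    have o: "i < k" "k < j" "j < l" "l < n"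
      using pq by (auto simp: p q interleaved_def diagonals_def)
    let ?e = "{vs ! i, vs ! j}" and ?f = "{vs ! k, vs ! l}"
    have ef: "?e \<in> edges ?G" "?f \<in> edges ?G" using o by (auto intro!: edge)
    show "c p \<noteq> c q"
    proof
      assume "c p = c q"
      then have same: "page ?e = page ?f" by (simp add: c_def p q)
      obtain w where w: "w \<noteq> u" "independent {u, w}"
        and X: "page ?e = {a + t *\<^sub>R u + s *\<^sub>R w | t s. 0 \<le> s}" using H page(1)[OF ef(1)] by blast
      have "L \<subseteq> page ?e" unfolding X L
      proof
        fix z assume "z \<in> range (\<lambda>t. a + t *\<^sub>R u)"
        then obtain r where "z = a + r *\<^sub>R u + 0 *\<^sub>R w" by auto
        then show "z \<in> {a + t *\<^sub>R u + s *\<^sub>R w | t s. 0 \<le> s}" by blast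
      qed
      moreover have "vpos D ` ?e \<subseteq> L" "vpos D ` ?f \<subseteq> L"
        using V mem o by (auto simp: complete_graph_def)
      ultimately have "vpos D ` ?e \<subseteq> page ?e" "vpos D ` ?f \<subseteq> page ?e" by (meson order_trans)+
      moreover have "epos D ?e - vpos D ` ?e \<subseteq> page ?e" "epos D ?f - vpos D ` ?f \<subseteq> page ?e"
        using page(2)[OF ef(1)] page(2)[OF ef(2)] unfolding same[symmetric] by (meson Diff_subset order_trans)+
      ultimately have sub: "epos D ?e \<subseteq> page ?e" "epos D ?f \<subseteq> page ?e"
        by (simp_all only: Diff_subset_conv Un_absorb1)
      obtain g where g: "arc g" "pathstart g = vpos D (vs ! i)" "pathfinish g = vpos D (vs ! j)"
        "path_image g = epos D ?e" using embedding_edge_arc[OF D ef(1)] .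
      obtain h where h: "arc h" "pathstart h = vpos D (vs ! k)" "pathfinish h = vpos D (vs ! l)"
        "path_image h = epos D ?f" using embedding_edge_arc[OF D ef(2)] .
      have "path_image g \<inter> path_image h \<noteq> {}"
        by (rule half_plane_chords_meet[OF w(1)[symmetric] w(2) X g(1) _ _ _ h(1)])
          (use g h sub t mem less o in auto)
      moreover have "?e \<inter> ?f = {}"
        using o vs by (auto simp: nth_eq_iff_index_eq)
      moreover have "?e \<noteq> ?f" using calculation(2) by auto
      ultimately show False using embedding_edge_Int[OF D ef] g h by simp
    qed
  qed
  then show ?thesis using P by simp
qed

lemma book_thickness_complete_graph:
  assumes "4 \<le> n"
  shows "book_thickness (complete_graph n) = enat (nat \<lceil>real n / 2\<rceil>)"
proof (rule antisym)
  have "nat \<lceil>real n / 2\<rceil> = (n + 1) div 2" by linarith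
  then show "book_thickness (complete_graph n) \<le> enat (nat \<lceil>real n / 2\<rceil>)"
    using book_thickness_complete_graph_le[of n] assms by simp
  show "enat (nat \<lceil>real n / 2\<rceil>) \<le> book_thickness (complete_graph n)"
    unfolding book_thickness_def
  proof (rule Inf_greatest)
    fix x assume "x \<in> {enat N | N. 1 \<le> N \<and> (\<exists>D. book_embedding (complete_graph n) N D)}"
    then obtain N D where "x = enat N" "book_embedding (complete_graph n) N D" by blast
    then show "enat (nat \<lceil>real n / 2\<rceil>) \<le> x"
      using book_page_count_lower_bound[OF assms, of N D] by (simp add: ceiling_le_iff nat_le_iff)
  qed
qed


section \<open>Points of a parabola in general position\<close>

text \<open>
  The ordinate over \<open>s\<close> of the line through the points of the parabola \<open>y = x\<^sup>2\<close> over \<open>a\<close> and \<open>b\<close>.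
\<close>

definition chord :: "real \<Rightarrow> real \<Rightarrow> real \<Rightarrow> real" where
  "chord a b s = (a + b) * s - a * b"

lemma chord_eq: "chord a b s = s\<^sup>2 + (s - a) * (b - s)"
  by (simp add: chord_def algebra_simps power2_eq_square)

lemma chord_commute: "chord a b = chord b a"
  by (auto simp: chord_def algebra_simps)

definition concurrent :: "real \<Rightarrow> real \<Rightarrow> real \<Rightarrow> real \<Rightarrow> real \<Rightarrow> real \<Rightarrow> bool" where
  "concurrent a b c d e f \<longleftrightarrow> (\<exists>s. chord a b s = chord c d s \<and> chord c d s = chord e f s)"

lemma concurrent_swap: "concurrent a b c d e f \<longleftrightarrow> concurrent b a c d e f"
  by (simp add: concurrent_def chord_commute[of a b])

lemma concurrent_rotate: "concurrent a b c d e f \<longleftrightarrow> concurrent c d e f a b"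
  unfolding concurrent_def by (intro ex_cong1) auto

definition general_position :: "real set \<Rightarrow> bool" where
  "general_position A \<longleftrightarrow> (\<forall>a b c d e f.
     {a, b, c, d, e, f} \<subseteq> A \<and> distinct [a, b, c, d, e, f] \<longrightarrow> \<not> concurrent a b c d e f)"

lemma chord_slopes_differ:
  assumes "chord c d s = chord e f s" "c \<noteq> e" "c \<noteq> f"
  shows "c + d \<noteq> e + f"
proof
  assume eq: "c + d = e + f"
  then have "c * d = e * f" using assms(1) by (simp add: chord_def)
  then have "(c - e) * (c - f) = 0" using eq by algebra
  then show False using assms(2,3) by simp
qed

lemma concurrent_unique:
  assumes "concurrent y a c d e f" "concurrent z a c d e f" "distinct [a, c, d, e, f]"
  shows "y = z"
proof -
  obtain s where s: "chord y a s = chord c d s" "chord c d s = chord e f s"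
    using assms(1) by (auto simp: concurrent_def)
  obtain t where t: "chord z a t = chord c d t" "chord c d t = chord e f t"
    using assms(2) by (auto simp: concurrent_def)
  have "((c + d) - (e + f)) * (s - t) = 0"
    using s(2) t(2) unfolding chord_def by algebra
  moreover have "c + d \<noteq> e + f" using chord_slopes_differ[OF s(2)] assms(3) by simp
  ultimately have st: "t = s" by simp
  have "(y - z) * (s - a) = 0" using s(1) t(1) unfolding st chord_def by algebra
  moreover have "s \<noteq> a"
  proof
    assume "s = a"
    then have "(a - c) * (d - a) = 0" using s(1) unfolding \<open>s = a\<close> chord_eq by simp
    then show False using assms(3) by auto
  qed
  ultimately show ?thesis by simp
qed

text \<open>
  A bad point \<open>y\<close> closes a concurrent triple whose other five ends are in \<open>A\<close>. Two of the chords
  already meet in a point off the parabola, and the third passes through that point and a given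
  point of the parabola, so it determines \<open>y\<close>.
\<close>

lemma finite_bad_points:
  assumes A: "finite A" and gp: "general_position A"
  shows "finite {y. \<not> general_position (insert y A)}"
proof -
  define Bad where "Bad = (\<lambda>(a, c, d, e, f). {y. concurrent y a c d e f \<and> distinct [a, c, d, e, f]})"
  have "finite (Bad p)" for p
  proof -
    obtain a c d e f where p: "p = (a, c, d, e, f)" by (rule prod_cases5)
    have "y = z" if "y \<in> Bad p" "z \<in> Bad p" for y z
      using that concurrent_unique[of y a c d e f z] by (simp add: p Bad_def)
    then have "\<exists>z. Bad p \<subseteq> {z}" by blast
    then show ?thesis using finite_subset by blast
  qed
  then have "finite (\<Union>p\<in>A \<times> A \<times> A \<times> A \<times> A. Bad p)" using A by auto
  moreover have "{y. \<not> general_position (insert y A)} \<subseteq> (\<Union>p\<in>A \<times> A \<times> A \<times> A \<times> A. Bad p)"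
  proof
    fix y assume "y \<in> {y. \<not> general_position (insert y A)}"
    then obtain a b c d e f where abc: "{a, b, c, d, e, f} \<subseteq> insert y A"
      "distinct [a, b, c, d, e, f]" "concurrent a b c d e f"
      unfolding general_position_def mem_Collect_eq not_all not_imp not_not by (elim exE conjE) (rule that)
    have "y \<in> {a, b, c, d, e, f}"
    proof (rule ccontr)
      assume "y \<notin> {a, b, c, d, e, f}"
      then have "{a, b, c, d, e, f} \<subseteq> A" using abc(1) by blast
      then show False using gp abc(2,3) unfolding general_position_def by blast
    qed
    then have "y = a \<or> y = b \<or> y = c \<or> y = d \<or> y = e \<or> y = f" by blast
    then have "\<exists>a c d e f. {a, c, d, e, f} \<subseteq> A \<and> distinct [a, c, d, e, f] \<and> concurrent y a c d e f"
    proof (elim disjE)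
      assume y: "y = a"
      have "concurrent y b c d e f" using abc(3) unfolding y by (metis concurrent_swap concurrent_rotate)
      moreover have "{b, c, d, e, f} \<subseteq> A" "distinct [b, c, d, e, f]" using abc(1,2) unfolding y by auto
      ultimately show ?thesis by blast
    next
      assume y: "y = b"
      have "concurrent y a c d e f" using abc(3) unfolding y by (metis concurrent_swap concurrent_rotate)
      moreover have "{a, c, d, e, f} \<subseteq> A" "distinct [a, c, d, e, f]" using abc(1,2) unfolding y by auto
      ultimately show ?thesis by blast
    next
      assume y: "y = c"
      have "concurrent y d e f a b" using abc(3) unfolding y by (metis concurrent_swap concurrent_rotate)
      moreover have "{d, e, f, a, b} \<subseteq> A" "distinct [d, e, f, a, b]" using abc(1,2) unfolding y by auto
      ultimately show ?thesis by blast
    next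
      assume y: "y = d"
      have "concurrent y c e f a b" using abc(3) unfolding y by (metis concurrent_swap concurrent_rotate)
      moreover have "{c, e, f, a, b} \<subseteq> A" "distinct [c, e, f, a, b]" using abc(1,2) unfolding y by auto
      ultimately show ?thesis by blast
    next
      assume y: "y = e"
      have "concurrent y f a b c d" using abc(3) unfolding y by (metis concurrent_swap concurrent_rotate)
      moreover have "{f, a, b, c, d} \<subseteq> A" "distinct [f, a, b, c, d]" using abc(1,2) unfolding y by auto
      ultimately show ?thesis by blast
    next
      assume y: "y = f"
      have "concurrent y e a b c d" using abc(3) unfolding y by (metis concurrent_swap concurrent_rotate)
      moreover have "{e, a, b, c, d} \<subseteq> A" "distinct [e, a, b, c, d]" using abc(1,2) unfolding y by auto
      ultimately show ?thesis by blast
    qed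
    then show "y \<in> (\<Union>p\<in>A \<times> A \<times> A \<times> A \<times> A. Bad p)" unfolding Bad_def by blast
  qed
  ultimately show ?thesis by (rule finite_subset[rotated])
qed

lemma general_position_sequence:
  "\<exists>x :: nat \<Rightarrow> real. strict_mono x \<and> general_position (x ` {..<n})"
proof (induction n)
  case 0
  have "strict_mono real" by (rule strict_monoI) simp
  then show ?case by (intro exI[of _ real]) (auto simp: general_position_def)
next
  case (Suc n)
  then obtain x :: "nat \<Rightarrow> real" where x: "strict_mono x" "general_position (x ` {..<n})" by blast
  have "infinite ({x n<..} - {y. \<not> general_position (insert y (x ` {..<n}))})"
    using finite_bad_points[OF _ x(2)] by (intro Diff_infinite_finite) (auto simp: infinite_Ioi)
  then obtain y where y: "x n < y" "general_position (insert y (x ` {..<n}))"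
    by (metis (no_types, lifting) DiffE ex_in_conv finite.emptyI greaterThan_iff mem_Collect_eq)
  define z where "z = (\<lambda>k. if k < n then x k else y + real (k - n))"
  have "strict_mono z"
  proof (rule strict_monoI)
    fix i j :: nat assume "i < j"
    moreover have "x i < x n" if "i < n" using strict_monoD[OF x(1) that] .
    ultimately show "z i < z j" using y(1) strict_monoD[OF x(1) \<open>i < j\<close>] by (auto simp: z_def)
  qed
  moreover have "z ` {..<Suc n} = insert y (x ` {..<n})"
    by (auto simp: z_def lessThan_Suc)
  ultimately show ?case using y(2) by (intro exI[of _ z]) simp
qed

section \<open>Convex polygons are unknotted\<close>

text \<open>
  The curve is the equator of the boundary of the prism \<open>Q \<times> [-1, 1]\<close>. Radial projection from a point
  of height \<open>0\<close> inside the prism maps this boundary homeomorphically to the unit sphere and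
  keeps points of height \<open>0\<close> at height \<open>0\<close>.
\<close>

lemma unknotted_convex_frontier:
  assumes Q: "polytope Q" and p: "p \<in> interior Q"
  shows "unknotted (frontier Q \<times> {0})"
proof -
  define B where "B = Q \<times> {-1..1::real}"
  have "polytope {-1..1::real}" using polytope_interval[of "-1" "1::real"] by simp
  then have polyB: "polytope B" unfolding B_def using Q by (rule polytope_Times[rotated])
  have closedB: "closed B" and boundedB: "bounded B" and convexB: "convex B"
    using polyB by (auto simp: polytope_imp_closed polytope_imp_bounded polytope_imp_convex)
  have intB: "interior B = interior Q \<times> {-1<..<1}" by (simp add: B_def interior_Times)
  define c :: R3 where "c = (p, 0)"
  have cB: "c \<in> interior B" using p by (simp add: intB c_def)
  have frB: "frontier B = B - interior B" using closedB by (simp add: frontier_def)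
  have "frontier B = \<Union>{F. F facet_of B}"
    using rel_boundary_of_polyhedron[OF polytope_imp_polyhedron[OF polyB]]
      rel_interior_nonempty_interior[of B] cB frB by auto
  then have pl: "piecewise_linear (frontier B)"
    unfolding piecewise_linear_def using polyB
    by (intro exI[of _ "{F. F facet_of B}"])
      (auto simp: finite_polytope_facets intro: face_of_polytope_polytope facet_of_imp_face_of)
  define f where "f = (\<lambda>y. sgn (y - c))"
  have away: "y - c \<noteq> 0" if "y \<in> frontier B" for y using that cB by (auto simp: frB)
  have "compact (frontier B)" using boundedB by (rule compact_frontier_bounded)
  moreover have "continuous_on (frontier B) f"
    unfolding f_def by (intro continuous_intros) (use away in auto)
  moreover have "f ` frontier B = sphere 0 1"
  proof
    show "f ` frontier B \<subseteq> sphere 0 1" using away by (simp add: image_subset_iff f_def norm_sgn)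
    show "sphere 0 1 \<subseteq> f ` frontier B"
    proof
      fix l :: R3 assume l: "l \<in> sphere 0 1"
      then have "l \<noteq> 0" by auto
      then obtain d where d: "0 < d" "c + d *\<^sub>R l \<in> frontier B"
        using ray_to_frontier[OF boundedB cB] by metis
      have "f (c + d *\<^sub>R l) = l" using d(1) l by (simp add: f_def sgn_div_norm)
      then show "l \<in> f ` frontier B" using d(2) by (metis imageI)
    qed
  qed
  moreover have "inj_on f (frontier B)"
  proof (rule inj_onI)
    have shrink: "\<not> norm (y - c) < norm (z - c)"
      if yz: "y \<in> frontier B" "z \<in> frontier B" "f y = f z" for y z
    proof
      assume less: "norm (y - c) < norm (z - c)"
      define r where "r = norm (y - c) / norm (z - c)"
      have r: "0 < r" "r < 1" using less away[OF yz(1)] away[OF yz(2)] by (auto simp: r_def)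
      have "y - c = norm (y - c) *\<^sub>R f y"
        using away[OF yz(1)] by (simp add: f_def sgn_div_norm)
      then have "y - c = norm (y - c) *\<^sub>R sgn (z - c)" using yz(3) by (simp add: f_def)
      then have "y - c = r *\<^sub>R (z - c)" by (simp add: r_def sgn_div_norm divide_inverse)
      then have "y = z - (1 - r) *\<^sub>R (z - c)" by (simp add: algebra_simps)
      also have "\<dots> \<in> interior B"
        using yz(2) r by (intro mem_interior_closure_convex_shrink[OF convexB cB]) (auto simp: frontier_def)
      finally show False using yz(1) by (simp add: frB)
    qed
    fix y z assume yz: "y \<in> frontier B" "z \<in> frontier B" "f y = f z"
    have "norm (y - c) = norm (z - c)"
      using shrink[OF yz] shrink[OF yz(2,1) yz(3)[symmetric]] by simp
    then have "norm (y - c) *\<^sub>R f y = norm (z - c) *\<^sub>R f z" using yz(3) by simp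
    then show "y = z" using away[OF yz(1)] away[OF yz(2)] by (simp add: f_def sgn_div_norm)
  qed
  ultimately have "\<exists>g. homeomorphism (frontier B) (sphere 0 1) f g" by (rule homeomorphism_compact)
  then obtain g where fg: "homeomorphism (frontier B) (sphere 0 1) f g" ..
  then have gf: "homeomorphism (sphere 0 1) (frontier B) g f" by (rule homeomorphism_symD)
  have flat: "snd (f y) = 0 \<longleftrightarrow> snd y = 0" if "y \<in> frontier B" for y
    using away[OF that] by (auto simp: f_def sgn_div_norm c_def)
  have "g ` {x \<in> sphere 0 1. snd x = 0} = {y \<in> frontier B. snd y = 0}"
  proof
    show "g ` {x \<in> sphere 0 1. snd x = 0} \<subseteq> {y \<in> frontier B. snd y = 0}"
    proof
      fix y assume "y \<in> g ` {x \<in> sphere 0 1. snd x = 0}"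
      then obtain x where x: "x \<in> sphere 0 1" "snd x = 0" "y = g x" by blast
      then have y: "y \<in> frontier B" "f y = x" using gf unfolding homeomorphism_def by auto
      then have "snd y = 0" using flat[OF y(1)] x(2) by simp
      then show "y \<in> {y \<in> frontier B. snd y = 0}" using y(1) by blast
    qed
    show "{y \<in> frontier B. snd y = 0} \<subseteq> g ` {x \<in> sphere 0 1. snd x = 0}"
    proof
      fix y assume y: "y \<in> {y \<in> frontier B. snd y = 0}"
      then have "f y \<in> sphere 0 1" "g (f y) = y" using gf unfolding homeomorphism_def by auto
      then show "y \<in> g ` {x \<in> sphere 0 1. snd x = 0}" using flat y by (metis (mono_tags, lifting) imageI mem_Collect_eq)
    qed
  qed
  also have "\<dots> = frontier Q \<times> {0}"
    using polytope_imp_closed[OF Q] unfolding frB intB by (auto simp: B_def frontier_def)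
  finally show ?thesis unfolding unknotted_def using pl gf by blast
qed

section \<open>Fragments of a Hamiltonian cycle\<close>

lemma components_of_finite_closed_cover:
  fixes \<A> :: "'a::topological_space set set"
  assumes fin: "finite \<A>" and conn: "\<And>A. A \<in> \<A> \<Longrightarrow> connected A \<and> A \<noteq> {}"
    and cl: "\<And>A. A \<in> \<A> \<Longrightarrow> closedin (top_of_set (\<Union>\<A>)) A"
    and dis: "pairwise disjnt \<A>"
  shows "components (\<Union>\<A>) = \<A>"
proof -
  have sub: "A \<in> components (\<Union>\<A>)" if A: "A \<in> \<A>" for A
  proof -
    obtain c where c: "c \<in> components (\<Union>\<A>)" "A \<subseteq> c"
      using exists_component_superset[of A "\<Union>\<A>"] conn[OF A] A by blast
    have cS: "c \<subseteq> \<Union>\<A>" using in_components_subset[OF c(1)] .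
    have "closedin (top_of_set (\<Union>\<A>)) (\<Union>(\<A> - {A}))" using fin cl by (intro closedin_Union) auto
    moreover have "\<Union>\<A> - \<Union>(\<A> - {A}) = A" using A dis unfolding pairwise_def disjnt_def by blast
    ultimately have "openin (top_of_set (\<Union>\<A>)) A"
      using openin_diff[OF openin_subtopology_self] by (metis openin_diff openin_subtopology_self)
    then have "openin (top_of_set c) A" "closedin (top_of_set c) A"
      using cl[OF A] c(2) cS by (auto intro: openin_subset_trans closedin_subset_trans)
    then have "A = {} \<or> A = c" using in_components_connected[OF c(1)] unfolding connected_clopen by blast
    then show ?thesis using conn[OF A] c(1) by auto
  qed
  moreover have "c \<in> \<A>" if c: "c \<in> components (\<Union>\<A>)" for c
  proof -
    obtain z where "z \<in> c" using in_components_nonempty[OF c] by blast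
    then obtain A where A: "A \<in> \<A>" "z \<in> A" using in_components_subset[OF c] by blast
    then have "c = A" using components_eq[OF c sub[OF A(1)]] \<open>z \<in> c\<close> by blast
    then show ?thesis using A by simp
  qed
  ultimately show ?thesis by blast
qed

text \<open>
  All vertices are on the spine, so the complement of the spine falls apart into the open edges.
\<close>

lemma fragments_of_hamiltonian_cycle:
  assumes D: "embedding G D" and ham: "is_hamiltonian_cycle G vs" and fin: "finite (edges G)"
    and V: "\<Union>(edges G) \<subseteq> verts G"
  shows "fragments G D vs = epos D ` (edges G - cycle_edges vs)"
proof -
  let ?C = "cycle_support vs D" and ?E = "edges G - cycle_edges vs"
  have cyc: "is_cycle G vs" and vs: "set vs = verts G" using ham by (auto simp: is_hamiltonian_cycle_def)
  have CE: "cycle_edges vs \<subseteq> edges G" "\<Union>(cycle_edges vs) = verts G"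
    using cyc vs Union_cycle_edges[of vs] by (auto simp: is_cycle_def)
  have VC: "vpos D ` verts G \<subseteq> ?C"
    using vpos_in_drawn[OF D CE(1)] CE(2) by (auto simp: cycle_support_eq_drawn)
  have off: "epos D e - ?C = epos D e - vpos D ` e" if e: "e \<in> ?E" for e
  proof -
    have "drawn D {e} \<inter> drawn D (cycle_edges vs) = vpos D ` (\<Union>{e} \<inter> \<Union>(cycle_edges vs))"
      using e CE by (intro embedding_drawn_Int[OF D]) auto
    moreover have "e \<subseteq> verts G" using e V by blast
    ultimately have "epos D e \<inter> ?C = vpos D ` e"
      using CE by (simp add: cycle_support_eq_drawn Int_absorb2)
    then show ?thesis by blast
  qed
  have piece: "connected (epos D e - ?C) \<and> epos D e - ?C \<noteq> {} \<and> closure (epos D e - ?C) = epos D e"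
    if e: "e \<in> ?E" for e
  proof -
    obtain x y where xy: "e = {x, y}" using embedding_edge_pair[OF D, of e] e by blast
    have eG: "{x, y} \<in> edges G" using e xy by simp
    have "closed (epos D e)" using embedding_edge_closed[OF D, of e] e compact_imp_closed by blast
    then have "closure (epos D e - ?C) \<subseteq> epos D e" by (intro closure_minimal) auto
    moreover have "epos D {x, y} - ?C = epos D {x, y} - vpos D ` {x, y}" using off[OF e] xy by simp
    ultimately show ?thesis
      using embedding_edge_delete[OF D eG order_refl] unfolding xy by (metis subset_antisym)
  qed
  define \<A> where "\<A> = (\<lambda>e. epos D e - ?C) ` ?E"
  have S: "support G D - ?C = \<Union>\<A>"
    using VC unfolding support_def \<A>_def cycle_support_def by auto
  have disj: "(epos D e - ?C) \<inter> (epos D f - ?C) = {}" if "e \<in> ?E" "f \<in> ?E" "e \<noteq> f" for e f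
  proof -
    have "epos D e \<inter> epos D f = vpos D ` (e \<inter> f)" using that by (intro embedding_edge_Int[OF D]) auto
    also have "\<dots> \<subseteq> ?C" using VC V that by blast
    finally show ?thesis by blast
  qed
  have "components (\<Union>\<A>) = \<A>"
  proof (rule components_of_finite_closed_cover)
    show "finite \<A>" using fin by (simp add: \<A>_def)
    show "connected A \<and> A \<noteq> {}" if "A \<in> \<A>" for A using that piece by (auto simp: \<A>_def)
    show "closedin (top_of_set (\<Union>\<A>)) A" if A: "A \<in> \<A>" for A
    proof -
      obtain e where e: "e \<in> ?E" "A = epos D e - ?C" using A by (auto simp: \<A>_def)
      have "closed (epos D e)" using embedding_edge_closed[OF D, of e] e(1) compact_imp_closed by blast
      moreover have "A = \<Union>\<A> \<inter> epos D e" using A e(2) S by blast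
      ultimately show ?thesis by (metis closedin_closed_Int)
    qed
    show "pairwise disjnt \<A>" using disj by (auto simp: pairwise_def disjnt_def \<A>_def)
  qed
  then show ?thesis unfolding fragments_def S using piece by (auto simp: \<A>_def image_image)
qed

section \<open>Passing to the three-sphere\<close>

lemma inv_stereo_in_S3: "inv_stereo x \<in> S3"
proof -
  have "(2 / ((norm x)\<^sup>2 + 1))\<^sup>2 * (norm x)\<^sup>2 + (((norm x)\<^sup>2 - 1) / ((norm x)\<^sup>2 + 1))\<^sup>2 = 1"
  proof -
    have "(norm x)\<^sup>2 + 1 \<noteq> 0" by (metis add_nonneg_eq_0_iff zero_le_power2 zero_neq_one zero_le_one)
    then show ?thesis by (simp add: divide_simps) algebra
  qed
  moreover have "(norm (inv_stereo x))\<^sup>2 =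
      (2 / ((norm x)\<^sup>2 + 1))\<^sup>2 * (norm x)\<^sup>2 + (((norm x)\<^sup>2 - 1) / ((norm x)\<^sup>2 + 1))\<^sup>2"
    by (simp only: inv_stereo_def norm_Pair norm_scaleR real_norm_def power_mult_distrib power2_abs
        real_sqrt_pow2 add_nonneg_nonneg zero_le_power2 mult_nonneg_nonneg)
  ultimately show ?thesis using norm_ge_zero[of "inv_stereo x"] by (auto simp: S3_def power2_eq_1_iff)
qed

lemma continuous_on_inv_stereo: "continuous_on S inv_stereo"
proof -
  have "(norm x)\<^sup>2 + 1 \<noteq> 0" for x :: R3
    by (metis add_nonneg_eq_0_iff zero_le_power2 zero_neq_one zero_le_one)
  then show ?thesis unfolding inv_stereo_def by (intro continuous_intros) auto
qed

lemma inj_inv_stereo: "inj inv_stereo"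
proof (rule injI)
  fix x y :: R3 assume eq: "inv_stereo x = inv_stereo y"
  have pos: "0 < (norm z)\<^sup>2 + 1" for z :: R3 by (smt (verit) zero_le_power2)
  have "((norm x)\<^sup>2 - 1) / ((norm x)\<^sup>2 + 1) = ((norm y)\<^sup>2 - 1) / ((norm y)\<^sup>2 + 1)"
    using eq by (simp add: inv_stereo_def)
  then have norms: "(norm x)\<^sup>2 = (norm y)\<^sup>2"
    using pos[of x] pos[of y] by (simp add: divide_simps split: if_splits) (simp add: algebra_simps)
  have "(2 / ((norm x)\<^sup>2 + 1)) *\<^sub>R x = (2 / ((norm y)\<^sup>2 + 1)) *\<^sub>R y"
    using eq by (simp add: inv_stereo_def)
  then show "x = y" using pos[of y] unfolding norms by simp
qed

text \<open>
  A piecewise linear embedding represents its own isotopy class, by the constant isotopy.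
\<close>

lemma spatial_embedding_to_S3:
  assumes D: "pl_embedding (complete_graph n) D"
  shows "pl_representative (complete_graph n) (to_S3 D) D"
    and "spatial_embedding (complete_graph n) (to_S3 D)"
proof -
  let ?G = "complete_graph n"
  have "\<exists>K. homeomorphism S3 S3 (\<lambda>x. x) K"
    by (intro exI[of _ "\<lambda>x. x"] homeomorphismI) auto
  then have "ambient_isotopic ?G (to_S3 D) (to_S3 D)"
    unfolding ambient_isotopic_def
    by (intro exI[of _ "\<lambda>t x. x"]) (auto simp: case_prod_unfold intro!: continuous_intros)
  then show rep: "pl_representative ?G (to_S3 D) D"
    using D by (simp add: pl_representative_def)
  have emb: "embedding ?G D" using D by (simp add: pl_embedding_def)
  have "embedding \<lparr>verts = verts ?G, edges = edges ?G\<rparr>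
      \<lparr>vpos = (\<lambda>v. inv_stereo (vpos D v)), epos = (\<lambda>e. inv_stereo ` epos D e)\<rparr>"
    by (rule embedding_image[OF emb])
      (auto simp: complete_graph_def intro: continuous_on_inv_stereo inj_on_subset[OF inj_inv_stereo])
  then have "embedding ?G (to_S3 D)" by (simp add: to_S3_def complete_graph_def)
  moreover have "support ?G (to_S3 D) \<subseteq> range inv_stereo" by (auto simp: support_def to_S3_def)
  moreover have "range inv_stereo \<subseteq> S3" by (simp add: image_subset_iff inv_stereo_in_S3)
  ultimately show "spatial_embedding ?G (to_S3 D)"
    using rep unfolding spatial_embedding_def by blast
qed


section \<open>A polygon inscribed in the parabola\<close>

lemma chord_nested:
  assumes "c \<le> a" "b \<le> d" "(a, b) \<noteq> (c, d)" "a < s" "s < b"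
  shows "chord a b s < chord c d s"
proof -
  have "(s - a) * (b - s) < (s - c) * (d - s)"
  proof (cases "c < a")
    case True
    then show ?thesis using assms by (intro mult_less_le_imp_less) auto
  next
    case False
    then show ?thesis using assms by (intro mult_le_less_imp_less) auto
  qed
  then show ?thesis by (simp add: chord_eq)
qed

lemma chord_gt_square: "a < s \<Longrightarrow> s < b \<Longrightarrow> s\<^sup>2 < chord a b s"
  by (simp add: chord_eq)

lemma chord_le_square: "a < b \<Longrightarrow> s \<le> a \<or> b \<le> s \<Longrightarrow> chord a b s \<le> s\<^sup>2"
  by (auto simp: chord_eq mult_le_0_iff)

lemma chord_eq_square: "chord a b s = s\<^sup>2 \<longleftrightarrow> s = a \<or> s = b"
  by (auto simp: chord_eq)

text \<open>
  By \<open>chord_eq\<close>, chords meet over \<open>s\<close> where \<open>(s - a) (b - s) = (s - c) (d - s)\<close>; for nested intervals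
  this forces a common end.
\<close>

lemma chords_meet:
  assumes ab: "a < b" "s \<in> {a..b}" and cd: "c < d" "s \<in> {c..d}" and ne: "(a, b) \<noteq> (c, d)"
    and eq: "chord a b s = chord c d s"
  shows "s \<in> {a, b} \<inter> {c, d} \<or>
    (a < c \<and> b < d \<or> c < a \<and> d < b) \<and> a < s \<and> s < b \<and> c < s \<and> s < d"
proof (cases "s \<in> {a, b} \<or> s \<in> {c, d}")
  case True
  then show ?thesis using eq chord_eq_square[of a b s] chord_eq_square[of c d s] by auto
next
  case False
  then have inner: "a < s" "s < b" "c < s" "s < d" using ab cd by auto
  have "\<not> (c \<le> a \<and> b \<le> d)" "\<not> (a \<le> c \<and> d \<le> b)"
    using chord_nested[of c a b d s] chord_nested[of a c d b s] inner ne eq by auto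
  then show ?thesis using inner by auto
qed

definition side :: "nat \<Rightarrow> nat \<Rightarrow> nat \<Rightarrow> bool" where
  "side n i j \<longleftrightarrow> j = Suc i \<or> i = 0 \<and> j = n - 1"

lemma interleaved_not_side:
  "interleaved (i, j) (k, l) \<or> interleaved (k, l) (i, j) \<Longrightarrow> k < l \<Longrightarrow> l < n \<Longrightarrow> \<not> side n i j"
  by (auto simp: side_def interleaved_def)

locale parabola_points =
  fixes n :: nat and x :: "nat \<Rightarrow> real"
  assumes n: "3 \<le> n" and mono: "strict_mono x"
begin

lemma x_less [simp]: "x i < x j \<longleftrightarrow> i < j" and x_le [simp]: "x i \<le> x j \<longleftrightarrow> i \<le> j"
  and x_eq [simp]: "x i = x j \<longleftrightarrow> i = j"
  using mono by (auto simp: strict_mono_less strict_mono_less_eq strict_mono_eq)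

definition crossing :: "nat \<Rightarrow> nat \<Rightarrow> nat \<Rightarrow> nat \<Rightarrow> real \<Rightarrow> bool" where
  "crossing i j k l s \<longleftrightarrow> (interleaved (i, j) (k, l) \<or> interleaved (k, l) (i, j)) \<and>
     x i < s \<and> s < x j \<and> x k < s \<and> s < x l \<and> chord (x i) (x j) s = chord (x k) (x l) s"

lemma crossing_sym: "crossing i j k l s \<Longrightarrow> crossing k l i j s"
  by (auto simp: crossing_def)

lemma chords_meet_cases:
  assumes "i < j" "k < l" "s \<in> {x i..x j}" "s \<in> {x k..x l}"
    and "chord (x i) (x j) s = chord (x k) (x l) s"
  obtains "i = k" "j = l" | v where "v \<in> {i, j} \<inter> {k, l}" "s = x v" | "crossing i j k l s"
proof (cases "(i, j) = (k, l)")
  case False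
  then have "s \<in> {x i, x j} \<inter> {x k, x l} \<or>
    (x i < x k \<and> x j < x l \<or> x k < x i \<and> x l < x j) \<and> x i < s \<and> s < x j \<and> x k < s \<and> s < x l"
    using assms by (intro chords_meet) auto
  then show thesis
  proof
    assume "s \<in> {x i, x j} \<inter> {x k, x l}"
    then show thesis using that(2)[of i] that(2)[of j] by auto
  next
    assume *: "(x i < x k \<and> x j < x l \<or> x k < x i \<and> x l < x j) \<and> x i < s \<and> s < x j \<and> x k < s \<and> s < x l"
    then have "x k < x j" "x i < x l" by linarith+
    then have "crossing i j k l s" using * assms(5) by (auto simp: crossing_def interleaved_def)
    then show thesis by (rule that(3))
  qed
qed (use that in auto)

text \<open>
  The polygon is the region over its lower sides and under the side from the first to the last
  vertex; being an intersection of half-planes, it is visibly convex.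
\<close>

definition polygon :: "complex set" where
  "polygon = {z. (\<forall>i. Suc i < n \<longrightarrow> chord (x i) (x (Suc i)) (Re z) \<le> Im z) \<and>
     Im z \<le> chord (x 0) (x (n - 1)) (Re z)}"

definition polygon_interior :: "complex set" where
  "polygon_interior = {z. (\<forall>i. Suc i < n \<longrightarrow> chord (x i) (x (Suc i)) (Re z) < Im z) \<and>
     Im z < chord (x 0) (x (n - 1)) (Re z)}"

lemma chord_diff: "chord a b s - chord b c s = (a - c) * (s - b)"
  by (simp add: chord_def algebra_simps)

lemma polygon_low: "z \<in> polygon \<Longrightarrow> Suc i < n \<Longrightarrow> chord (x i) (x (Suc i)) (Re z) \<le> Im z"
  and polygon_high: "z \<in> polygon \<Longrightarrow> Im z \<le> chord (x 0) (x (n - 1)) (Re z)"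
  by (simp_all add: polygon_def)

lemma polygon_Re:
  assumes "z \<in> polygon"
  shows "x 0 \<le> Re z" "Re z \<le> x (n - 1)"
proof -
  have "chord (x 0) (x 1) (Re z) \<le> chord (x 0) (x (n - 1)) (Re z)"
    using polygon_low[OF assms, of 0] polygon_high[OF assms] n by simp
  then have "0 \<le> (x (n - 1) - x 1) * (Re z - x 0)"
    using chord_diff[of "x 1" "x 0" "Re z" "x (n - 1)"] chord_commute[of "x 0" "x 1"]
    by (simp add: algebra_simps)
  moreover have "x 1 < x (n - 1)" using n by simp
  ultimately show "x 0 \<le> Re z" by (simp add: zero_le_mult_iff)
  have "Suc (n - 2) = n - 1" using n by simp
  then have "chord (x (n - 2)) (x (n - 1)) (Re z) \<le> Im z" "Im z \<le> chord (x 0) (x (n - 1)) (Re z)"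
    using polygon_low[OF assms, of "n - 2"] polygon_high[OF assms] n by simp_all
  then have "(x (n - 2) - x 0) * (Re z - x (n - 1)) \<le> 0"
    using chord_diff[of "x (n - 2)" "x (n - 1)" "Re z" "x 0"] chord_commute[of "x 0" "x (n - 1)"] by simp
  moreover have "x 0 < x (n - 2)" using n by simp
  ultimately show "Re z \<le> x (n - 1)" by (simp add: mult_le_0_iff)
qed

lemma chord_over_side:
  assumes "i < j" "j < n" "x i < s" "s < x j" "Suc m < n" "(i, j) \<noteq> (m, Suc m)"
  shows "chord (x m) (x (Suc m)) s < chord (x i) (x j) s"
proof (cases "x m < s \<and> s < x (Suc m)")
  case True
  then have "x i < x (Suc m)" "x m < x j" using assms(3,4) by linarith+
  then show ?thesis using True assms by (intro chord_nested) auto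
next
  case False
  then have "chord (x m) (x (Suc m)) s \<le> s\<^sup>2" by (intro chord_le_square) auto
  also have "\<dots> < chord (x i) (x j) s" using assms by (intro chord_gt_square)
  finally show ?thesis .
qed

lemma chord_under_top:
  assumes "i < j" "j < n" "x i < s" "s < x j" "(i, j) \<noteq> (0, n - 1)"
  shows "chord (x i) (x j) s < chord (x 0) (x (n - 1)) s"
  using assms by (intro chord_nested) auto

lemma vertex_in_polygon:
  assumes "v < n"
  shows "Complex (x v) ((x v)\<^sup>2) \<in> polygon"
proof -
  have "chord (x i) (x (Suc i)) (x v) \<le> (x v)\<^sup>2" for i by (intro chord_le_square) auto
  moreover have "(x v)\<^sup>2 \<le> chord (x 0) (x (n - 1)) (x v)" using assms by (simp add: chord_eq)
  ultimately show ?thesis by (simp add: polygon_def)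
qed

lemma side_in_polygon:
  assumes ij: "i < j" "j < n" "side n i j" and s: "s \<in> {x i..x j}"
  shows "Complex s (chord (x i) (x j) s) \<in> polygon - polygon_interior"
proof
  show "Complex s (chord (x i) (x j) s) \<notin> polygon_interior"
    using ij unfolding side_def polygon_interior_def by auto
  show "Complex s (chord (x i) (x j) s) \<in> polygon"
  proof (cases "s = x i \<or> s = x j")
    case True
    then have "chord (x i) (x j) s = s\<^sup>2" by (simp add: chord_eq_square)
    then show ?thesis using True vertex_in_polygon[of i] vertex_in_polygon[of j] ij by auto
  next
    case False
    then have "x i < s" "s < x j" using s by auto
    then have "chord (x m) (x (Suc m)) s \<le> chord (x i) (x j) s" if "Suc m < n" for m
      using chord_over_side[OF ij(1,2) _ _ that] by (cases "(i, j) = (m, Suc m)") force+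
    moreover have "chord (x i) (x j) s \<le> chord (x 0) (x (n - 1)) s"
      using chord_under_top[OF ij(1,2)] \<open>x i < s\<close> \<open>s < x j\<close> by (cases "(i, j) = (0, n - 1)") force+
    ultimately show ?thesis by (simp add: polygon_def)
  qed
qed

lemma diagonal_in_polygon_interior:
  assumes "i < j" "j < n" "\<not> side n i j" "x i < s" "s < x j"
  shows "Complex s (chord (x i) (x j) s) \<in> polygon_interior"
proof -
  have "chord (x m) (x (Suc m)) s < chord (x i) (x j) s" if "Suc m < n" for m
    using assms that by (intro chord_over_side) (auto simp: side_def)
  moreover have "chord (x i) (x j) s < chord (x 0) (x (n - 1)) s"
    using assms by (intro chord_under_top) (auto simp: side_def)
  ultimately show ?thesis by (simp add: polygon_interior_def)
qed

text \<open>
  A point of the polygon on the line of a side lies on the side itself, since the lines of the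
  neighbouring sides bound it on the left and on the right.
\<close>

lemma polygon_boundary_on_side:
  assumes z: "z \<in> polygon - polygon_interior"
  obtains i j s where "i < j" "j < n" "side n i j" "s \<in> {x i..x j}"
    "z = Complex s (chord (x i) (x j) s)"
proof -
  let ?s = "Re z"
  have zP: "z \<in> polygon" using z by simp
  have low: "chord (x i) (x (Suc i)) ?s \<le> Im z" if "Suc i < n" for i
    using polygon_low[OF zP that] .
  have "(\<exists>i. Suc i < n \<and> chord (x i) (x (Suc i)) ?s = Im z) \<or> Im z = chord (x 0) (x (n - 1)) ?s"
    using z unfolding polygon_def polygon_interior_def by force
  then show thesis
  proof
    assume "Im z = chord (x 0) (x (n - 1)) ?s"
    then show thesis using polygon_Re[OF zP] n
      by (intro that[of 0 "n - 1" ?s]) (auto simp: side_def complex_eq_iff)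
  next
    assume "\<exists>i. Suc i < n \<and> chord (x i) (x (Suc i)) ?s = Im z"
    then obtain i where i: "Suc i < n" "chord (x i) (x (Suc i)) ?s = Im z" by blast
    have "x i \<le> ?s"
    proof (cases i)
      case 0 then show ?thesis using polygon_Re[OF zP] by simp
    next
      case (Suc m)
      then have "(x m - x (Suc i)) * (?s - x i) \<le> 0"
        using low[of m] i chord_diff[of "x m" "x i" ?s "x (Suc i)"] by simp
      moreover have "x m < x (Suc i)" using Suc by simp
      ultimately show ?thesis by (simp add: mult_le_0_iff)
    qed
    moreover have "?s \<le> x (Suc i)"
    proof (cases "Suc (Suc i) < n")
      case False
      then have "Suc i = n - 1" using i(1) by simp
      then show ?thesis using polygon_Re[OF zP] by simp
    next
      case True
      then have "0 \<le> (x i - x (Suc (Suc i))) * (?s - x (Suc i))"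
        using low[of "Suc i"] i chord_diff[of "x i" "x (Suc i)" ?s "x (Suc (Suc i))"] by simp
      moreover have "x i < x (Suc (Suc i))" by simp
      ultimately show ?thesis by (simp add: zero_le_mult_iff)
    qed
    ultimately show thesis using i
      by (intro that[of i "Suc i" ?s]) (auto simp: side_def complex_eq_iff)
  qed
qed

lemma polyhedron_under_chord: "polyhedron {z. Im z \<le> chord a b (Re z)}"
proof -
  have "{z. Im z \<le> chord a b (Re z)} = {z. Complex (- (a + b)) 1 \<bullet> z \<le> - a * b}"
    by (auto simp: inner_complex_def chord_def algebra_simps)
  then show ?thesis by (simp add: polyhedron_halfspace_le)
qed

lemma polyhedron_over_chord: "polyhedron {z. chord a b (Re z) \<le> Im z}"
proof -
  have "{z. chord a b (Re z) \<le> Im z} = {z. Complex (a + b) (- 1) \<bullet> z \<le> a * b}"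
    by (auto simp: inner_complex_def chord_def algebra_simps)
  then show ?thesis by (simp add: polyhedron_halfspace_le)
qed

lemma polytope_polygon: "polytope polygon"
  unfolding polytope_eq_bounded_polyhedron
proof
  have "polygon = \<Inter>((\<lambda>i. {z. chord (x i) (x (Suc i)) (Re z) \<le> Im z}) ` {i. Suc i < n})
      \<inter> {z. Im z \<le> chord (x 0) (x (n - 1)) (Re z)}"
    by (auto simp: polygon_def)
  moreover have "finite {i. Suc i < n}" by (rule finite_subset[of _ "{..n}"]) auto
  ultimately show "polyhedron polygon"
    by (auto intro!: polyhedron_Int polyhedron_Inter polyhedron_over_chord polyhedron_under_chord)
  define M where "M = max \<bar>x 0\<bar> \<bar>x (n - 1)\<bar>"
  define C where "C = (\<lambda>a b. \<bar>a + b\<bar> * M + \<bar>a * b\<bar>)"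
  have chord_bound: "\<bar>chord a b s\<bar> \<le> C a b" if "\<bar>s\<bar> \<le> M" for a b s
  proof -
    have "\<bar>chord a b s\<bar> \<le> \<bar>a + b\<bar> * \<bar>s\<bar> + \<bar>a * b\<bar>"
      unfolding chord_def using abs_triangle_ineq4[of "(a + b) * s" "a * b"] by (simp only: abs_mult)
    also have "\<dots> \<le> C a b" unfolding C_def using that by (intro add_right_mono mult_left_mono) auto
    finally show ?thesis .
  qed
  show "bounded polygon"
    unfolding bounded_iff
  proof (intro exI ballI)
    fix z assume z: "z \<in> polygon"
    have s: "\<bar>Re z\<bar> \<le> M" using polygon_Re[OF z] unfolding M_def by linarith
    have "chord (x 0) (x (Suc 0)) (Re z) \<le> Im z" "Im z \<le> chord (x 0) (x (n - 1)) (Re z)"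
      using polygon_low[OF z, of 0] polygon_high[OF z] n by simp_all
    then have "\<bar>Im z\<bar> \<le> C (x 0) (x (Suc 0)) + C (x 0) (x (n - 1))"
      using chord_bound[OF s, of "x 0" "x (Suc 0)"] chord_bound[OF s, of "x 0" "x (n - 1)"] by linarith
    then show "norm z \<le> M + (C (x 0) (x (Suc 0)) + C (x 0) (x (n - 1)))"
      using s cmod_le[of z] by linarith
  qed
qed

lemma interior_polygon: "interior polygon = polygon_interior"
proof
  have "continuous_on UNIV (\<lambda>z. chord a b (Re z))" for a b
    unfolding chord_def by (intro continuous_intros)
  then have op: "open {z. chord a b (Re z) < Im z}" "open {z. Im z < chord a b (Re z)}" for a b
    by (auto intro!: open_Collect_less continuous_intros)
  have "polygon_interior = (\<Inter>i\<in>{i. Suc i < n}. {z. chord (x i) (x (Suc i)) (Re z) < Im z})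
      \<inter> {z. Im z < chord (x 0) (x (n - 1)) (Re z)}"
    by (auto simp: polygon_interior_def)
  moreover have "finite {i. Suc i < n}" by (rule finite_subset[of _ "{..n}"]) auto
  ultimately have "open polygon_interior" using op by (auto intro!: open_Int open_INT)
  moreover have "polygon_interior \<subseteq> polygon"
    by (auto simp: polygon_def polygon_interior_def less_imp_le)
  ultimately show "polygon_interior \<subseteq> interior polygon" by (intro interior_maximal)
  show "interior polygon \<subseteq> polygon_interior"
  proof
    fix z assume "z \<in> interior polygon"
    then obtain r where r: "0 < r" "ball z r \<subseteq> polygon" by (auto simp: mem_interior)
    have shift: "z + Complex 0 t \<in> polygon" if "\<bar>t\<bar> < r" for t
    proof -
      have "cmod (Complex 0 t) = \<bar>t\<bar>" by (simp add: cmod_def)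
      then have "z + Complex 0 t \<in> ball z r" using that by (simp add: dist_norm norm_minus_commute)
      then show ?thesis using r(2) by blast
    qed
    have "z + Complex 0 (r / 2) \<in> polygon" "z + Complex 0 (- (r / 2)) \<in> polygon"
      using r(1) by (intro shift; simp)+
    then show "z \<in> polygon_interior"
      using r(1) unfolding polygon_def polygon_interior_def by fastforce
  qed
qed

lemma frontier_polygon: "frontier polygon = polygon - polygon_interior"
  using polytope_imp_closed[OF polytope_polygon] by (simp add: frontier_def interior_polygon)

lemma inside_frontier_polygon: "inside (frontier polygon) = polygon_interior"
  using polytope_polygon
  by (simp add: inside_frontier_eq_interior polytope_imp_bounded polytope_imp_convex interior_polygon)

lemma polygon_interior_nonempty: "polygon_interior \<noteq> {}"
proof -
  define s where "s = x 1"
  define h where "h = chord (x 0) (x (n - 1)) s"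
  have "s\<^sup>2 < h" unfolding h_def s_def using n by (intro chord_gt_square) auto
  then have "s\<^sup>2 < (s\<^sup>2 + h) / 2" "(s\<^sup>2 + h) / 2 < h" by simp_all
  moreover have "chord (x i) (x (Suc i)) s < (s\<^sup>2 + h) / 2" for i
  proof -
    have "chord (x i) (x (Suc i)) s \<le> s\<^sup>2" unfolding s_def by (intro chord_le_square) auto
    then show ?thesis using \<open>s\<^sup>2 < (s\<^sup>2 + h) / 2\<close> by (rule le_less_trans)
  qed
  ultimately have "Complex s ((s\<^sup>2 + h) / 2) \<in> polygon_interior"
    by (simp add: polygon_interior_def h_def)
  then show ?thesis by blast
qed

lemma cycle_edges_upt: "cycle_edges [0..<n] = {{i, j} | i j. i < j \<and> j < n \<and> side n i j}"
proof
  show "cycle_edges [0..<n] \<subseteq> {{i, j} | i j. i < j \<and> j < n \<and> side n i j}"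
  proof
    fix e assume "e \<in> cycle_edges [0..<n]"
    then obtain i where i: "i < n" "e = {i, Suc i mod n}" by (auto simp: cycle_edges_def)
    show "e \<in> {{i, j} | i j. i < j \<and> j < n \<and> side n i j}"
    proof (cases "Suc i = n")
      case True
      then have "e = {0, n - 1}" using i by auto
      then show ?thesis using n by (intro CollectI exI[of _ 0] exI[of _ "n - 1"]) (auto simp: side_def)
    next
      case False
      then have "e = {i, Suc i}" "Suc i < n" using i by auto
      then show ?thesis by (intro CollectI exI[of _ i] exI[of _ "Suc i"]) (auto simp: side_def)
    qed
  qed
  show "{{i, j} | i j. i < j \<and> j < n \<and> side n i j} \<subseteq> cycle_edges [0..<n]"
  proof
    fix e assume "e \<in> {{i, j} | i j. i < j \<and> j < n \<and> side n i j}"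
    then obtain i j where e: "e = {i, j}" "i < j" "j < n" "side n i j" by blast
    show "e \<in> cycle_edges [0..<n]"
    proof (cases "j = Suc i")
      case True
      then show ?thesis using e unfolding cycle_edges_def by (intro CollectI exI[of _ i]) auto
    next
      case False
      then have "e = {n - 1, 0}" using e by (auto simp: side_def)
      then show ?thesis using n unfolding cycle_edges_def by (intro CollectI exI[of _ "n - 1"]) auto
    qed
  qed
qed

lemma hamiltonian_cycle_upt: "is_hamiltonian_cycle (complete_graph n) [0..<n]"
proof -
  have "cycle_edges [0..<n] \<subseteq> edges (complete_graph n)"
    unfolding cycle_edges_upt by (auto simp: complete_graph_def)
  then show ?thesis using n by (auto simp: is_hamiltonian_cycle_def is_cycle_def complete_graph_def)
qed

end


section \<open>The leveled drawing\<close>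

text \<open>
  Two chords cross over at most one value of \<open>s\<close>, so this asks finitely many inequalities of \<open>K\<close>, each of
  which holds for large \<open>K\<close>. The first one puts all crossings on the descending part of a lifted
  chord, the second one lets a factor \<open>K\<close> outweigh the different distances from the right ends.
\<close>

lemma eventually_steep:
  assumes "parabola_points n x"
  shows "\<forall>\<^sub>F K in at_top. \<forall>i j k l s. j < n \<longrightarrow> l < n \<longrightarrow> parabola_points.crossing x i j k l s \<longrightarrow>
    x j - s < K * (s - x i) \<and> x l - s < K * (x j - s)"
proof -
  interpret parabola_points n x by fact
  let ?P = "\<lambda>K (i, j, k, l). \<forall>s. crossing i j k l s \<longrightarrow>
    x j - s < K * (s - x i) \<and> x l - s < K * (x j - s)"
  have "\<forall>\<^sub>F K in at_top. ?P K p" for p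
  proof -
    obtain i j k l where p: "p = (i, j, k, l)" by (rule prod_cases4)
    show ?thesis
    proof (cases "\<exists>s. crossing i j k l s")
      case True
      then obtain s where s: "crossing i j k l s" by blast
      have unique: "t = s" if "crossing i j k l t" for t
      proof -
        have "(x i + x j - (x k + x l)) * (t - s) = 0"
          using s that unfolding crossing_def chord_def by algebra
        moreover have "x i + x j \<noteq> x k + x l"
          using s by (intro chord_slopes_differ[of _ _ s]) (auto simp: crossing_def interleaved_def)
        ultimately show ?thesis by simp
      qed
      have "0 < s - x i" "0 < x j - s" using s by (auto simp: crossing_def)
      moreover have "\<forall>\<^sub>F K in at_top. (x j - s) / (s - x i) < K"
        "\<forall>\<^sub>F K in at_top. (x l - s) / (x j - s) < K" by (rule eventually_gt_at_top)+
      ultimately have "\<forall>\<^sub>F K in at_top. x j - s < K * (s - x i) \<and> x l - s < K * (x j - s)"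
        by (auto simp: pos_divide_less_eq eventually_conj)
      then show ?thesis unfolding p by (rule eventually_mono) (use unique in auto)
    next
      case False
      then show ?thesis by (simp add: p)
    qed
  qed
  then have "\<forall>\<^sub>F K in at_top. \<forall>p\<in>{..<n} \<times> {..<n} \<times> {..<n} \<times> {..<n}. ?P K p"
    by (intro eventually_ball_finite) auto
  then show ?thesis
  proof (rule eventually_mono)
    fix K assume K: "\<forall>p\<in>{..<n} \<times> {..<n} \<times> {..<n} \<times> {..<n}. ?P K p"
    show "\<forall>i j k l s. j < n \<longrightarrow> l < n \<longrightarrow> crossing i j k l s \<longrightarrow>
      x j - s < K * (s - x i) \<and> x l - s < K * (x j - s)"
    proof (intro allI impI)
      fix i j k l s assume jl: "j < n" "l < n" and c: "crossing i j k l s"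
      then have "i < n" "k < n" by (auto simp: crossing_def interleaved_def)
      then show "x j - s < K * (s - x i) \<and> x l - s < K * (x j - s)"
        using bspec[OF K, of "(i, j, k, l)"] jl c by simp
    qed
  qed
qed

locale leveled_points = parabola_points +
  fixes K :: real
  assumes general: "general_position (x ` {..<n})" and K: "1 < K"
    and steep: "\<And>i j k l s. j < n \<Longrightarrow> l < n \<Longrightarrow> crossing i j k l s \<Longrightarrow>
      x j - s < K * (s - x i) \<and> x l - s < K * (x j - s)"
begin

text \<open>
  A lifted diagonal rises steeply at its left end \<open>x i\<close> and then descends linearly to its
  right end, at the scale \<open>K ^ p\<close> for the page \<open>p\<close>. The sides of the polygon stay at height \<open>0\<close>.
\<close>

definition weight :: "nat \<Rightarrow> nat \<Rightarrow> real" where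
  "weight i j = (if side n i j then 0 else K ^ page n (i, j))"

definition height :: "nat \<Rightarrow> nat \<Rightarrow> real \<Rightarrow> real" where
  "height i j s = weight i j * min (K * (s - x i)) (x j - s)"

definition curve :: "nat \<Rightarrow> nat \<Rightarrow> real \<Rightarrow> R3" where
  "curve i j s = (Complex s (chord (x i) (x j) s), height i j s)"

definition vertex :: "nat \<Rightarrow> R3" where
  "vertex v = (Complex (x v) ((x v)\<^sup>2), 0)"

abbreviation D :: "(nat, R3) drawing" where
  "D \<equiv> curve_drawing x vertex curve"

abbreviation G :: "nat ugraph" where
  "G \<equiv> complete_graph n"

lemma fst_curve_eq: "fst (curve i j s) = fst (curve k l t) \<longleftrightarrow>
    s = t \<and> chord (x i) (x j) s = chord (x k) (x l) s"
  by (auto simp: curve_def)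

lemma fst_curve_vertex: "fst (curve i j s) = fst (vertex v) \<longleftrightarrow> s = x v \<and> (v = i \<or> v = j)"
  by (auto simp: curve_def vertex_def chord_eq_square)

lemma curve_at_vertex: "i < j \<Longrightarrow> v \<in> {i, j} \<Longrightarrow> curve i j (x v) = vertex v"
  using K by (auto simp: curve_def vertex_def chord_eq height_def)

lemma crossing_height:
  assumes "crossing i j k l s" "j < n" "k < l" "l < n"
  shows "height i j s = K ^ page n (i, j) * (x j - s)"
proof -
  have "\<not> side n i j"
    using assms interleaved_not_side[of i j k l n] by (simp add: crossing_def)
  moreover have "x j - s < K * (s - x i)" using steep assms by blast
  ultimately show ?thesis by (simp add: height_def weight_def)
qed

lemma crossing_page_height:
  assumes c: "crossing i j k l s" and ij: "i < j" "j < n" and kl: "k < l" "l < n"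
    and page: "page n (k, l) < page n (i, j)"
  shows "height k l s < height i j s"
proof -
  have s: "s < x j" using c by (simp add: crossing_def)
  have "height k l s = K ^ page n (k, l) * (x l - s)"
    by (rule crossing_height[OF crossing_sym[OF c] kl(2) ij])
  also have "\<dots> < K ^ page n (k, l) * (K * (x j - s))"
    using steep[OF ij(2) kl(2) c] K by simp
  also have "\<dots> = K ^ Suc (page n (k, l)) * (x j - s)" by simp
  also have "\<dots> \<le> K ^ page n (i, j) * (x j - s)"
    using K s page by (intro mult_right_mono power_increasing) auto
  also have "\<dots> = height i j s" by (rule crossing_height[OF c ij(2) kl, symmetric])
  finally show ?thesis .
qed

lemma crossing_pages_differ:
  assumes "crossing i j k l s" "j < n" "l < n"
  shows "page n (i, j) \<noteq> page n (k, l)"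
  using assms page_noncrossing[of "(i, j)" "(k, l)" n] page_noncrossing[of "(k, l)" "(i, j)" n]
  by (auto simp: crossing_def)

lemma crossing_heights_differ:
  assumes "crossing i j k l s" "i < j" "j < n" "k < l" "l < n"
  shows "height i j s \<noteq> height k l s"
  using crossing_pages_differ[OF assms(1,3,5)] crossing_page_height[OF assms]
    crossing_page_height[OF crossing_sym[OF assms(1)] assms(4,5,2,3)]
  by (cases "page n (i, j)" "page n (k, l)" rule: linorder_cases) auto

text \<open>
  The three ways in which points of the drawing can share their projection: they coincide on one
  edge, they coincide in a common vertex, or the two edges cross there.
\<close>

lemma same_projection:
  assumes ij: "i < j" "s \<in> {x i..x j}" and kl: "k < l" "t \<in> {x k..x l}"
    and "fst (curve i j s) = fst (curve k l t)"
  shows "t = s \<and> i = k \<and> j = l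
    \<or> (\<exists>v\<in>{i, j} \<inter> {k, l}. curve i j s = vertex v \<and> curve k l t = vertex v)
    \<or> t = s \<and> crossing i j k l s"
proof -
  have eq: "t = s" "chord (x i) (x j) s = chord (x k) (x l) s" using assms(5) by (auto simp: fst_curve_eq)
  have sk: "s \<in> {x k..x l}" using kl(2) eq(1) by simp
  show ?thesis
  proof (rule chords_meet_cases[OF ij(1) kl(1) ij(2) sk eq(2)])
    fix v assume v: "v \<in> {i, j} \<inter> {k, l}" "s = x v"
    have "curve i j s = vertex v" "curve k l t = vertex v"
      unfolding eq(1) v(2) using v(1) ij(1) kl(1) by (auto intro!: curve_at_vertex)
    then show ?thesis using v(1) by blast
  qed (use eq(1) in auto)
qed

text \<open>
  The parameter at which a lifted chord turns from rising to descending.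
\<close>

definition bend :: "nat \<Rightarrow> nat \<Rightarrow> real" where
  "bend i j = (K * x i + x j) / (K + 1)"

lemma bend_bounds: "i < j \<Longrightarrow> x i < bend i j \<and> bend i j < x j"
proof -
  assume "i < j"
  then have "x i < x j" by simp
  then show ?thesis using K by (simp add: bend_def field_simps)
qed

lemma bend_le_iff: "bend i j \<le> s \<longleftrightarrow> x j - s \<le> K * (s - x i)"
  using K by (simp add: bend_def field_simps)

lemma curve_rising: "s \<in> {x i..bend i j} \<Longrightarrow> curve i j s =
    (Complex 0 (- x i * x j), - weight i j * K * x i) + s *\<^sub>R (Complex 1 (x i + x j), weight i j * K)"
proof -
  assume "s \<in> {x i..bend i j}"
  then have "K * (s - x i) \<le> x j - s" using bend_le_iff[of i j s] K by (cases "s = bend i j") (auto simp: bend_def field_simps)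
  then show ?thesis
    by (simp add: curve_def height_def min_absorb1 chord_def complex_eq_iff algebra_simps)
qed

lemma curve_falling: "s \<in> {bend i j..x j} \<Longrightarrow> curve i j s =
    (Complex 0 (- x i * x j), weight i j * x j) + s *\<^sub>R (Complex 1 (x i + x j), - weight i j)"
proof -
  assume "s \<in> {bend i j..x j}"
  then have "x j - s \<le> K * (s - x i)" using bend_le_iff[of i j s] by simp
  then show ?thesis
    by (simp add: curve_def height_def min_absorb2 chord_def complex_eq_iff algebra_simps)
qed

lemma continuous_on_curve: "continuous_on S (curve i j)"
  unfolding curve_def height_def chord_def Complex_eq by (intro continuous_intros)

lemma inj_fst_curve: "inj_on fst (curve i j ` S)"
  by (rule inj_onI) (auto simp: curve_def)

lemma pl_embedding_D: "pl_embedding G D"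
  unfolding pl_embedding_def
proof
  show "embedding G D"
  proof (rule embedding_curve_drawing[OF mono])
    show "inj_on vertex {..<n}" by (rule inj_onI) (simp add: vertex_def)
    fix i j assume ij: "i < j" "j < n"
    show "curve i j (x i) = vertex i \<and> curve i j (x j) = vertex j"
      using curve_at_vertex[OF ij(1)] by simp
    show "continuous_on {x i..x j} (curve i j)" by (rule continuous_on_curve)
    show "inj_on (curve i j) {x i..x j}" by (rule inj_onI) (simp add: curve_def)
    show "k \<in> {i, j}" if "curve i j s = vertex k" for k s
      using fst_curve_vertex[of i j s k] that by simp
    show "curve i j s \<in> vertex ` ({i, j} \<inter> {k, l})"
      if kl: "k < l" "l < n" and ne: "(i, j) \<noteq> (k, l)" and s: "s \<in> {x i..x j}"
        and t: "t \<in> {x k..x l}" and eq: "curve i j s = curve k l t" for k l s t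
      using same_projection[OF ij(1) s kl(1) t arg_cong[OF eq, of fst]]
    proof (elim disjE conjE bexE)
      assume c: "t = s" "crossing i j k l s"
      then have "height i j s = height k l s" using eq by (simp add: curve_def)
      then show ?thesis using crossing_heights_differ[OF c(2) ij kl] by simp
    qed (use ne in auto)
  qed
  show "\<forall>e\<in>edges G. piecewise_linear (epos D e)"
  proof
    fix e assume "e \<in> edges G"
    then obtain i j where e: "i < j" "j < n" "e = {i, j}" by (rule complete_graph_edge)
    show "piecewise_linear (epos D e)"
      unfolding e(3) epos_curve_drawing[OF e(1)]
      using bend_bounds[OF e(1)]
      by (intro piecewise_linear_curve[of "x i" "bend i j" "x j", OF _ _ curve_rising curve_falling]) auto
  qed
qed

lemma embedding_D: "embedding G D"
  using pl_embedding_D by (simp add: pl_embedding_def)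

lemma support_D: "support G D = (\<Union>(i, j)\<in>{(i, j). i < j \<and> j < n}. curve i j ` {x i..x j})"
proof
  have vertex: "\<exists>i j. i < j \<and> j < n \<and> vertex v \<in> curve i j ` {x i..x j}" if "v < n" for v
  proof -
    define w :: nat where "w = (if v = 0 then 1 else 0)"
    have w: "w < n" "w \<noteq> v" using n by (auto simp: w_def)
    have "vertex v \<in> curve (min v w) (max v w) ` {x (min v w)..x (max v w)}"
    proof
      show "vertex v = curve (min v w) (max v w) (x v)"
        using w by (intro curve_at_vertex[symmetric]) auto
    qed auto
    then show ?thesis using that w by (intro exI[of _ "min v w"] exI[of _ "max v w"]) auto
  qed
  show "support G D \<subseteq> (\<Union>(i, j)\<in>{(i, j). i < j \<and> j < n}. curve i j ` {x i..x j})"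
  proof
    fix a assume "a \<in> support G D"
    then consider v where "v < n" "a = vertex v" | e where "e \<in> edges G" "a \<in> epos D e"
      by (auto simp: support_def complete_graph_def)
    then show "a \<in> (\<Union>(i, j)\<in>{(i, j). i < j \<and> j < n}. curve i j ` {x i..x j})"
    proof cases
      case 1 then show ?thesis using vertex[of v] by blast
    next
      case 2
      obtain i j where e: "i < j" "j < n" "e = {i, j}" using complete_graph_edge[OF 2(1)] .
      then show ?thesis using 2(2) by auto
    qed
  qed
  show "(\<Union>(i, j)\<in>{(i, j). i < j \<and> j < n}. curve i j ` {x i..x j}) \<subseteq> support G D"
  proof
    fix a assume "a \<in> (\<Union>(i, j)\<in>{(i, j). i < j \<and> j < n}. curve i j ` {x i..x j})"
    then obtain i j where ij: "i < j" "j < n" "a \<in> epos D {i, j}" by auto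
    moreover have "{i, j} \<in> edges G" using ij by (auto simp: complete_graph_def)
    ultimately show "a \<in> support G D" by (auto simp: support_def simp del: epos_curve_drawing)
  qed
qed

lemma on_support:
  assumes "a \<in> support G D"
  obtains i j s where "i < j" "j < n" "s \<in> {x i..x j}" "a = curve i j s"
  using assms unfolding support_D by auto

lemma cycle_support_D: "cycle_support [0..<n] D = frontier polygon \<times> {0}"
proof
  have flat: "curve i j s = (Complex s (chord (x i) (x j) s), 0)" if "side n i j" for i j s
    using that by (simp add: curve_def height_def weight_def)
  show "cycle_support [0..<n] D \<subseteq> frontier polygon \<times> {0}"
  proof
    fix a assume "a \<in> cycle_support [0..<n] D"
    then obtain i j where ij: "i < j" "j < n" "side n i j" "a \<in> epos D {i, j}"
      unfolding cycle_support_def cycle_edges_upt by blast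
    then obtain s where "s \<in> {x i..x j}" "a = curve i j s" by auto
    then show "a \<in> frontier polygon \<times> {0}"
      using side_in_polygon[OF ij(1-3)] flat[OF ij(3)] by (simp add: frontier_polygon)
  qed
  show "frontier polygon \<times> {0} \<subseteq> cycle_support [0..<n] D"
  proof
    fix a assume "a \<in> frontier polygon \<times> {0::real}"
    then obtain z where z: "z \<in> polygon - polygon_interior" "a = (z, 0)" by (auto simp: frontier_polygon)
    obtain i j s where ij: "i < j" "j < n" "side n i j" "s \<in> {x i..x j}"
      "z = Complex s (chord (x i) (x j) s)" using polygon_boundary_on_side[OF z(1)] .
    then have "a \<in> epos D {i, j}" using z(2) flat[OF ij(3), of s] by (simp add: image_iff) (metis atLeastAtMost_iff)
    then show "a \<in> cycle_support [0..<n] D"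
      using ij unfolding cycle_support_def cycle_edges_upt by blast
  qed
qed

text \<open>
  A crossing lies strictly on the descending segment of its edge and off all other edges, and the
  part \<open>R\<close> of the drawing that is left is closed, so near the crossing only that segment is seen.
\<close>

lemma straight_at_crossing:
  assumes c: "crossing i j k l s" and ij: "i < j" "j < n" and kl: "k < l" "l < n"
  shows "straight_at (support G D) (curve i j s) (Complex 1 (x i + x j), - weight i j)"
proof -
  let ?d = "(Complex 1 (x i + x j), - weight i j) :: R3"
  let ?c = "(Complex 0 (- x i * x j), weight i j * x j) :: R3"
  have s: "x i < s" "s < x j" using c by (auto simp: crossing_def)
  have sbend: "bend i j < s"
    using steep[OF ij(2) kl(2) c] bend_le_iff[of i j s] K by (cases "s = bend i j") (auto simp: bend_def field_simps)
  define R where "R = curve i j ` {x i..bend i j} \<union>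
    (\<Union>(k, l)\<in>{(k, l). k < l \<and> l < n} - {(i, j)}. curve k l ` {x k..x l})"
  have supp: "support G D = R \<union> curve i j ` {bend i j..x j}"
  proof -
    have "{x i..x j} = {x i..bend i j} \<union> {bend i j..x j}" using bend_bounds[OF ij(1)] by auto
    then have "curve i j ` {x i..x j} = curve i j ` {x i..bend i j} \<union> curve i j ` {bend i j..x j}"
      by (simp add: image_Un)
    moreover have "support G D = curve i j ` {x i..x j} \<union>
        (\<Union>(k, l)\<in>{(k, l). k < l \<and> l < n} - {(i, j)}. curve k l ` {x k..x l})"
    proof -
      have "insert (i, j) ({(k, l). k < l \<and> l < n} - {(i, j)}) = {(k, l). k < l \<and> l < n}"
        using ij by auto
      then show ?thesis
        unfolding support_D by (metis (no_types, lifting) UN_insert case_prod_conv)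
    qed
    ultimately show ?thesis unfolding R_def by (simp only: Un_ac)
  qed
  have "finite {(k, l). k < l \<and> l < n}"
    by (rule finite_subset[of _ "{..<n} \<times> {..<n}"]) auto
  moreover have "compact (curve k l ` {p..q})" for k l p q
    by (intro compact_continuous_image continuous_on_curve) simp
  ultimately have "closed R" unfolding R_def
    by (intro compact_imp_closed compact_Un compact_UN) auto
  moreover have "curve i j s \<notin> R"
  proof
    assume "curve i j s \<in> R"
    then consider t where "t \<le> bend i j" "curve i j s = curve i j t"
      | p where "p \<in> {(k, l). k < l \<and> l < n} - {(i, j)}"
          "curve i j s \<in> curve (fst p) (snd p) ` {x (fst p)..x (snd p)}"
      unfolding R_def by (auto simp: case_prod_unfold)
    then show False
    proof cases
      case 1 then show False using sbend by (simp add: curve_def)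
    next
      case (2 p)
      then obtain k l t where 2: "k < l" "l < n" "(k, l) \<noteq> (i, j)" "t \<in> {x k..x l}"
        "curve i j s = curve k l t" by (cases p) auto
      have si: "s \<in> {x i..x j}" using s by simp
      show False
        using same_projection[OF ij(1) si 2(1,4) arg_cong[OF 2(5), of fst]]
      proof (elim disjE conjE bexE)
        fix v assume "curve i j s = vertex v"
        then show False using fst_curve_vertex[of i j s v] s by auto
      next
        assume "t = s" "crossing i j k l s"
        then show False using crossing_heights_differ[of i j k l s] ij 2 by (simp add: curve_def)
      qed (use 2 in auto)
    qed
  qed
  ultimately obtain r0 where r0: "0 < r0" "ball (curve i j s) r0 \<inter> R = {}"
    using separate_point_closed[of R "curve i j s"] by (metis disjoint_iff mem_ball not_less)
  define r where "r = min r0 (min (s - bend i j) (x j - s))"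
  have r: "0 < r" "r \<le> r0" "r \<le> s - bend i j" "r \<le> x j - s" using r0(1) sbend s by (auto simp: r_def)
  have fall: "curve i j t = curve i j s + (t - s) *\<^sub>R ?d" if "t \<in> {bend i j..x j}" for t
  proof -
    have "s \<in> {bend i j..x j}" using sbend s by simp
    then show ?thesis unfolding curve_falling[OF that] curve_falling[OF \<open>s \<in> _\<close>]
      by (simp add: complex_eq_iff algebra_simps)
  qed
  have "1 \<le> norm ?d"
  proof -
    have "1 \<le> norm (Complex 1 (x i + x j))" using abs_Re_le_cmod[of "Complex 1 (x i + x j)"] by simp
    also have "\<dots> \<le> norm ?d" by (rule norm_fst_le)
    finally show ?thesis .
  qed
  then have short: "\<bar>t\<bar> < r" if "curve i j s + t *\<^sub>R ?d \<in> ball (curve i j s) r" for t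
  proof -
    have "\<bar>t\<bar> * 1 \<le> \<bar>t\<bar> * norm ?d" using \<open>1 \<le> norm ?d\<close> by (intro mult_left_mono) auto
    also have "\<dots> < r" using that by (simp add: dist_norm del: scaleR_Pair norm_Pair)
    finally show ?thesis by simp
  qed
  have "support G D \<inter> ball (curve i j s) r = range (\<lambda>t. curve i j s + t *\<^sub>R ?d) \<inter> ball (curve i j s) r"
  proof
    show "support G D \<inter> ball (curve i j s) r \<subseteq> range (\<lambda>t. curve i j s + t *\<^sub>R ?d) \<inter> ball (curve i j s) r"
    proof
      fix y assume y: "y \<in> support G D \<inter> ball (curve i j s) r"
      then have "y \<in> ball (curve i j s) r0" using subset_ball[OF r(2)] by blast
      then have "y \<notin> R" using r0(2) by blast
      then obtain t where "t \<in> {bend i j..x j}" "y = curve i j t" using y supp by auto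
      then show "y \<in> range (\<lambda>t. curve i j s + t *\<^sub>R ?d) \<inter> ball (curve i j s) r"
        using fall y by (metis IntD2 IntI rangeI)
    qed
    show "range (\<lambda>t. curve i j s + t *\<^sub>R ?d) \<inter> ball (curve i j s) r \<subseteq> support G D \<inter> ball (curve i j s) r"
    proof
      fix y assume y: "y \<in> range (\<lambda>t. curve i j s + t *\<^sub>R ?d) \<inter> ball (curve i j s) r"
      then obtain t where t: "y = curve i j s + t *\<^sub>R ?d" by blast
      then have "\<bar>t\<bar> < r" using short[of t] y by simp
      then have "s + t \<in> {bend i j..x j}" using r by auto
      moreover have "y = curve i j (s + t)" using fall[OF calculation] t by simp
      ultimately show "y \<in> support G D \<inter> ball (curve i j s) r" using supp y by blast
    qed
  qed
  then show ?thesis unfolding straight_at_def using r(1) by blast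
qed

lemma no_triple_crossing:
  assumes "crossing i j k l s" "crossing k l p q s" "crossing i j p q s"
    "i < j" "j < n" "k < l" "l < n" "p < q" "q < n"
  shows False
proof -
  have "distinct [i, j, k, l, p, q]"
    using assms by (auto simp: crossing_def interleaved_def)
  then have "distinct [x i, x j, x k, x l, x p, x q]" by simp
  moreover have "{x i, x j, x k, x l, x p, x q} \<subseteq> x ` {..<n}" using assms by auto
  moreover have "concurrent (x i) (x j) (x k) (x l) (x p) (x q)"
    using assms unfolding concurrent_def crossing_def by blast
  ultimately show False using general unfolding general_position_def by blast
qed

lemma diagram_D: "diagram G D"
  unfolding diagram_def Let_def
proof (intro conjI ballI impI)
  fix a b c assume "a \<in> support G D" "b \<in> support G D" "c \<in> support G D"
    and eq: "fst a = fst b \<and> fst b = fst c"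
  then obtain i j s k l t p q r where
    a: "i < j" "j < n" "s \<in> {x i..x j}" "a = curve i j s" and
    b: "k < l" "l < n" "t \<in> {x k..x l}" "b = curve k l t" and
    c: "p < q" "q < n" "r \<in> {x p..x q}" "c = curve p q r" by (metis on_support)
  show "a = b \<or> b = c \<or> a = c"
  proof (rule ccontr)
    assume ne: "\<not> (a = b \<or> b = c \<or> a = c)"
    have ab: "t = s \<and> crossing i j k l s"
      using same_projection[OF a(1,3) b(1,3)] eq a(4) b(4) ne by auto
    have bc: "r = t \<and> crossing k l p q t"
      using same_projection[OF b(1,3) c(1,3)] eq b(4) c(4) ne by auto
    have ac: "r = s \<and> crossing i j p q s"
      using same_projection[OF a(1,3) c(1,3)] eq a(4) c(4) ne by auto
    show False using no_triple_crossing[of i j k l s p q] ab bc ac a b c by simp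
  qed
next
  fix v a assume "a \<in> support G D" and eq: "fst a = fst (vpos D v)"
  then obtain i j s where a: "i < j" "j < n" "a = curve i j s" by (metis on_support)
  then show "a = vpos D v"
    using eq fst_curve_vertex[of i j s v] curve_at_vertex[of i j v] by auto
next
  fix a b assume "a \<in> support G D" "b \<in> support G D" and ab: "a \<noteq> b \<and> fst a = fst b"
  then obtain i j s k l t where
    a: "i < j" "j < n" "s \<in> {x i..x j}" "a = curve i j s" and
    b: "k < l" "l < n" "t \<in> {x k..x l}" "b = curve k l t" by (metis on_support)
  have c: "t = s" "crossing i j k l s"
    using same_projection[OF a(1,3) b(1,3)] ab a(4) b(4) by auto
  have slopes: "x i + x j \<noteq> x k + x l"
    using c(2) by (intro chord_slopes_differ[of _ _ s]) (auto simp: crossing_def interleaved_def)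
  have "Complex 1 (x k + x l) \<noteq> Complex 1 (x i + x j) \<and>
      independent {Complex 1 (x i + x j), Complex 1 (x k + x l)}"
    by (rule independent_pair) (use slopes in \<open>auto simp: complex_eq_iff\<close>)
  then show "\<exists>u w. straight_at (support G D) a u \<and> straight_at (support G D) b w \<and>
      fst u \<noteq> fst w \<and> independent {fst u, fst w}"
    using straight_at_crossing[OF c(2) a(1,2) b(1,2)]
      straight_at_crossing[OF crossing_sym[OF c(2)] b(1,2) a(1,2)] a(4) b(4) c(1)
    by (intro exI[of _ "(Complex 1 (x i + x j), - weight i j)"]
        exI[of _ "(Complex 1 (x k + x l), - weight k l)"]) auto
qed

text \<open>
  An edge projects injectively, which excludes monogons; two straight chords cross at most once, which
  excludes bigons.
\<close>

lemma reduced_D: "reduced G D"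
  unfolding reduced_def
proof
  have inj: "inj_on fst (epos D e)" if "e \<in> edges G" for e
    using complete_graph_edge[OF that] inj_fst_curve by (metis epos_curve_drawing)
  show "\<not> reducing_R1 G D"
  proof
    assume "reducing_R1 G D"
    then obtain e g where e: "e \<in> edges G" and g: "arc g" "path_image g \<subseteq> epos D e - vpos D ` verts G"
      "fst (pathstart g) = fst (pathfinish g)" unfolding reducing_R1_def by meson
    have "pathstart g \<in> epos D e" "pathfinish g \<in> epos D e"
      using g(2) pathstart_in_path_image[of g] pathfinish_in_path_image[of g] by blast+
    then have "pathstart g = pathfinish g" using inj_onD[OF inj[OF e] g(3)] by simp
    then show False using arc_distinct_ends[OF g(1)] by simp
  qed
  show "\<not> reducing_R2 G D"
  proof
    assume "reducing_R2 G D"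
    then obtain e f g h where e: "e \<in> edges G" and f: "f \<in> edges G" and "arc g"
      and g: "path_image g \<subseteq> epos D e - vpos D ` verts G"
      and h: "path_image h \<subseteq> epos D f - vpos D ` verts G"
      and s: "fst (pathstart g) = fst (pathstart h)" "snd (pathstart h) < snd (pathstart g)"
      and t: "fst (pathfinish g) = fst (pathfinish h)" "snd (pathfinish h) < snd (pathfinish g)"
      unfolding reducing_R2_def by meson
    have mem: "pathstart g \<in> epos D e - vpos D ` verts G" "pathfinish g \<in> epos D e - vpos D ` verts G"
      "pathstart h \<in> epos D f" "pathfinish h \<in> epos D f"
      using g h pathstart_in_path_image[of g] pathfinish_in_path_image[of g]
        pathstart_in_path_image[of h] pathfinish_in_path_image[of h] by blast+
    obtain i j where ij: "i < j" "j < n" "e = {i, j}" using complete_graph_edge[OF e] .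
    obtain k l where kl: "k < l" "l < n" "f = {k, l}" using complete_graph_edge[OF f] .
    have cross: "\<exists>r. a = curve i j r \<and> crossing i j k l r"
      if ab: "a \<in> epos D e - vpos D ` verts G" "b \<in> epos D f" "fst a = fst b" "snd b < snd a" for a b
    proof -
      obtain r r' where r: "r \<in> {x i..x j}" "a = curve i j r" "r' \<in> {x k..x l}" "b = curve k l r'"
        using ab ij kl by auto
      show ?thesis using same_projection[OF ij(1) r(1) kl(1) r(3)] ab r ij
        by (auto simp: complete_graph_def)
    qed
    obtain r r' where r: "pathstart g = curve i j r" "crossing i j k l r"
      "pathfinish g = curve i j r'" "crossing i j k l r'"
      using cross[OF mem(1,3) s] cross[OF mem(2,4) t] by blast
    have "(x i + x j - (x k + x l)) * (r - r') = 0"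
      using r(2,4) unfolding crossing_def chord_def by algebra
    moreover have "x i + x j \<noteq> x k + x l"
      using r(2) by (intro chord_slopes_differ[of _ _ r]) (auto simp: crossing_def interleaved_def)
    ultimately have "pathstart g = pathfinish g" using r by simp
    then show False using arc_distinct_ends[OF \<open>arc g\<close>] by simp
  qed
qed

end


context leveled_points
begin

lemma crosses_over_page:
  assumes ij: "i < j" "j < n" and kl: "k < l" "l < n"
    and over: "crosses_over (curve i j ` {x i..x j}) (curve k l ` {x k..x l})"
  shows "page n (k, l) < page n (i, j)"
proof -
  obtain s t where s: "s \<in> {x i..x j}" and t: "t \<in> {x k..x l}"
    and fst: "fst (curve i j s) = fst (curve k l t)" and snd: "snd (curve k l t) < snd (curve i j s)"
    using over unfolding crosses_over_def by blast
  have c: "t = s" "crossing i j k l s"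
    using same_projection[OF ij(1) s kl(1) t fst] snd by auto
  have "height k l s < height i j s" using snd c(1) by (simp add: curve_def)
  then have "\<not> page n (i, j) < page n (k, l)"
    using crossing_page_height[OF crossing_sym[OF c(2)] kl ij] by auto
  then show ?thesis using crossing_pages_differ[OF c(2) ij(2) kl(2)] by simp
qed

lemma fragments_D:
  "fragments G D [0..<n] = {curve i j ` {x i..x j} | i j. i < j \<and> j < n \<and> \<not> side n i j}"
proof -
  have "edges G \<subseteq> Pow {..<n}" by (auto simp: complete_graph_def)
  then have "finite (edges G)" by (rule finite_subset) simp
  moreover have "\<Union>(edges G) \<subseteq> verts G" by (auto simp: complete_graph_def)
  ultimately have "fragments G D [0..<n] = epos D ` (edges G - cycle_edges [0..<n])"
    by (rule fragments_of_hamiltonian_cycle[OF embedding_D hamiltonian_cycle_upt])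
  also have "edges G - cycle_edges [0..<n] = {{i, j} | i j. i < j \<and> j < n \<and> \<not> side n i j}"
  proof
    show "edges G - cycle_edges [0..<n] \<subseteq> {{i, j} | i j. i < j \<and> j < n \<and> \<not> side n i j}"
    proof
      fix e assume e: "e \<in> edges G - cycle_edges [0..<n]"
      then obtain i j where "i < j" "j < n" "e = {i, j}" using complete_graph_edge[of e n] by blast
      then show "e \<in> {{i, j} | i j. i < j \<and> j < n \<and> \<not> side n i j}"
        using e unfolding cycle_edges_upt by blast
    qed
    show "{{i, j} | i j. i < j \<and> j < n \<and> \<not> side n i j} \<subseteq> edges G - cycle_edges [0..<n]"
      unfolding cycle_edges_upt by (auto simp: complete_graph_def doubleton_eq_iff)
  qed
  also have "epos D ` \<dots> = {curve i j ` {x i..x j} | i j. i < j \<and> j < n \<and> \<not> side n i j}"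
  proof -
    have "epos D ` {{i, j} | i j. i < j \<and> j < n \<and> \<not> side n i j} =
        {epos D {i, j} | i j. i < j \<and> j < n \<and> \<not> side n i j}" by blast
    also have "\<dots> = {curve i j ` {x i..x j} | i j. i < j \<and> j < n \<and> \<not> side n i j}"
      by (metis (no_types, opaque_lifting) epos_curve_drawing)
    finally show ?thesis .
  qed
  finally show ?thesis .
qed

lemma vertex_in_cycle_support: "v < n \<Longrightarrow> vertex v \<in> cycle_support [0..<n] D"
proof -
  assume "v < n"
  have "cycle_edges [0..<n] \<subseteq> edges G"
    using hamiltonian_cycle_upt by (simp add: is_hamiltonian_cycle_def is_cycle_def)
  moreover have "v \<in> \<Union>(cycle_edges [0..<n])"
    using Union_cycle_edges[of "[0..<n]"] n \<open>v < n\<close> by simp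
  ultimately show ?thesis
    using vpos_in_drawn[OF embedding_D, of "cycle_edges [0..<n]" v] by (simp add: cycle_support_eq_drawn)
qed

lemma diagonal_inner_point:
  assumes "i < j" "j < n" "\<not> side n i j" "s \<in> {x i..x j}"
  obtains v where "v < n" "curve i j s = vertex v" | "fst (curve i j s) \<in> polygon_interior"
proof (cases "s = x i \<or> s = x j")
  case True
  then show thesis using that(1)[of i] that(1)[of j] assms curve_at_vertex[of i j] by auto
next
  case False
  then have "x i < s" "s < x j" using assms(4) by auto
  then show thesis using that(2) diagonal_in_polygon_interior[OF assms(1-3)] by (simp add: curve_def)
qed

lemma semi_leveled_D: "semi_leveled_diagram G D [0..<n]"
  unfolding semi_leveled_diagram_def
proof (intro conjI ballI impI)
  let ?C = "cycle_support [0..<n] D" and ?F = "fragments G D [0..<n]"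
  show "is_cycle G [0..<n]" using hamiltonian_cycle_upt by (simp add: is_hamiltonian_cycle_def)
  obtain p where "p \<in> interior polygon" using polygon_interior_nonempty interior_polygon by blast
  then show "unknotted ?C"
    unfolding cycle_support_D by (rule unknotted_convex_frontier[OF polytope_polygon])
  show "diagram G D" by (rule diagram_D)
  show "inj_on fst ?C" unfolding cycle_support_D by (rule inj_onI) auto
  show "inj_on fst f" if "f \<in> ?F" for f using that inj_fst_curve unfolding fragments_D by blast
  show "a = b" if f: "f \<in> ?F" "a \<in> f" and b: "b \<in> ?C" and eq: "fst a = fst b" for f a b
  proof -
    obtain i j s where a: "i < j" "j < n" "\<not> side n i j" "s \<in> {x i..x j}" "a = curve i j s"
      using f unfolding fragments_D by blast
    have b': "fst b \<notin> polygon_interior" "snd b = 0"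
      using b unfolding cycle_support_D frontier_polygon by auto
    show "a = b"
    proof (rule diagonal_inner_point[OF a(1-4)])
      fix v assume "curve i j s = vertex v"
      then have "snd a = 0" by (simp add: a(5) vertex_def)
      then show "a = b" using eq b' by (simp add: prod_eq_iff)
    qed (use b' eq a in auto)
  qed
  show "\<not> (crosses_over f g \<and> crosses_over g f)" if fg: "f \<in> ?F" "g \<in> ?F" for f g
  proof -
    obtain i j where f: "i < j" "j < n" "f = curve i j ` {x i..x j}" using fg unfolding fragments_D by blast
    obtain k l where g: "k < l" "l < n" "g = curve k l ` {x k..x l}" using fg unfolding fragments_D by blast
    show ?thesis
      using crosses_over_page[OF f(1,2) g(1,2)] crosses_over_page[OF g(1,2) f(1,2)] f(3) g(3) by auto
  qed
qed

lemma divided_D: "\<exists>N\<le>(n + 1) div 2. divided_in_levels G D [0..<n] N"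
proof -
  let ?C = "cycle_support [0..<n] D" and ?F = "fragments G D [0..<n]"
  have "\<forall>f\<in>?F. \<exists>p. fst p < snd p \<and> snd p < n \<and> f = curve (fst p) (snd p) ` {x (fst p)..x (snd p)}"
    unfolding fragments_D by force
  then obtain ends where ends: "\<And>f. f \<in> ?F \<Longrightarrow> fst (ends f) < snd (ends f) \<and> snd (ends f) < n \<and>
      f = curve (fst (ends f)) (snd (ends f)) ` {x (fst (ends f))..x (snd (ends f))}" by metis
  have pages: "page n (ends g) < page n (ends f)" if "f \<in> ?F" "g \<in> ?F" "crosses_over f g" for f g
    using crosses_over_page[of "fst (ends f)" "snd (ends f)" "fst (ends g)" "snd (ends g)"]
      ends[OF that(1)] ends[OF that(2)] that(3) by simp
  have bound: "page n (ends f) < (n + 1) div 2" for f using n by (intro page_less) simp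
  have levels: "\<exists>N\<le>(n + 1) div 2. \<exists>L :: nat \<Rightarrow> R3 set set. inj_on L {1..N} \<and> partition_on ?F (L ` {1..N}) \<and>
     (1 \<le> N \<longrightarrow> L 1 = {f \<in> ?F. \<forall>g\<in>?F. g \<noteq> f \<longrightarrow> \<not> crosses_over f g}) \<and>
     (\<forall>i\<in>{2..N}. L i = {f \<in> ?F. (\<exists>g\<in>L (i - 1). crosses_over f g) \<and>
        (\<forall>g\<in>?F. crosses_over f g \<longrightarrow> (\<exists>k\<in>{1..<i}. g \<in> L k))})"
    by (rule levels_of_ranked_relation[of ?F "\<lambda>f. page n (ends f)"]) (rule bound, rule pages)
  have fstC: "fst ` ?C = frontier polygon" unfolding cycle_support_D by force
  have inner: "\<forall>f\<in>?F. fst ` (f - ?C) \<subseteq> inside (fst ` ?C)"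
  proof (intro ballI subsetI)
    fix f z assume f: "f \<in> ?F" and "z \<in> fst ` (f - ?C)"
    then obtain i j s where a: "i < j" "j < n" "\<not> side n i j" "s \<in> {x i..x j}"
      "curve i j s \<notin> ?C" "z = fst (curve i j s)"
      using f unfolding fragments_D by blast
    show "z \<in> inside (fst ` ?C)"
      unfolding fstC inside_frontier_polygon
      by (rule diagonal_inner_point[OF a(1-4)]) (use a vertex_in_cycle_support in auto)
  qed
  show ?thesis
    using levels
    by (simp only: divided_in_levels_def semi_leveled_D reduced_D eqTrueI[OF inner] simp_thms)
qed

end

lemma hamiltonian_level_number_complete_graph_le:
  assumes "3 \<le> n"
  shows "hamiltonian_level_number (complete_graph n) \<le> enat ((n + 1) div 2)"
proof -
  obtain x :: "nat \<Rightarrow> real" where x: "strict_mono x" "general_position (x ` {..<n})"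
    using general_position_sequence by blast
  interpret parabola_points n x using assms x(1) by unfold_locales
  have "\<forall>\<^sub>F K in at_top. 1 < K \<and> (\<forall>i j k l s. j < n \<longrightarrow> l < n \<longrightarrow> crossing i j k l s \<longrightarrow>
    x j - s < K * (s - x i) \<and> x l - s < K * (x j - s))"
    by (intro eventually_conj eventually_gt_at_top eventually_steep parabola_points_axioms)
  then obtain K :: real where "1 < K" "\<And>i j k l s. j < n \<Longrightarrow> l < n \<Longrightarrow> crossing i j k l s \<Longrightarrow>
      x j - s < K * (s - x i) \<and> x l - s < K * (x j - s)"
    using eventually_happens'[OF trivial_limit_at_top_linorder] by blast
  then interpret leveled_points n x K using x(2) by unfold_locales auto
  let ?\<G> = "to_S3 D"
  obtain N where N: "N \<le> (n + 1) div 2" "divided_in_levels G D [0..<n] N" using divided_D by blast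
  have "hamiltonian_level_number G \<le> spatial_hamiltonian_level_number G ?\<G>"
    unfolding hamiltonian_level_number_def
    using spatial_embedding_to_S3(2)[OF pl_embedding_D] by (intro INF_lower) simp
  also have "\<dots> \<le> enat N"
    unfolding spatial_hamiltonian_level_number_def
    using spatial_embedding_to_S3(1)[OF pl_embedding_D] hamiltonian_cycle_upt N(2)
    by (intro Inf_lower) blast
  also have "\<dots> \<le> enat ((n + 1) div 2)" using N(1) by simp
  finally show ?thesis .
qed

theorem proposition7:
  fixes n :: nat
  assumes "5 \<le> n"
  shows "hamiltonian_level_number (complete_graph n) = level_number (complete_graph n)
    \<and> level_number (complete_graph n) = book_thickness (complete_graph n)
    \<and> book_thickness (complete_graph n) = enat (nat \<lceil>real n / 2\<rceil>)"
proof -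
  let ?b = "enat (nat \<lceil>real n / 2\<rceil>)"
  have "nat \<lceil>real n / 2\<rceil> = (n + 1) div 2" by linarith
  then have "hamiltonian_level_number (complete_graph n) \<le> ?b"
    using hamiltonian_level_number_complete_graph_le[of n] assms by simp
  moreover have "?b \<le> level_number (complete_graph n)"
    by (rule complete_graph_level_number_ge[OF assms])
  moreover have "book_thickness (complete_graph n) = ?b"
    using assms by (intro book_thickness_complete_graph) simp
  ultimately show ?thesis
    using level_number_le_hamiltonian[of "complete_graph n"] by (auto intro: antisym order_trans)
qed

end
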